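(* Let $d\in\{1,2,3\}$, $p=1/2$, $\lambda_A=1$ and $0\le\lambda_B\le 1$. For DLAS on $\mathbb{Z}^d$ with these parameters, there exists a constant $C>0$ that does not depend on $\lambda_B$ such that $$\rho_t \ge C\,(t\log t)^{-d/4}$$ for all sufficiently large $t$.
   Context: DLAS (two-type diffusion-limited annihilating system) on a graph with vertex set $\mathcal V$ and jump rates $\lambda_A,\lambda_B\ge 0$ is a continuous-time Markov process $\zeta_t=(\zeta_t(v))_{v\in\mathcal V}$ on $\mathbb{Z}^{\mathcal V}$: $|\zeta_t(v)|$ is the number of particles at $v$ at time $t$, and these are all of type $A$ if $\zeta_t(v)>0$ and all of type $B$ if $\zeta_t(v)<0$. Particles move independently as continuous-time nearest-neighbor simple random walks, $A$-particles jumping at rate $\lambda_A$ and $B$-particles at rate $\lambda_B$. When a particle jumps onto a site containing a particle of the opposite type, it and one such particle are instantly both removed (mutual annihilation, pairwise). Any number of particles of the same type may share a site. Initially each vertex contains exactly one particle, which independently is of type $A$ with probability $p$ and of type $B$ with probability $1-p$. Let $N_t$ be the number of $A$-particles at the origin at time $t$ and $\rho_t=\mathbb{E}N_t$. *)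

theory Defs
  imports "HOL-Probability.Probability"
begin

text \<open>
  Two-type diffusion-limited annihilating systems (DLAS) on a locally finite graph, which is given
  by its neighbourhoods \<open>nbrs v\<close>. A configuration \<open>\<zeta>\<close> has \<open>\<bar>\<zeta> v\<bar>\<close> particles at \<open>v\<close>, all of type A
  if \<open>\<zeta> v > 0\<close> and all of type B if \<open>\<zeta> v < 0\<close>.
\<close>

type_synonym 'v config = "'v \<Rightarrow> int"

definition config_space :: "'v config measure" where
  "config_space = PiM UNIV (\<lambda>_. count_space UNIV)"

text \<open>
  An A-particle jumps from \<open>v\<close> to \<open>w\<close>. If \<open>\<zeta> w \<ge> 0\<close>, it joins the A-particles at \<open>w\<close>; if
  \<open>\<zeta> w < 0\<close>, it is removed together with one of the B-particles at \<open>w\<close>. With the sign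
  convention both cases amount to adding 1 at \<open>w\<close>. Symmetrically for a B-particle.
\<close>

definition jump_A :: "'v \<Rightarrow> 'v \<Rightarrow> 'v config \<Rightarrow> 'v config" where
  "jump_A v w \<zeta> = \<zeta>(v := \<zeta> v - 1, w := \<zeta> w + 1)"

definition jump_B :: "'v \<Rightarrow> 'v \<Rightarrow> 'v config \<Rightarrow> 'v config" where
  "jump_B v w \<zeta> = \<zeta>(v := \<zeta> v + 1, w := \<zeta> w - 1)"

text \<open>
  Generator of the system with finitely many particles: each A-particle jumps at rate \<open>rA\<close> and
  each B-particle at rate \<open>rB\<close>, independently, to a uniformly chosen neighbour. It is only
  meaningful at configurations of finite support.
\<close>

definition generator ::
  "('v \<Rightarrow> 'v set) \<Rightarrow> real \<Rightarrow> real \<Rightarrow> ('v config \<Rightarrow> real) \<Rightarrow> 'v config \<Rightarrow> real" where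
  "generator nbrs rA rB f \<zeta> =
     (\<Sum>v | \<zeta> v > 0. \<Sum>w\<in>nbrs v.
        rA * real_of_int (\<zeta> v) / real (card (nbrs v)) * (f (jump_A v w \<zeta>) - f \<zeta>)) +
     (\<Sum>v | \<zeta> v < 0. \<Sum>w\<in>nbrs v.
        rB * real_of_int (- \<zeta> v) / real (card (nbrs v)) * (f (jump_B v w \<zeta>) - f \<zeta>))"

text \<open>
  Transition semigroup \<open>exp (t L)\<close> of the system with finitely many particles. The number of
  particles never increases, so the generator \<open>L\<close> is bounded on the configurations that can be
  reached from a given one; hence for bounded \<open>f\<close> the series converges, and its value is the
  expectation of \<open>f\<close> at time \<open>t\<close> for the (non-explosive) Markov chain started from \<open>\<zeta>\<close>.
\<close>

definition finite_semigroup ::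
  "('v \<Rightarrow> 'v set) \<Rightarrow> real \<Rightarrow> real \<Rightarrow> real \<Rightarrow> ('v config \<Rightarrow> real) \<Rightarrow> 'v config \<Rightarrow> real" where
  "finite_semigroup nbrs rA rB t f \<zeta> =
     (\<Sum>n. t ^ n / fact n * (generator nbrs rA rB ^^ n) f \<zeta>)"

definition restrict_config :: "'v set \<Rightarrow> 'v config \<Rightarrow> 'v config" where
  "restrict_config F \<zeta> = (\<lambda>v. if v \<in> F then \<zeta> v else 0)"

text \<open>
  Infinite systems: only the particles in a finite set \<open>F\<close> of vertices are retained, and \<open>F\<close>
  exhausts the graph. The limit need not exist for configurations that grow too fast at infinity;
  the process started from one particle per vertex almost surely avoids these at any fixed time.
\<close>

definition semigroup_DLAS ::
  "('v \<Rightarrow> 'v set) \<Rightarrow> real \<Rightarrow> real \<Rightarrow> real \<Rightarrow> ('v config \<Rightarrow> real) \<Rightarrow> 'v config \<Rightarrow> real" where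
  "semigroup_DLAS nbrs rA rB t f \<zeta> =
     Lim (finite_subsets_at_top UNIV)
       (\<lambda>F. finite_semigroup nbrs rA rB t f (restrict_config F \<zeta>))"

definition bounded_cylinder :: "('v config \<Rightarrow> real) \<Rightarrow> bool" where
  "bounded_cylinder f \<longleftrightarrow>
     (\<exists>K. finite K \<and> (\<forall>\<zeta> \<zeta>'. (\<forall>v\<in>K. \<zeta> v = \<zeta>' v) \<longrightarrow> f \<zeta> = f \<zeta>')) \<and>
     (\<exists>b. \<forall>\<zeta>. \<bar>f \<zeta>\<bar> \<le> b)"

definition history :: "'a measure \<Rightarrow> (real \<Rightarrow> 'a \<Rightarrow> 'v config) \<Rightarrow> real \<Rightarrow> 'a measure" where
  "history M \<zeta> s =
     sigma (space M) {\<zeta> u -` E \<inter> space M | u E. 0 \<le> u \<and> u \<le> s \<and> E \<in> sets config_space}"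

text \<open>
  The values \<open>\<zeta> t\<close> at times \<open>t < 0\<close> are irrelevant.
\<close>

locale DLAS = prob_space M
  for M :: "'a measure"
  and nbrs :: "'v \<Rightarrow> 'v set"
  and rA rB p :: real
  and \<zeta> :: "real \<Rightarrow> 'a \<Rightarrow> 'v config" +
  assumes measurable: "t \<ge> 0 \<Longrightarrow> \<zeta> t \<in> measurable M config_space"
    and initial_law:
      "distr M config_space (\<zeta> 0) =
         PiM UNIV (\<lambda>_. measure_pmf (map_pmf (\<lambda>isA. if isA then 1 else - 1) (bernoulli_pmf p)))"
    and markov:
      "s \<ge> 0 \<Longrightarrow> t \<ge> 0 \<Longrightarrow> bounded_cylinder f \<Longrightarrow>
         AE \<omega> in M. real_cond_exp M (history M \<zeta> s) (\<lambda>\<omega>. f (\<zeta> (s + t) \<omega>)) \<omega> =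
                    semigroup_DLAS nbrs rA rB t f (\<zeta> s \<omega>)"

definition num_A :: "(real \<Rightarrow> 'a \<Rightarrow> 'v config) \<Rightarrow> 'v \<Rightarrow> real \<Rightarrow> 'a \<Rightarrow> nat" where
  "num_A \<zeta> v t \<omega> = nat (\<zeta> t \<omega> v)"

definition density_A :: "'a measure \<Rightarrow> (real \<Rightarrow> 'a \<Rightarrow> 'v config) \<Rightarrow> 'v \<Rightarrow> real \<Rightarrow> real" where
  "density_A M \<zeta> v t = (\<integral>\<omega>. real (num_A \<zeta> v t \<omega>) \<partial>M)"

definition lattice_nbrs :: "int ^ 'd \<Rightarrow> (int ^ 'd) set" where
  "lattice_nbrs v = {w. (\<Sum>i\<in>UNIV. \<bar>w $ i - v $ i\<bar>) = 1}"

end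

theory Submission
  imports Defs
begin

text \<open>
  Adding one A-particle (or deleting one B-particle) at \<open>x\<close> creates a single discrepancy, which
  performs a random walk of jump rate at most 1 as long as it lives, whatever the rest of the system
  does. Hence the influence of the initial state at \<open>x\<close> on the state at \<open>y\<close> at time \<open>t\<close> is
  bounded by exponential supermartingales of this walk, and is negligible at distance
  \<open>R = 4 \<surd>(t log t)\<close>.

  Let \<open>Y\<close> be the initial charge (number of A-particles minus number of B-particles) of the cube
  of radius \<open>R\<close>. Charge is conserved, so resampling the initial state in this cube changes
  the charge of the cube of radius \<open>2 R\<close> at time \<open>t\<close> by the change of \<open>Y\<close>, up to the
  negligible charge that leaves. As the mean charge vanishes, the expected number of A-particles in the
  larger cube is at least about \<open>E Y\<^sup>+\<close>, which has order \<open>R\<^bsup>d/2\<^esup>\<close>. By translation invariance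
  this number is \<open>\<rho>\<^sub>t\<close> times the volume \<open>(4 R + 1)\<^bsup>d\<^esup>\<close>.
\<close>

section \<open>Finite systems\<close>

text \<open>No coupled process is built. The discrepancy walk is read off the generator:
  \<open>lip\<close> bounds the effect of one unit of charge, site by site, and powers of
  \<open>N + gen\<close> carry this bound to time t. All constants are uniform in \<open>rB\<close>
  because both rates are at most 1. When \<open>rB\<close> < 1, exchanging A and B is not a
  symmetry, so the vanishing mean charge needs its own argument: the mean charge of a site changes
  at the rate of a discrete Laplacian of a mean flow, which vanishes by translation invariance in
  the limit of large finite systems. Two weights are used. \<open>decay\<close> is summable and lets
  finite systems approximate the infinite one at fixed t; its factor exp((e - 1) t) is harmless
  there. \<open>barrier\<close> has the small rate \<theta>^2 and governs the scale R. With \<theta>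
  = sqrt(log t / t) the escape bound per site is of order exp(\<theta>^2 t - \<theta> R) \<le>
  t^(-3), which for d \<le> 3 beats the volume of the cube. Given the initial charge Y of the small
  cube, the larger cube has mean charge a + Y up to the error, with a nearly 0. Testing this against
  the event Y > 0 produces E Y^+.\<close>

definition supp :: "'v config \<Rightarrow> 'v set" where
  "supp \<zeta> = {v. \<zeta> v \<noteq> 0}"

definition mass :: "'v config \<Rightarrow> real" where
  "mass \<zeta> = (\<Sum>v\<in>supp \<zeta>. \<bar>real_of_int (\<zeta> v)\<bar>)"

definition configs :: "real \<Rightarrow> 'v config set" where
  "configs N = {\<zeta>. finite (supp \<zeta>) \<and> mass \<zeta> \<le> N}"

definition pos :: "int \<Rightarrow> real" where "pos z = real_of_int (max z 0)"

definition incr :: "'v \<Rightarrow> 'v config \<Rightarrow> 'v config" where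
  "incr x \<zeta> = \<zeta>(x := \<zeta> x + 1)"

lemma pos_nonneg [simp]: "0 \<le> pos z"
  by (simp add: pos_def)

lemma mass_eq: "finite V \<Longrightarrow> supp \<zeta> \<subseteq> V \<Longrightarrow> mass \<zeta> = (\<Sum>v\<in>V. \<bar>real_of_int (\<zeta> v)\<bar>)"
  unfolding mass_def by (rule sum.mono_neutral_left) (auto simp: supp_def)

lemma supp_jump: "supp (jump_A v w \<zeta>) \<subseteq> insert v (insert w (supp \<zeta>))"
    "supp (jump_B v w \<zeta>) \<subseteq> insert v (insert w (supp \<zeta>))"
  by (auto simp: supp_def jump_A_def jump_B_def split: if_splits)

lemma abs_coord_le_mass:
  assumes "finite (supp \<zeta>)"
  shows "\<bar>real_of_int (\<zeta> x)\<bar> \<le> mass \<zeta>"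
proof -
  have "\<bar>real_of_int (\<zeta> x)\<bar> \<le> (\<Sum>v\<in>insert x (supp \<zeta>). \<bar>real_of_int (\<zeta> v)\<bar>)"
    using assms by (intro member_le_sum) auto
  also have "\<dots> = mass \<zeta>"
    by (rule mass_eq[symmetric]) (use assms in auto)
  finally show ?thesis .
qed

text \<open>The site left loses one particle and the target gains at most one, or loses one by
  annihilation. This confines the dynamics to \<open>configs N\<close>, on which the generator is
  bounded.\<close>

lemma mass_jump_le:
  assumes fin: "finite (supp \<zeta>)" and "v \<noteq> w"
    and j: "\<zeta>' = jump_A v w \<zeta> \<and> \<zeta> v > 0 \<or> \<zeta>' = jump_B v w \<zeta> \<and> \<zeta> v < 0"
  shows "mass \<zeta>' \<le> mass \<zeta>"
proof -
  let ?V = "insert v (insert w (supp \<zeta>))"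
  let ?U = "supp \<zeta> - {v, w}"
  have V: "?V = insert v (insert w ?U)" by auto
  have "mass \<zeta>' = (\<Sum>u\<in>?V. \<bar>real_of_int (\<zeta>' u)\<bar>)"
    using fin j supp_jump[of v w \<zeta>] by (intro mass_eq) auto
  also have "\<dots> = \<bar>real_of_int (\<zeta>' v)\<bar> + \<bar>real_of_int (\<zeta>' w)\<bar> + (\<Sum>u\<in>?U. \<bar>real_of_int (\<zeta>' u)\<bar>)"
    unfolding V using fin \<open>v \<noteq> w\<close> by simp
  also have "(\<Sum>u\<in>?U. \<bar>real_of_int (\<zeta>' u)\<bar>) = (\<Sum>u\<in>?U. \<bar>real_of_int (\<zeta> u)\<bar>)"
    using j by (intro sum.cong) (auto simp: jump_A_def jump_B_def)
  also have "\<bar>real_of_int (\<zeta>' v)\<bar> + \<bar>real_of_int (\<zeta>' w)\<bar> + (\<Sum>u\<in>?U. \<bar>real_of_int (\<zeta> u)\<bar>)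
      \<le> \<bar>real_of_int (\<zeta> v)\<bar> + \<bar>real_of_int (\<zeta> w)\<bar> + (\<Sum>u\<in>?U. \<bar>real_of_int (\<zeta> u)\<bar>)"
    using j \<open>v \<noteq> w\<close> by (auto simp: jump_A_def jump_B_def)
  also have "\<dots> = (\<Sum>u\<in>?V. \<bar>real_of_int (\<zeta> u)\<bar>)"
    unfolding V using fin \<open>v \<noteq> w\<close> by simp
  also have "\<dots> = mass \<zeta>"
    by (rule mass_eq[symmetric]) (use fin in auto)
  finally show ?thesis .
qed

lemma jump_in_configs:
  assumes "\<zeta> \<in> configs N" "v \<noteq> w"
  shows "\<zeta> v > 0 \<Longrightarrow> jump_A v w \<zeta> \<in> configs N" "\<zeta> v < 0 \<Longrightarrow> jump_B v w \<zeta> \<in> configs N"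
  using assms mass_jump_le[of \<zeta> v w "jump_A v w \<zeta>"] mass_jump_le[of \<zeta> v w "jump_B v w \<zeta>"]
    finite_subset[OF supp_jump(1)[of v w \<zeta>]] finite_subset[OF supp_jump(2)[of v w \<zeta>]]
  by (auto simp: configs_def)

text \<open>The normalisation of both rates to at most 1 makes the total jump rate at most the mass
  and the discrepancy walk at most as fast as a rate 1 walk, whatever the rates are.\<close>

locale annihilation_graph =
  fixes nbrs :: "'v \<Rightarrow> 'v set" and rA rB :: real
  assumes finite_nbrs: "finite (nbrs v)"
    and nbrs_nonempty: "nbrs v \<noteq> {}"
    and nbrs_irrefl: "v \<notin> nbrs v"
    and rA: "0 \<le> rA" "rA \<le> 1"
    and rB: "0 \<le> rB" "rB \<le> 1"
begin

definition avg :: "'v \<Rightarrow> ('v \<Rightarrow> real) \<Rightarrow> real" where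
  "avg v g = (\<Sum>w\<in>nbrs v. g w) / real (card (nbrs v))"

abbreviation gen :: "('v config \<Rightarrow> real) \<Rightarrow> 'v config \<Rightarrow> real" where
  "gen \<equiv> generator nbrs rA rB"

abbreviation semi :: "real \<Rightarrow> ('v config \<Rightarrow> real) \<Rightarrow> 'v config \<Rightarrow> real" where
  "semi \<equiv> finite_semigroup nbrs rA rB"

lemma card_nbrs_pos: "card (nbrs v) > 0"
  using finite_nbrs nbrs_nonempty by (simp add: card_gt_0_iff)

lemma avg_diff: "avg v (\<lambda>w. g w - h w) = avg v g - avg v h"
  by (simp add: avg_def sum_subtractf diff_divide_distrib)

lemma avg_const [simp]: "avg v (\<lambda>_. a) = a"
  using card_nbrs_pos[of v] by (simp add: avg_def)

lemma avg_mono: "(\<And>w. w \<in> nbrs v \<Longrightarrow> g w \<le> h w) \<Longrightarrow> avg v g \<le> avg v h"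
  by (simp add: avg_def divide_right_mono sum_mono)

lemma avg_cong: "(\<And>w. w \<in> nbrs v \<Longrightarrow> g w = h w) \<Longrightarrow> avg v g = avg v h"
  by (simp add: avg_def)

lemma abs_avg_le:
  assumes "\<And>w. w \<in> nbrs v \<Longrightarrow> \<bar>g w\<bar> \<le> h w"
  shows "\<bar>avg v g\<bar> \<le> avg v h"
proof -
  have "\<bar>\<Sum>w\<in>nbrs v. g w\<bar> \<le> (\<Sum>w\<in>nbrs v. h w)"
    using assms by (intro order.trans[OF sum_abs] sum_mono) auto
  thus ?thesis by (simp add: avg_def divide_right_mono abs_divide)
qed

lemma abs_avg_le_const: "(\<And>w. w \<in> nbrs v \<Longrightarrow> \<bar>g w\<bar> \<le> b) \<Longrightarrow> \<bar>avg v g\<bar> \<le> b"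
  using abs_avg_le[of v g "\<lambda>_. b"] by simp

text \<open>The freedom in V allows two configurations with different supports to be compared over
  one index set.\<close>

lemma gen_eq:
  assumes "finite V" "supp \<zeta> \<subseteq> V"
  shows "gen f \<zeta> = (\<Sum>v\<in>V. rA * pos (\<zeta> v) * avg v (\<lambda>w. f (jump_A v w \<zeta>) - f \<zeta>) +
                           rB * pos (- \<zeta> v) * avg v (\<lambda>w. f (jump_B v w \<zeta>) - f \<zeta>))"
proof -
  have "(\<Sum>v\<in>V. rA * pos (\<zeta> v) * avg v (\<lambda>w. f (jump_A v w \<zeta>) - f \<zeta>)) =
     (\<Sum>v | \<zeta> v > 0. \<Sum>w\<in>nbrs v.
        rA * real_of_int (\<zeta> v) / real (card (nbrs v)) * (f (jump_A v w \<zeta>) - f \<zeta>))"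
  proof (rule sum.mono_neutral_cong_right)
    show "{v. \<zeta> v > 0} \<subseteq> V" using assms by (auto simp: supp_def)
  next
    show "\<And>x. x \<in> {v. \<zeta> v > 0} \<Longrightarrow> rA * pos (\<zeta> x) * avg x (\<lambda>w. f (jump_A x w \<zeta>) - f \<zeta>) =
       (\<Sum>w\<in>nbrs x. rA * real_of_int (\<zeta> x) / real (card (nbrs x)) * (f (jump_A x w \<zeta>) - f \<zeta>))"
      unfolding sum_distrib_left[symmetric] by (auto simp: pos_def avg_def max_def)
  qed (use assms in \<open>auto simp: pos_def max_def\<close>)
  moreover have "(\<Sum>v\<in>V. rB * pos (- \<zeta> v) * avg v (\<lambda>w. f (jump_B v w \<zeta>) - f \<zeta>)) =
     (\<Sum>v | \<zeta> v < 0. \<Sum>w\<in>nbrs v.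
        rB * real_of_int (- \<zeta> v) / real (card (nbrs v)) * (f (jump_B v w \<zeta>) - f \<zeta>))"
  proof (rule sum.mono_neutral_cong_right)
    show "{v. \<zeta> v < 0} \<subseteq> V" using assms by (auto simp: supp_def)
  next
    show "\<And>x. x \<in> {v. \<zeta> v < 0} \<Longrightarrow> rB * pos (- \<zeta> x) * avg x (\<lambda>w. f (jump_B x w \<zeta>) - f \<zeta>) =
       (\<Sum>w\<in>nbrs x. rB * real_of_int (- \<zeta> x) / real (card (nbrs x)) * (f (jump_B x w \<zeta>) - f \<zeta>))"
      unfolding sum_distrib_left[symmetric] by (auto simp: pos_def avg_def max_def)
  qed (use assms in \<open>auto simp: pos_def max_def\<close>)
  ultimately show ?thesis
    by (simp add: generator_def sum.distrib)
qed

definition rate :: "'v config \<Rightarrow> real" where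
  "rate \<zeta> = (\<Sum>v\<in>supp \<zeta>. rA * pos (\<zeta> v) + rB * pos (- \<zeta> v))"

lemma rate_eq:
  "finite V \<Longrightarrow> supp \<zeta> \<subseteq> V \<Longrightarrow> rate \<zeta> = (\<Sum>v\<in>V. rA * pos (\<zeta> v) + rB * pos (- \<zeta> v))"
  unfolding rate_def by (rule sum.mono_neutral_left) (auto simp: supp_def pos_def)

lemma rate_le_mass: "rate \<zeta> \<le> mass \<zeta>"
  unfolding rate_def mass_def
proof (intro sum_mono)
  fix v
  have "rA * pos (\<zeta> v) \<le> 1 * pos (\<zeta> v)" "rB * pos (- \<zeta> v) \<le> 1 * pos (- \<zeta> v)"
    using rA rB by (intro mult_right_mono; simp)+
  thus "rA * pos (\<zeta> v) + rB * pos (- \<zeta> v) \<le> \<bar>real_of_int (\<zeta> v)\<bar>"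
    by (auto simp: pos_def max_def split: if_splits)
qed

lemma rate_le: "\<zeta> \<in> configs N \<Longrightarrow> rate \<zeta> \<le> N"
  using rate_le_mass[of \<zeta>] by (simp add: configs_def)

text \<open>Splits the generator into gains, which are monotone in f, and the loss term; only the
  latter is an obstacle to positivity.\<close>

lemma gen_eq_rate:
  assumes "finite (supp \<zeta>)"
  shows "gen f \<zeta> = (\<Sum>v\<in>supp \<zeta>. rA * pos (\<zeta> v) * avg v (\<lambda>w. f (jump_A v w \<zeta>)) +
                           rB * pos (- \<zeta> v) * avg v (\<lambda>w. f (jump_B v w \<zeta>))) - rate \<zeta> * f \<zeta>"
  unfolding gen_eq[OF assms order.refl] rate_def sum_distrib_right sum_subtractf[symmetric] avg_diff
  by (intro sum.cong) (auto simp: algebra_simps)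

text \<open>Uniformisation: adding \<open>N\<close> times the identity to the generator makes it a positive operator on
  the configurations with at most \<open>N\<close> particles.\<close>

definition ugen :: "real \<Rightarrow> ('v config \<Rightarrow> real) \<Rightarrow> 'v config \<Rightarrow> real" where
  "ugen N f \<zeta> = N * f \<zeta> + gen f \<zeta>"

text \<open>Jumps from \<open>configs N\<close> stay in \<open>configs N\<close>, so only values
  there enter. In the form \<open>semi_local\<close> this later replaces observables by others that
  agree with them only for bounded mass, such as a truncated particle number.\<close>

lemma gen_local:
  assumes "\<And>\<zeta>. \<zeta> \<in> configs N \<Longrightarrow> f \<zeta> = g \<zeta>" "\<zeta> \<in> configs N"
  shows "gen f \<zeta> = gen g \<zeta>"
proof -
  have V: "finite (supp \<zeta>)" using assms by (simp add: configs_def)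
  have "rA * pos (\<zeta> v) * avg v (\<lambda>w. f (jump_A v w \<zeta>) - f \<zeta>) +
         rB * pos (- \<zeta> v) * avg v (\<lambda>w. f (jump_B v w \<zeta>) - f \<zeta>) =
      rA * pos (\<zeta> v) * avg v (\<lambda>w. g (jump_A v w \<zeta>) - g \<zeta>) +
         rB * pos (- \<zeta> v) * avg v (\<lambda>w. g (jump_B v w \<zeta>) - g \<zeta>)" for v
  proof (cases "\<zeta> v" "0::int" rule: linorder_cases)
    case less
    have "avg v (\<lambda>w. f (jump_B v w \<zeta>) - f \<zeta>) = avg v (\<lambda>w. g (jump_B v w \<zeta>) - g \<zeta>)"
      by (rule avg_cong) (use less assms nbrs_irrefl jump_in_configs(2) in \<open>metis\<close>)
    with less show ?thesis by (simp add: pos_def)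
  next
    case greater
    have "avg v (\<lambda>w. f (jump_A v w \<zeta>) - f \<zeta>) = avg v (\<lambda>w. g (jump_A v w \<zeta>) - g \<zeta>)"
      by (rule avg_cong) (use greater assms nbrs_irrefl jump_in_configs(1) in \<open>metis\<close>)
    with greater show ?thesis by (simp add: pos_def)
  qed (simp add: pos_def)
  thus ?thesis unfolding gen_eq[OF V order.refl] by simp
qed

lemma gen_power_local:
  assumes "\<And>\<zeta>. \<zeta> \<in> configs N \<Longrightarrow> f \<zeta> = g \<zeta>" "\<zeta> \<in> configs N"
  shows "(gen ^^ n) f \<zeta> = (gen ^^ n) g \<zeta>"
  using assms(2)
proof (induction n arbitrary: \<zeta>)
  case (Suc n)
  show ?case unfolding funpow.simps o_def by (rule gen_local[OF _ Suc.prems]) (rule Suc.IH)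
qed (use assms in auto)

lemma semi_local:
  assumes "\<And>\<zeta>. \<zeta> \<in> configs N \<Longrightarrow> f \<zeta> = g \<zeta>" "\<zeta> \<in> configs N"
  shows "semi t f \<zeta> = semi t g \<zeta>"
  unfolding finite_semigroup_def using gen_power_local[OF assms] by simp

text \<open>A jump changes f by at most 2 b, and jumps occur at total rate at most N.\<close>

lemma abs_gen_le:
  assumes f: "\<And>\<zeta>. \<zeta> \<in> configs N \<Longrightarrow> \<bar>f \<zeta>\<bar> \<le> b" and \<zeta>: "\<zeta> \<in> configs N"
  shows "\<bar>gen f \<zeta>\<bar> \<le> 2 * N * b"
proof -
  have V: "finite (supp \<zeta>)" using \<zeta> by (simp add: configs_def)
  have b: "0 \<le> b" using f[OF \<zeta>] by linarith
  have "\<bar>gen f \<zeta>\<bar> \<le> (\<Sum>v\<in>supp \<zeta>. (rA * pos (\<zeta> v) + rB * pos (- \<zeta> v)) * (2 * b))"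
    unfolding gen_eq[OF V order.refl]
  proof (intro order.trans[OF sum_abs] sum_mono)
    fix v
    show "\<bar>rA * pos (\<zeta> v) * avg v (\<lambda>w. f (jump_A v w \<zeta>) - f \<zeta>) +
         rB * pos (- \<zeta> v) * avg v (\<lambda>w. f (jump_B v w \<zeta>) - f \<zeta>)\<bar>
        \<le> (rA * pos (\<zeta> v) + rB * pos (- \<zeta> v)) * (2 * b)"
    proof (cases "\<zeta> v" "0::int" rule: linorder_cases)
      case less
      have "\<bar>avg v (\<lambda>w. f (jump_B v w \<zeta>) - f \<zeta>)\<bar> \<le> 2 * b"
      proof (rule abs_avg_le_const)
        fix w assume "w \<in> nbrs v"
        hence "jump_B v w \<zeta> \<in> configs N"
          using less \<zeta> nbrs_irrefl jump_in_configs(2) by metis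
        from f[OF this] f[OF \<zeta>] show "\<bar>f (jump_B v w \<zeta>) - f \<zeta>\<bar> \<le> 2 * b" by linarith
      qed
      hence "rB * pos (- \<zeta> v) * \<bar>avg v (\<lambda>w. f (jump_B v w \<zeta>) - f \<zeta>)\<bar> \<le> rB * pos (- \<zeta> v) * (2 * b)"
        using rB by (intro mult_left_mono) auto
      with less rB show ?thesis by (simp add: pos_def abs_mult max_def)
    next
      case greater
      have "\<bar>avg v (\<lambda>w. f (jump_A v w \<zeta>) - f \<zeta>)\<bar> \<le> 2 * b"
      proof (rule abs_avg_le_const)
        fix w assume "w \<in> nbrs v"
        hence "jump_A v w \<zeta> \<in> configs N"
          using greater \<zeta> nbrs_irrefl jump_in_configs(1) by metis
        from f[OF this] f[OF \<zeta>] show "\<bar>f (jump_A v w \<zeta>) - f \<zeta>\<bar> \<le> 2 * b" by linarith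
      qed
      hence "rA * pos (\<zeta> v) * \<bar>avg v (\<lambda>w. f (jump_A v w \<zeta>) - f \<zeta>)\<bar> \<le> rA * pos (\<zeta> v) * (2 * b)"
        using rA by (intro mult_left_mono) auto
      with greater rA show ?thesis by (simp add: pos_def abs_mult max_def)
    qed (simp add: pos_def)
  qed
  also have "\<dots> = rate \<zeta> * (2 * b)" by (simp add: rate_def sum_distrib_right)
  also have "\<dots> \<le> N * (2 * b)" using rate_le[OF \<zeta>] b by (intro mult_right_mono) auto
  finally show ?thesis by simp
qed

lemma abs_gen_power_le:
  assumes f: "\<And>\<zeta>. \<zeta> \<in> configs N \<Longrightarrow> \<bar>f \<zeta>\<bar> \<le> b" and \<zeta>: "\<zeta> \<in> configs N"
  shows "\<bar>(gen ^^ n) f \<zeta>\<bar> \<le> (2 * N) ^ n * b"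
  using \<zeta>
proof (induction n arbitrary: \<zeta>)
  case (Suc n)
  have "\<bar>gen ((gen ^^ n) f) \<zeta>\<bar> \<le> 2 * N * ((2 * N) ^ n * b)"
    by (rule abs_gen_le[OF Suc.IH Suc.prems])
  thus ?case by (simp add: mult.assoc)
qed (use f in auto)

section \<open>Linearity and differentiability of the semigroup\<close>

lemma gen_add: "gen (\<lambda>\<zeta>. f \<zeta> + g \<zeta>) = (\<lambda>\<zeta>. gen f \<zeta> + gen g \<zeta>)"
proof
  have eq: "r * ((y + y') - (z + z')) = r * (y - z) + r * (y' - z')" for r y z y' z' :: real
    by (simp add: algebra_simps)
  show "gen (\<lambda>\<zeta>. f \<zeta> + g \<zeta>) \<zeta> = gen f \<zeta> + gen g \<zeta>" for \<zeta>
    by (simp only: generator_def eq sum.distrib ac_simps)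
qed

lemma gen_cmult: "gen (\<lambda>\<zeta>. a * f \<zeta>) = (\<lambda>\<zeta>. a * gen f \<zeta>)"
proof
  have eq: "r * (a * y - a * z) = a * (r * (y - z))" for r y z :: real
    by (simp add: algebra_simps)
  show "gen (\<lambda>\<zeta>. a * f \<zeta>) \<zeta> = a * gen f \<zeta>" for \<zeta>
    by (simp only: generator_def eq sum_distrib_left distrib_left)
qed

lemma gen_zero: "gen (\<lambda>\<zeta>. 0) = (\<lambda>\<zeta>. 0)"
  by (simp add: generator_def fun_eq_iff)

lemma gen_sum: "gen (\<lambda>\<zeta>. \<Sum>i\<in>I. f i \<zeta>) = (\<lambda>\<zeta>. \<Sum>i\<in>I. gen (f i) \<zeta>)"
  by (induction I rule: infinite_finite_induct) (simp_all add: gen_zero gen_add)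

lemma gen_power_add: "(gen ^^ n) (\<lambda>\<zeta>. f \<zeta> + g \<zeta>) = (\<lambda>\<zeta>. (gen ^^ n) f \<zeta> + (gen ^^ n) g \<zeta>)"
  by (induction n) (simp_all add: gen_add)

lemma gen_power_cmult: "(gen ^^ n) (\<lambda>\<zeta>. a * f \<zeta>) = (\<lambda>\<zeta>. a * (gen ^^ n) f \<zeta>)"
  by (induction n) (simp_all add: gen_cmult)

text \<open>Despite the name this is two-sided: f is bounded on the configurations of mass at most
  N. Unbounded observables such as the charge satisfy it for every N.\<close>

definition bounded_below :: "real \<Rightarrow> ('v config \<Rightarrow> real) \<Rightarrow> bool" where
  "bounded_below N f \<longleftrightarrow> (\<exists>b. \<forall>\<zeta>\<in>configs N. \<bar>f \<zeta>\<bar> \<le> b)"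

text \<open>The n-th power of the generator grows like (2 N)^n, so the exponential series of 2 N |t|
  dominates.\<close>

lemma semi_summable:
  assumes "bounded_below N f" "\<zeta> \<in> configs N"
  shows "summable (\<lambda>n. \<bar>t ^ n / fact n * (gen ^^ n) f \<zeta>\<bar>)"
proof -
  obtain b where b: "\<And>\<zeta>. \<zeta> \<in> configs N \<Longrightarrow> \<bar>f \<zeta>\<bar> \<le> b"
    using assms by (auto simp: bounded_below_def)
  show ?thesis
  proof (rule summable_comparison_test')
    show "summable (\<lambda>n. (inverse (fact n) * (\<bar>t\<bar> * (2 * N)) ^ n) * b)"
      by (intro summable_mult2 summable_exp)
  next
    fix n :: nat
    have "\<bar>t\<bar> ^ n / fact n * \<bar>(gen ^^ n) f \<zeta>\<bar> \<le> \<bar>t\<bar> ^ n / fact n * ((2 * N) ^ n * b)"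
      by (intro mult_left_mono abs_gen_power_le b assms) auto
    thus "norm \<bar>t ^ n / fact n * (gen ^^ n) f \<zeta>\<bar> \<le> inverse (fact n) * (\<bar>t\<bar> * (2 * N)) ^ n * b"
      by (simp add: abs_mult power_abs field_simps power_mult_distrib)
  qed
qed

lemmas semi_summable' = summable_rabs_cancel[OF semi_summable]

lemma semi_add:
  assumes "bounded_below N f" "bounded_below N g" "\<zeta> \<in> configs N"
  shows "semi t (\<lambda>\<zeta>. f \<zeta> + g \<zeta>) \<zeta> = semi t f \<zeta> + semi t g \<zeta>"
  unfolding finite_semigroup_def gen_power_add distrib_left
  by (rule suminf_add[symmetric]; rule semi_summable'; fact)

lemma semi_cmult:
  assumes "bounded_below N f" "\<zeta> \<in> configs N"
  shows "semi t (\<lambda>\<zeta>. a * f \<zeta>) \<zeta> = a * semi t f \<zeta>"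
  unfolding finite_semigroup_def gen_power_cmult mult.left_commute[of _ a]
  by (rule suminf_mult; rule semi_summable'; fact)

lemma bounded_below_add: "bounded_below N f \<Longrightarrow> bounded_below N g \<Longrightarrow> bounded_below N (\<lambda>\<zeta>. f \<zeta> + g \<zeta>)"
  unfolding bounded_below_def by (meson abs_triangle_ineq add_mono order.trans)

lemma bounded_below_cmult: "bounded_below N f \<Longrightarrow> bounded_below N (\<lambda>\<zeta>. a * f \<zeta>)"
  unfolding bounded_below_def by (metis abs_ge_zero abs_mult mult_left_mono)

lemma bounded_below_diff: "bounded_below N f \<Longrightarrow> bounded_below N g \<Longrightarrow> bounded_below N (\<lambda>\<zeta>. f \<zeta> - g \<zeta>)"
  using bounded_below_add[of N f "\<lambda>\<zeta>. -1 * g \<zeta>"] bounded_below_cmult[of N g "-1"] by simp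

lemma bounded_below_zero: "bounded_below N (\<lambda>\<zeta>. 0)"
  unfolding bounded_below_def by auto

lemma bounded_below_sum:
  "(\<And>i. i \<in> I \<Longrightarrow> bounded_below N (f i)) \<Longrightarrow> bounded_below N (\<lambda>\<zeta>. \<Sum>i\<in>I. f i \<zeta>)"
  by (induction I rule: infinite_finite_induct) (simp_all add: bounded_below_zero bounded_below_add)

lemma semi_diff:
  assumes "bounded_below N f" "bounded_below N g" "\<zeta> \<in> configs N"
  shows "semi t (\<lambda>\<zeta>. f \<zeta> - g \<zeta>) \<zeta> = semi t f \<zeta> - semi t g \<zeta>"
  using semi_add[of N f "\<lambda>\<zeta>. -1 * g \<zeta>"] semi_cmult[of N g \<zeta> t "-1"] bounded_below_cmult[of N g "-1"] assms
  by simp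

lemma semi_zero: "semi t (\<lambda>\<zeta>. 0) \<zeta> = 0"
proof -
  have "(gen ^^ n) (\<lambda>\<zeta>. 0) = (\<lambda>\<zeta>. 0)" for n
    by (induction n) (simp_all add: gen_zero)
  thus ?thesis by (simp add: finite_semigroup_def)
qed

lemma semi_sum:
  assumes "\<And>i. i \<in> I \<Longrightarrow> bounded_below N (f i)" "\<zeta> \<in> configs N"
  shows "semi t (\<lambda>\<zeta>. \<Sum>i\<in>I. f i \<zeta>) \<zeta> = (\<Sum>i\<in>I. semi t (f i) \<zeta>)"
  using assms(1)
proof (induction I rule: infinite_finite_induct)
  case (insert i I)
  have "semi t (\<lambda>\<zeta>. f i \<zeta> + (\<Sum>i\<in>I. f i \<zeta>)) \<zeta> = semi t (f i) \<zeta> + semi t (\<lambda>\<zeta>. \<Sum>i\<in>I. f i \<zeta>) \<zeta>"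
    using insert.prems by (intro semi_add[OF _ _ assms(2)] bounded_below_sum) auto
  with insert show ?case by simp
qed (simp_all add: semi_zero)

text \<open>For fixed f and \<zeta> the semigroup is an everywhere convergent power series in t;
  termwise differentiation shifts the powers of the generator by one.\<close>

lemma has_derivative_semi:
  assumes "bounded_below N f" "\<zeta> \<in> configs N"
  shows "((\<lambda>t. semi t f \<zeta>) has_real_derivative semi t (gen f) \<zeta>) (at t)"
proof -
  define c where "c n = (gen ^^ n) f \<zeta> / fact n" for n
  have s: "summable (\<lambda>n. c n * x ^ n)" for x
    using semi_summable'[OF assms, of x] by (simp add: c_def mult_ac)
  have "((\<lambda>x. \<Sum>n. c n * x ^ n) has_field_derivative (\<Sum>n. diffs c n * t ^ n)) (at t)"
    by (rule termdiffs_strong_converges_everywhere) (rule s)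
  moreover have "diffs c n * t ^ n = t ^ n / fact n * (gen ^^ n) (gen f) \<zeta>" for n
  proof -
    have "(gen ^^ n) (gen f) = (gen ^^ Suc n) f" by (simp add: funpow_swap1)
    moreover have "real (Suc n) / fact (Suc n) = 1 / fact n"
      by (simp add: fact_Suc del: of_nat_Suc)
    moreover have "diffs c n * t ^ n = real (Suc n) / fact (Suc n) * ((gen ^^ Suc n) f \<zeta> * t ^ n)"
      by (simp add: diffs_def c_def del: funpow.simps of_nat_Suc fact_Suc)
    ultimately show ?thesis by simp
  qed
  ultimately show ?thesis
    by (simp add: finite_semigroup_def c_def mult_ac)
qed

section \<open>Positivity through uniformisation\<close>

lemma ugen_power:
  "(ugen N ^^ n) f \<zeta> = (\<Sum>k\<le>n. real (n choose k) * N ^ (n - k) * (gen ^^ k) f \<zeta>)"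
proof (induction n arbitrary: \<zeta>)
  case (Suc n)
  define g where "g k = (gen ^^ k) f \<zeta>" for k
  have "(ugen N ^^ Suc n) f \<zeta> = N * (ugen N ^^ n) f \<zeta> + gen ((ugen N ^^ n) f) \<zeta>"
    by (simp add: ugen_def)
  also have "(ugen N ^^ n) f = (\<lambda>\<zeta>. \<Sum>k\<le>n. real (n choose k) * N ^ (n - k) * (gen ^^ k) f \<zeta>)"
    using Suc.IH by auto
  also have "gen \<dots> \<zeta> = (\<Sum>k\<le>n. real (n choose k) * N ^ (n - k) * g (Suc k))"
    by (simp add: gen_sum gen_cmult g_def)
  also have "N * (\<Sum>k\<le>n. real (n choose k) * N ^ (n - k) * (gen ^^ k) f \<zeta>) =
      (\<Sum>k\<le>n. real (n choose k) * N ^ (Suc n - k) * g k)"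
    by (simp add: sum_distrib_left g_def Suc_diff_le mult_ac)
  also have "\<dots> = (\<Sum>k\<le>Suc n. real (n choose k) * N ^ (Suc n - k) * g k)"
    by simp
  also have "\<dots> = N ^ Suc n * g 0 + (\<Sum>k\<le>n. real (n choose Suc k) * N ^ (n - k) * g (Suc k))"
    by (subst sum.atMost_Suc_shift) simp
  also have "\<dots> + (\<Sum>k\<le>n. real (n choose k) * N ^ (n - k) * g (Suc k)) =
     N ^ Suc n * g 0 + (\<Sum>k\<le>n. real (Suc n choose Suc k) * N ^ (n - k) * g (Suc k))"
    by (simp add: sum.distrib[symmetric] algebra_simps)
  also have "\<dots> = (\<Sum>k\<le>Suc n. real (Suc n choose k) * N ^ (Suc n - k) * g k)"
    by (simp only: sum.atMost_Suc_shift) simp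
  finally show ?case by (simp add: g_def)
qed simp

text \<open>Multiplication by N commutes with the generator, so exp(N t) exp(t L) = exp(t (N + L)).
  At the level of series this is the Cauchy product combined with the binomial formula
  \<open>ugen_power\<close>.\<close>

lemma semi_uniformized:
  assumes "bounded_below N f" "\<zeta> \<in> configs N"
  shows "(\<lambda>n. t ^ n / fact n * (ugen N ^^ n) f \<zeta>) sums (exp (N * t) * semi t f \<zeta>)"
proof -
  have "(\<lambda>n. \<Sum>k\<le>n. (t ^ k / fact k * (gen ^^ k) f \<zeta>) * ((N * t) ^ (n - k) / fact (n - k))) sums
     ((\<Sum>n. t ^ n / fact n * (gen ^^ n) f \<zeta>) * (\<Sum>n. (N * t) ^ n / fact n))"
    using semi_summable[OF assms, of t] summable_norm_exp[of "N * t"]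
    by (intro Cauchy_product_sums) (simp_all add: divide_inverse mult_ac)
  moreover have "(\<Sum>k\<le>n. (t ^ k / fact k * (gen ^^ k) f \<zeta>) * ((N * t) ^ (n - k) / fact (n - k))) =
      t ^ n / fact n * (ugen N ^^ n) f \<zeta>" for n
    unfolding ugen_power sum_distrib_left
  proof (intro sum.cong refl)
    fix k assume "k \<in> {..n}"
    hence k: "k \<le> n" by simp
    have "t ^ n = t ^ k * t ^ (n - k)" using k by (simp flip: power_add)
    thus "(t ^ k / fact k * (gen ^^ k) f \<zeta>) * ((N * t) ^ (n - k) / fact (n - k)) =
        t ^ n / fact n * (real (n choose k) * N ^ (n - k) * (gen ^^ k) f \<zeta>)"
      by (simp add: binomial_fact[OF k] field_simps power_mult_distrib)
  qed
  moreover have "(\<Sum>n. (N * t) ^ n / fact n) = exp (N * t)"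
    by (simp add: exp_def divide_inverse mult_ac)
  ultimately show ?thesis
    by (simp add: finite_semigroup_def mult.commute)
qed

text \<open>The loss term has rate at most N on \<open>configs N\<close>, so the added N f outweighs
  it, and the gains are averages of nonnegative values.\<close>

lemma ugen_nonneg:
  assumes f: "\<And>\<zeta>. \<zeta> \<in> configs N \<Longrightarrow> 0 \<le> f \<zeta>" and \<zeta>: "\<zeta> \<in> configs N"
  shows "0 \<le> ugen N f \<zeta>"
proof -
  have V: "finite (supp \<zeta>)" using \<zeta> by (simp add: configs_def)
  have "0 \<le> rA * pos (\<zeta> v) * avg v (\<lambda>w. f (jump_A v w \<zeta>)) +
                           rB * pos (- \<zeta> v) * avg v (\<lambda>w. f (jump_B v w \<zeta>))" for v
  proof (cases "\<zeta> v" "0::int" rule: linorder_cases)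
    case less
    have "avg v (\<lambda>_. 0) \<le> avg v (\<lambda>w. f (jump_B v w \<zeta>))"
      by (rule avg_mono) (use less f \<zeta> nbrs_irrefl jump_in_configs(2) in \<open>metis\<close>)
    with less rB show ?thesis by (simp add: pos_def mult_nonneg_nonpos mult_nonpos_nonneg)
  next
    case greater
    have "avg v (\<lambda>_. 0) \<le> avg v (\<lambda>w. f (jump_A v w \<zeta>))"
      by (rule avg_mono) (use greater f \<zeta> nbrs_irrefl jump_in_configs(1) in \<open>metis\<close>)
    with greater rA show ?thesis by (simp add: pos_def)
  qed (simp add: pos_def)
  moreover have "rate \<zeta> * f \<zeta> \<le> N * f \<zeta>"
    using rate_le[OF \<zeta>] f[OF \<zeta>] by (intro mult_right_mono)
  moreover have "ugen N f \<zeta> = (\<Sum>v\<in>supp \<zeta>. rA * pos (\<zeta> v) * avg v (\<lambda>w. f (jump_A v w \<zeta>)) +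
      rB * pos (- \<zeta> v) * avg v (\<lambda>w. f (jump_B v w \<zeta>))) + (N * f \<zeta> - rate \<zeta> * f \<zeta>)"
    unfolding ugen_def gen_eq_rate[OF V] by simp
  ultimately show ?thesis
    by (simp add: sum_nonneg)
qed

text \<open>The defining series has terms of both signs; the uniformised one has only nonnegative
  terms.\<close>

lemma semi_nonneg:
  assumes "bounded_below N f" and f: "\<And>\<zeta>. \<zeta> \<in> configs N \<Longrightarrow> 0 \<le> f \<zeta>"
    and \<zeta>: "\<zeta> \<in> configs N" and t: "0 \<le> t"
  shows "0 \<le> semi t f \<zeta>"
proof -
  have "0 \<le> (ugen N ^^ n) f \<zeta>'" if "\<zeta>' \<in> configs N" for n \<zeta>'
    using that
  proof (induction n arbitrary: \<zeta>')
    case (Suc n)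
    show ?case using ugen_nonneg[OF Suc.IH Suc.prems] by simp
  qed (use f in auto)
  hence "0 \<le> exp (N * t) * semi t f \<zeta>"
    using t \<zeta> by (intro sums_le[OF _ sums_zero semi_uniformized[OF assms(1) \<zeta>]]) auto
  thus ?thesis by (simp add: zero_le_mult_iff)
qed

lemma semi_mono:
  assumes "bounded_below N f" "bounded_below N g" "\<And>\<zeta>. \<zeta> \<in> configs N \<Longrightarrow> f \<zeta> \<le> g \<zeta>"
    and "\<zeta> \<in> configs N" and "0 \<le> t"
  shows "semi t f \<zeta> \<le> semi t g \<zeta>"
  using semi_nonneg[of N "\<lambda>\<zeta>. g \<zeta> - f \<zeta>" \<zeta> t] semi_diff[OF assms(2,1,4), of t] assms
    bounded_below_diff[OF assms(2,1)]
  by simp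

section \<open>Influence of a single unit of charge\<close>

definition lip :: "real \<Rightarrow> ('v \<Rightarrow> real) \<Rightarrow> ('v config \<Rightarrow> real) \<Rightarrow> bool" where
  "lip N \<phi> f \<longleftrightarrow> (\<forall>\<zeta> x. \<zeta> \<in> configs N \<longrightarrow> incr x \<zeta> \<in> configs N \<longrightarrow> \<bar>f (incr x \<zeta>) - f \<zeta>\<bar> \<le> \<phi> x)"

text \<open>For a walk X of jump rate at most 1, the inequality makes exp(- c t) \<phi>(X) a
  supermartingale. Such a \<phi> is therefore a weight whose \<open>lip\<close> bound survives the
  dynamics at the cost of a factor exp(c t).\<close>

definition superharmonic :: "real \<Rightarrow> ('v \<Rightarrow> real) \<Rightarrow> bool" where
  "superharmonic c \<phi> \<longleftrightarrow> (\<forall>x. 0 \<le> \<phi> x \<and> avg x \<phi> \<le> (1 + c) * \<phi> x)"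

lemma incr_jump:
  assumes "u \<noteq> w"
  shows "incr x (jump_A u w \<zeta>) = jump_A u w (incr x \<zeta>)"
    and "incr x (jump_B u w \<zeta>) = jump_B u w (incr x \<zeta>)"
    and "jump_A u w (incr u \<zeta>) = incr w \<zeta>"
    and "incr w (jump_B u w \<zeta>) = incr u \<zeta>"
  using assms by (auto simp: incr_def jump_A_def jump_B_def fun_eq_iff)

lemma incr_apply: "incr x \<zeta> u = \<zeta> u + (if u = x then 1 else 0)"
  by (simp add: incr_def)

text \<open>The discrepancy between \<open>\<zeta>\<close> and \<open>incr x \<zeta>\<close> stays a single one: it moves
  like an A-particle where \<open>\<zeta>\<close> is nonnegative, and like a B-particle elsewhere.\<close>

lemma lip_ugen:
  assumes lip: "lip N \<phi> f" and \<phi>: "superharmonic c \<phi>" and c: "0 \<le> c"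
  shows "lip N (\<lambda>x. (N + c) * \<phi> x) (ugen N f)"
  unfolding lip_def
proof (intro allI impI)
  fix \<zeta> :: "'v config" and x assume \<zeta>: "\<zeta> \<in> configs N" and \<zeta>': "incr x \<zeta> \<in> configs N"
  define V where "V = insert x (supp \<zeta>)"
  have V: "finite V" "supp \<zeta> \<subseteq> V" "supp (incr x \<zeta>) \<subseteq> V"
    using \<zeta> by (auto simp: V_def configs_def supp_def incr_def split: if_splits)
  have xV: "x \<in> V" by (simp add: V_def)
  define D where "D y \<xi> = f (incr y \<xi>) - f \<xi>" for y \<xi>
  have D: "\<bar>D y \<xi>\<bar> \<le> \<phi> y" if "\<xi> \<in> configs N" "incr y \<xi> \<in> configs N" for y \<xi>
    using lip that by (auto simp: lip_def D_def)
  have \<phi>0: "0 \<le> \<phi> y" and \<phi>1: "avg y \<phi> \<le> (1 + c) * \<phi> y" for y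
    using \<phi> by (auto simp: superharmonic_def)
  have nn: "u \<noteq> w" if "w \<in> nbrs u" for u w
    using that nbrs_irrefl by metis
  \<comment> \<open>\<open>T u\<close> collects the jumps common to \<zeta> and
    \<open>incr x \<zeta>\<close>: A-jumps at the rate of \<zeta>, B-jumps at the rate of
    \<open>incr x \<zeta>\<close>, in each case the smaller of the two. These leave the discrepancy
    at x.\<close>
  define T where "T u = rA * pos (\<zeta> u) * avg u (\<lambda>w. D x (jump_A u w \<zeta>)) +
      rB * pos (- incr x \<zeta> u) * avg u (\<lambda>w. D x (jump_B u w \<zeta>))" for u
  define k where "k u = rA * pos (\<zeta> u) + rB * pos (- incr x \<zeta> u)" for u
  \<comment> \<open>The one unmatched particle is an extra A at x in \<open>incr x \<zeta>\<close>
    if \<open>\<zeta> x \<ge> 0\<close>, and an extra B at x in \<zeta> otherwise. When it jumps to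
    w, the discrepancy moves to w, which \<open>e w\<close> records.\<close>
  define r where "r = (if \<zeta> x \<ge> 0 then rA else rB)"
  define e where "e w = (if \<zeta> x \<ge> 0 then D w \<zeta> else D w (jump_B x w \<zeta>))" for w
  have r: "0 \<le> r" "r \<le> 1" using rA rB by (auto simp: r_def)

  have posA: "pos (incr x \<zeta> u) = pos (\<zeta> u) + (if u = x \<and> \<zeta> x \<ge> 0 then 1 else 0)" for u
    by (auto simp: pos_def incr_def)
  have posB: "pos (- \<zeta> u) = pos (- incr x \<zeta> u) + (if u = x \<and> \<zeta> x < 0 then 1 else 0)" for u
    by (auto simp: pos_def incr_def)

  define X where "X u = (if u = x then r * avg x e - r * D x \<zeta> else 0)" for u
  have summand: "rA * pos (incr x \<zeta> u) * avg u (\<lambda>w. f (jump_A u w (incr x \<zeta>)) - f (incr x \<zeta>)) +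
       rB * pos (- incr x \<zeta> u) * avg u (\<lambda>w. f (jump_B u w (incr x \<zeta>)) - f (incr x \<zeta>)) -
     (rA * pos (\<zeta> u) * avg u (\<lambda>w. f (jump_A u w \<zeta>) - f \<zeta>) +
       rB * pos (- \<zeta> u) * avg u (\<lambda>w. f (jump_B u w \<zeta>) - f \<zeta>)) = T u - k u * D x \<zeta> + X u" for u
  proof -
    have A: "avg u (\<lambda>w. D x (jump_A u w \<zeta>)) =
        avg u (\<lambda>w. f (jump_A u w (incr x \<zeta>)) - f (incr x \<zeta>)) - avg u (\<lambda>w. f (jump_A u w \<zeta>) - f \<zeta>) + D x \<zeta>"
    proof -
      have "avg u (\<lambda>w. D x (jump_A u w \<zeta>)) = avg u (\<lambda>w. f (jump_A u w (incr x \<zeta>)) - f (jump_A u w \<zeta>))"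
        by (rule avg_cong) (simp add: D_def incr_jump nn)
      thus ?thesis by (simp add: avg_diff D_def)
    qed
    have B: "avg u (\<lambda>w. D x (jump_B u w \<zeta>)) =
        avg u (\<lambda>w. f (jump_B u w (incr x \<zeta>)) - f (incr x \<zeta>)) - avg u (\<lambda>w. f (jump_B u w \<zeta>) - f \<zeta>) + D x \<zeta>"
    proof -
      have "avg u (\<lambda>w. D x (jump_B u w \<zeta>)) = avg u (\<lambda>w. f (jump_B u w (incr x \<zeta>)) - f (jump_B u w \<zeta>))"
        by (rule avg_cong) (simp add: D_def incr_jump nn)
      thus ?thesis by (simp add: avg_diff D_def)
    qed
    consider "u \<noteq> x" | "u = x" "\<zeta> x \<ge> 0" | "u = x" "\<zeta> x < 0" by fastforce
    thus ?thesis
    proof cases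
      case 1
      thus ?thesis unfolding T_def k_def A B X_def posA posB by (simp add: algebra_simps)
    next
      case 2
      have "avg x e = avg x (\<lambda>w. f (jump_A x w (incr x \<zeta>)) - f \<zeta>)"
        by (rule avg_cong) (use 2 in \<open>simp add: e_def D_def incr_jump nn\<close>)
      hence "avg x e = avg x (\<lambda>w. f (jump_A x w (incr x \<zeta>)) - f (incr x \<zeta>)) + D x \<zeta>"
        by (simp add: avg_diff D_def)
      with 2 show ?thesis unfolding T_def k_def A B X_def posA posB
        by (simp add: r_def algebra_simps)
    next
      case 3
      have "avg x e = avg x (\<lambda>w. f (incr x \<zeta>) - f (jump_B x w \<zeta>))"
        by (rule avg_cong) (use 3 in \<open>simp add: e_def D_def incr_jump(4) nn\<close>)
      hence "D x \<zeta> = avg x e + avg x (\<lambda>w. f (jump_B x w \<zeta>) - f \<zeta>)"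
        by (simp add: avg_diff D_def)
      with 3 show ?thesis unfolding T_def k_def A B X_def posA posB
        by (simp add: r_def algebra_simps)
    qed
  qed
  define K where "K = (\<Sum>u\<in>V. k u)"
  have "gen f (incr x \<zeta>) - gen f \<zeta> = (\<Sum>u\<in>V. T u - k u * D x \<zeta> + X u)"
    unfolding gen_eq[OF V(1,2)] gen_eq[OF V(1,3)] sum_subtractf[symmetric] summand ..
  also have "\<dots> = (\<Sum>u\<in>V. T u) - K * D x \<zeta> + (r * avg x e - r * D x \<zeta>)"
    using V(1) xV by (simp add: sum.distrib sum_subtractf X_def K_def sum_distrib_right)
  finally have eq: "ugen N f (incr x \<zeta>) - ugen N f \<zeta> = (N - K - r) * D x \<zeta> + (\<Sum>u\<in>V. T u) + r * avg x e"
    by (simp add: ugen_def D_def algebra_simps)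

  \<comment> \<open>K + r is the total jump rate of whichever configuration has the extra particle.
    Being at most N, it leaves the diagonal term a nonnegative weight N - K - r.\<close>
  have K: "K + r \<le> N"
  proof (cases "\<zeta> x \<ge> 0")
    case True
    have "rate (incr x \<zeta>) = (\<Sum>u\<in>V. k u + (if u = x then rA else 0))"
      unfolding rate_eq[OF V(1,3)] by (rule sum.cong) (use True in \<open>auto simp: k_def posA algebra_simps\<close>)
    also have "\<dots> = K + r" using V(1) xV True by (simp add: sum.distrib K_def r_def)
    finally show ?thesis using rate_le[OF \<zeta>'] by simp
  next
    case False
    have "rate \<zeta> = (\<Sum>u\<in>V. k u + (if u = x then rB else 0))"
      unfolding rate_eq[OF V(1,2)] by (rule sum.cong) (use False in \<open>auto simp: k_def posB algebra_simps\<close>)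
    also have "\<dots> = K + r" using V(1) xV False by (simp add: sum.distrib K_def r_def)
    finally show ?thesis using rate_le[OF \<zeta>] by simp
  qed

  have T: "\<bar>T u\<bar> \<le> k u * \<phi> x" for u
  proof -
    have "\<bar>rA * pos (\<zeta> u) * avg u (\<lambda>w. D x (jump_A u w \<zeta>))\<bar> \<le> rA * pos (\<zeta> u) * \<phi> x"
    proof (cases "\<zeta> u > 0")
      case True
      have "\<bar>avg u (\<lambda>w. D x (jump_A u w \<zeta>))\<bar> \<le> \<phi> x"
      proof (rule abs_avg_le_const, rule D)
        fix w assume w: "w \<in> nbrs u"
        show "jump_A u w \<zeta> \<in> configs N" using True \<zeta> nn[OF w] by (simp add: jump_in_configs)
        have "incr x \<zeta> u > 0" using True by (auto simp: incr_def)
        thus "incr x (jump_A u w \<zeta>) \<in> configs N"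
          using \<zeta>' nn[OF w] by (simp add: incr_jump jump_in_configs)
      qed
      thus ?thesis using rA by (simp add: abs_mult mult_left_mono)
    qed (simp add: pos_def)
    moreover have "\<bar>rB * pos (- incr x \<zeta> u) * avg u (\<lambda>w. D x (jump_B u w \<zeta>))\<bar> \<le> rB * pos (- incr x \<zeta> u) * \<phi> x"
    proof (cases "incr x \<zeta> u < 0")
      case True
      have "\<bar>avg u (\<lambda>w. D x (jump_B u w \<zeta>))\<bar> \<le> \<phi> x"
      proof (rule abs_avg_le_const, rule D)
        fix w assume w: "w \<in> nbrs u"
        show "incr x (jump_B u w \<zeta>) \<in> configs N"
          using True \<zeta>' nn[OF w] by (simp add: incr_jump jump_in_configs)
        have "\<zeta> u < 0" using True by (simp add: incr_apply split: if_splits)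
        thus "jump_B u w \<zeta> \<in> configs N" using \<zeta> nn[OF w] by (simp add: jump_in_configs)
      qed
      thus ?thesis using rB by (simp add: abs_mult mult_left_mono)
    qed (simp add: pos_def)
    ultimately show ?thesis unfolding T_def k_def
      by (simp add: distrib_right abs_triangle_ineq[THEN order.trans] add_mono)
  qed

  have "\<bar>avg x e\<bar> \<le> avg x \<phi>"
  proof (rule abs_avg_le)
    fix w assume w: "w \<in> nbrs x"
    show "\<bar>e w\<bar> \<le> \<phi> w"
    proof (cases "\<zeta> x \<ge> 0")
      case True
      hence "incr x \<zeta> x > 0" by (simp add: incr_def)
      hence "incr w \<zeta> \<in> configs N"
        using \<zeta>' nn[OF w] jump_in_configs(1)[of "incr x \<zeta>" N x w] by (simp add: incr_jump)
      with True show ?thesis by (simp add: e_def D \<zeta>)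
    next
      case False
      hence "jump_B x w \<zeta> \<in> configs N" using \<zeta> nn[OF w] by (simp add: jump_in_configs)
      with False show ?thesis using \<zeta>' nn[OF w] by (simp add: e_def D incr_jump(4))
    qed
  qed
  hence E: "\<bar>avg x e\<bar> \<le> (1 + c) * \<phi> x" using \<phi>1[of x] by linarith

  have "\<bar>ugen N f (incr x \<zeta>) - ugen N f \<zeta>\<bar> \<le> \<bar>(N - K - r) * D x \<zeta>\<bar> + \<bar>\<Sum>u\<in>V. T u\<bar> + \<bar>r * avg x e\<bar>"
    unfolding eq by linarith
  also have "\<dots> \<le> (N - K - r) * \<phi> x + K * \<phi> x + r * ((1 + c) * \<phi> x)"
  proof (intro add_mono)
    show "\<bar>(N - K - r) * D x \<zeta>\<bar> \<le> (N - K - r) * \<phi> x"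
      using K D[OF \<zeta> \<zeta>'] by (simp add: abs_mult mult_left_mono)
    show "\<bar>\<Sum>u\<in>V. T u\<bar> \<le> K * \<phi> x"
      unfolding K_def sum_distrib_right using T by (intro order.trans[OF sum_abs] sum_mono)
    show "\<bar>r * avg x e\<bar> \<le> r * ((1 + c) * \<phi> x)"
      using r E by (simp add: abs_mult mult_left_mono)
  qed
  also have "\<dots> = N * \<phi> x + r * (c * \<phi> x)" by (simp add: algebra_simps)
  also have "\<dots> \<le> N * \<phi> x + 1 * (c * \<phi> x)"
    using r c \<phi>0[of x] by (intro add_left_mono mult_right_mono) auto
  finally show "\<bar>ugen N f (incr x \<zeta>) - ugen N f \<zeta>\<bar> \<le> (N + c) * \<phi> x"
    by (simp add: algebra_simps)
qed

lemma superharmonic_cmult: "superharmonic c \<phi> \<Longrightarrow> 0 \<le> a \<Longrightarrow> superharmonic c (\<lambda>x. a * \<phi> x)"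
  unfolding superharmonic_def avg_def
  by (auto simp: sum_distrib_left[symmetric] mult.left_commute[of _ a] mult_left_mono
      simp flip: times_divide_eq_right)

text \<open>Each application of \<open>ugen N\<close> costs a factor N + c, so the uniformised
  series is dominated by exp((N + c) t). Dividing by exp(N t) leaves a bound free of the number of
  particles.\<close>

lemma lip_semi:
  assumes bdd: "bounded_below N f" and lip: "lip N \<phi> f"
    and \<phi>: "superharmonic c \<phi>" and c: "0 \<le> c" and N: "0 \<le> N" and t: "0 \<le> t"
  shows "lip N (\<lambda>x. exp (c * t) * \<phi> x) (semi t f)"
  unfolding lip_def
proof (intro allI impI)
  fix \<zeta> :: "'v config" and x assume \<zeta>: "\<zeta> \<in> configs N" and \<zeta>': "incr x \<zeta> \<in> configs N"
  have *: "lip N (\<lambda>x. (N + c) ^ n * \<phi> x) ((ugen N ^^ n) f)" for n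
  proof (induction n)
    case (Suc n)
    show ?case
      using lip_ugen[OF Suc.IH superharmonic_cmult[OF \<phi>] c] N c by (simp add: mult.assoc)
  qed (use lip in simp)
  define d where "d n = t ^ n / fact n * ((ugen N ^^ n) f (incr x \<zeta>) - (ugen N ^^ n) f \<zeta>)" for n
  have d: "d sums (exp (N * t) * (semi t f (incr x \<zeta>) - semi t f \<zeta>))"
    unfolding d_def right_diff_distrib
    by (intro sums_diff semi_uniformized bdd \<zeta> \<zeta>')
  have "(\<lambda>n. ((N + c) * t) ^ n / fact n * \<phi> x) sums (exp ((N + c) * t) * \<phi> x)"
    using exp_converges[of "(N + c) * t"] by (intro sums_mult2) (simp add: divide_inverse mult_ac)
  moreover have "\<bar>d n\<bar> \<le> ((N + c) * t) ^ n / fact n * \<phi> x" for n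
  proof -
    have "\<bar>d n\<bar> = t ^ n / fact n * \<bar>(ugen N ^^ n) f (incr x \<zeta>) - (ugen N ^^ n) f \<zeta>\<bar>"
      using t by (simp add: d_def abs_mult)
    also have "\<dots> \<le> t ^ n / fact n * ((N + c) ^ n * \<phi> x)"
      using *[of n] \<zeta> \<zeta>' t by (intro mult_left_mono) (auto simp: lip_def)
    finally show ?thesis by (simp add: power_mult_distrib mult_ac)
  qed
  ultimately have "\<bar>exp (N * t) * (semi t f (incr x \<zeta>) - semi t f \<zeta>)\<bar> \<le> exp ((N + c) * t) * \<phi> x"
    using d norm_sums_le[of d "exp (N * t) * (semi t f (incr x \<zeta>) - semi t f \<zeta>)"] by simp
  also have "\<dots> = exp (N * t) * (exp (c * t) * \<phi> x)"
    by (simp add: distrib_right exp_add)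
  finally show "\<bar>semi t f (incr x \<zeta>) - semi t f \<zeta>\<bar> \<le> exp (c * t) * \<phi> x"
    by (simp add: abs_mult)
qed

end

text \<open>The initial states have this property almost surely. It bounds the mass of a restriction
  by the number of sites, and makes the content of any site differ from 0 by at most one
  \<open>incr\<close>.\<close>

definition unit_config :: "'v config \<Rightarrow> bool" where
  "unit_config \<zeta> \<longleftrightarrow> (\<forall>v. \<bar>\<zeta> v\<bar> \<le> 1)"

lemma restrict_unit_in_configs:
  assumes "unit_config \<zeta>" "finite F" "real (card F) \<le> N"
  shows "restrict_config F \<zeta> \<in> configs N"
proof -
  have sub: "supp (restrict_config F \<zeta>) \<subseteq> F"
    by (auto simp: supp_def restrict_config_def split: if_splits)
  have "mass (restrict_config F \<zeta>) = (\<Sum>v\<in>F. \<bar>real_of_int (restrict_config F \<zeta> v)\<bar>)"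
    by (rule mass_eq[OF assms(2) sub])
  also have "\<dots> \<le> (\<Sum>v\<in>F. 1)"
  proof (rule sum_mono)
    fix v
    have "\<bar>\<zeta> v\<bar> \<le> 1" using assms(1) by (simp add: unit_config_def)
    thus "\<bar>real_of_int (restrict_config F \<zeta> v)\<bar> \<le> 1"
      by (auto simp: restrict_config_def abs_le_iff)
  qed
  finally show ?thesis using assms finite_subset[OF sub] by (simp add: configs_def)
qed

definition charge :: "'v config \<Rightarrow> real" where
  "charge \<zeta> = (\<Sum>v\<in>supp \<zeta>. real_of_int (\<zeta> v))"

lemma charge_eq: "finite V \<Longrightarrow> supp \<zeta> \<subseteq> V \<Longrightarrow> charge \<zeta> = (\<Sum>v\<in>V. real_of_int (\<zeta> v))"
  unfolding charge_def by (rule sum.mono_neutral_left) (auto simp: supp_def)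

lemma abs_charge_le_mass: "\<bar>charge \<zeta>\<bar> \<le> mass \<zeta>"
  unfolding charge_def mass_def by (rule sum_abs)

lemma charge_incr:
  assumes "finite (supp \<zeta>)"
  shows "charge (incr x \<zeta>) = charge \<zeta> + 1"
proof -
  have "charge (incr x \<zeta>) = (\<Sum>v\<in>insert x (supp \<zeta>). real_of_int (incr x \<zeta> v))"
    using assms by (intro charge_eq) (auto simp: supp_def incr_def)
  also have "\<dots> = (\<Sum>v\<in>insert x (supp \<zeta>). real_of_int (\<zeta> v) + (if v = x then 1 else 0))"
    by (intro sum.cong) (auto simp: incr_def)
  also have "\<dots> = (\<Sum>v\<in>insert x (supp \<zeta>). real_of_int (\<zeta> v)) + 1"
    using assms by (simp add: sum.distrib)
  also have "(\<Sum>v\<in>insert x (supp \<zeta>). real_of_int (\<zeta> v)) = charge \<zeta>"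
    using assms by (intro charge_eq[symmetric]) auto
  finally show ?thesis .
qed

lemma charge_jump:
  assumes "finite (supp \<zeta>)" "u \<noteq> w"
  shows "charge (jump_A u w \<zeta>) = charge \<zeta>" "charge (jump_B u w \<zeta>) = charge \<zeta>"
proof -
  have A: "charge (jump_A a b \<xi>) = charge \<xi>" if "finite (supp \<xi>)" "a \<noteq> b" for a b and \<xi> :: "'a config"
  proof -
    have "charge (incr a (jump_A a b \<xi>)) = charge (incr b \<xi>)"
      by (rule arg_cong[of _ _ charge]) (use that in \<open>auto simp: incr_def jump_A_def\<close>)
    moreover have "finite (supp (jump_A a b \<xi>))"
      using that finite_subset[OF supp_jump(1)[of a b \<xi>]] by simp
    ultimately show ?thesis using that by (simp add: charge_incr)
  qed
  show "charge (jump_A u w \<zeta>) = charge \<zeta>" by (rule A[OF assms])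
  \<comment> \<open>A B-particle going from u to w moves charge exactly as an A-particle going from
    w to u.\<close>
  have "jump_B u w \<zeta> = jump_A w u \<zeta>"
    using assms(2) by (auto simp: jump_A_def jump_B_def fun_eq_iff)
  thus "charge (jump_B u w \<zeta>) = charge \<zeta>" using A[of \<zeta> w u] assms by simp
qed

section \<open>Independent initial charges\<close>

definition coin :: "int pmf" where
  "coin = map_pmf (\<lambda>isA. if isA then 1 else - 1) (bernoulli_pmf (1 / 2))"

text \<open>The default value 0 leaves the sites outside F empty, so a sample is itself an initial
  state of a finite system with one particle per site of F.\<close>

definition coins :: "'v set \<Rightarrow> 'v config pmf" where
  "coins F = Pi_pmf F 0 (\<lambda>_. coin)"

abbreviation Ecoins :: "'v set \<Rightarrow> ('v config \<Rightarrow> real) \<Rightarrow> real" where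
  "Ecoins F \<equiv> measure_pmf.expectation (coins F)"

lemma set_coin: "set_pmf coin = {1, -1}"
  by (auto simp: coin_def UNIV_bool)

lemma pmf_coin: "pmf coin 1 = 1 / 2" "pmf coin (- 1) = 1 / 2"
proof -
  have "inj (\<lambda>isA. if isA then 1 else - 1 :: int)" by (auto simp: inj_def)
  from pmf_map_inj'[OF this, of "bernoulli_pmf (1/2)" True] pmf_map_inj'[OF this, of "bernoulli_pmf (1/2)" False]
  show "pmf coin 1 = 1 / 2" "pmf coin (- 1) = 1 / 2" by (simp_all add: coin_def)
qed

lemma set_coins:
  assumes "finite F"
  shows "set_pmf (coins F) = PiE_dflt F 0 (\<lambda>_. {1, -1})"
  using assms by (simp add: coins_def set_Pi_pmf set_coin o_def)

lemma finite_set_coins: "finite F \<Longrightarrow> finite (set_pmf (coins F))"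
  by (simp add: set_coins finite_PiE_dflt)

lemma coins_apply:
  assumes "finite F" "\<sigma> \<in> set_pmf (coins F)"
  shows "v \<in> F \<Longrightarrow> \<sigma> v = 1 \<or> \<sigma> v = -1" "v \<notin> F \<Longrightarrow> \<sigma> v = 0"
  using assms by (auto simp: set_coins PiE_dflt_def)

lemma coins_unit:
  assumes "finite F" "\<sigma> \<in> set_pmf (coins F)"
  shows "unit_config \<sigma>"
  unfolding unit_config_def
proof
  fix v
  show "\<bar>\<sigma> v\<bar> \<le> 1" using coins_apply[OF assms, of v] by (cases "v \<in> F") auto
qed

lemma coins_restrict: "finite F \<Longrightarrow> \<sigma> \<in> set_pmf (coins F) \<Longrightarrow> restrict_config F \<sigma> = \<sigma>"
  by (simp add: restrict_config_def fun_eq_iff coins_apply(2))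

lemma coins_in_configs:
  "finite F \<Longrightarrow> \<sigma> \<in> set_pmf (coins F) \<Longrightarrow> real (card F) \<le> N \<Longrightarrow> \<sigma> \<in> configs N"
  using restrict_unit_in_configs[of \<sigma> F N] coins_unit[of F \<sigma>] coins_restrict[of F \<sigma>] by simp

lemma integrable_coins: "finite F \<Longrightarrow> integrable (measure_pmf (coins F)) (f :: _ \<Rightarrow> real)"
  by (intro integrable_measure_pmf_finite finite_set_coins)

lemma Ecoins_mono:
  assumes "finite F" "\<And>\<sigma>. \<sigma> \<in> set_pmf (coins F) \<Longrightarrow> f \<sigma> \<le> g \<sigma>"
  shows "Ecoins F f \<le> Ecoins F g"
  using assms by (intro integral_mono_AE) (auto simp: integrable_coins AE_measure_pmf_iff)

lemma Ecoins_cong: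
  "(\<And>\<sigma>. \<sigma> \<in> set_pmf (coins F) \<Longrightarrow> f \<sigma> = g \<sigma>) \<Longrightarrow> Ecoins F f = Ecoins F g"
  by (intro integral_cong_AE) (auto simp: AE_measure_pmf_iff)

lemma Ecoins_diff_le:
  assumes "finite F" "\<And>\<sigma>. \<sigma> \<in> set_pmf (coins F) \<Longrightarrow> \<bar>f \<sigma> - g \<sigma>\<bar> \<le> a"
  shows "\<bar>Ecoins F f - Ecoins F g\<bar> \<le> a"
proof -
  have "Ecoins F f \<le> Ecoins F (\<lambda>\<sigma>. g \<sigma> + a)" "Ecoins F g \<le> Ecoins F (\<lambda>\<sigma>. f \<sigma> + a)"
    using assms by (intro Ecoins_mono; force)+
  thus ?thesis using assms(1) by (simp add: integrable_coins)
qed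

lemma Ecoins_restrict:
  assumes "finite F'" "F \<subseteq> F'"
  shows "Ecoins F f = Ecoins F' (\<lambda>\<sigma>. f (restrict_config F \<sigma>))"
  unfolding coins_def Pi_pmf_subset[OF assms] by (simp add: restrict_config_def)

text \<open>Fubini for independent coins on disjoint sets. It separates the coins that are resampled
  from the rest.\<close>

lemma Ecoins_Un:
  assumes "finite B" "finite G" "B \<inter> G = {}"
  shows "Ecoins (B \<union> G) f = Ecoins B (\<lambda>\<sigma>. Ecoins G (\<lambda>\<tau>. f (\<lambda>x. if x \<in> B then \<sigma> x else \<tau> x)))"
proof -
  have "coins (B \<union> G) = bind_pmf (coins B) (\<lambda>\<sigma>. map_pmf (\<lambda>\<tau> x. if x \<in> B then \<sigma> x else \<tau> x) (coins G))"
    unfolding coins_def Pi_pmf_union[OF assms]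
    by (simp add: pair_pmf_def map_pmf_def bind_assoc_pmf bind_return_pmf)
  hence "Ecoins (B \<union> G) f = (\<Sum>\<sigma>\<in>set_pmf (coins B). pmf (coins B) \<sigma> *\<^sub>R
      measure_pmf.expectation (map_pmf (\<lambda>\<tau> x. if x \<in> B then \<sigma> x else \<tau> x) (coins G)) f)"
    by (simp only:) (rule pmf_expectation_bind, use assms in \<open>simp_all add: finite_set_coins\<close>)
  also have "\<dots> = (\<Sum>\<sigma>\<in>set_pmf (coins B). pmf (coins B) \<sigma> *
      Ecoins G (\<lambda>\<tau>. f (\<lambda>x. if x \<in> B then \<sigma> x else \<tau> x)))"
    by simp
  also have "\<dots> = Ecoins B (\<lambda>\<sigma>. Ecoins G (\<lambda>\<tau>. f (\<lambda>x. if x \<in> B then \<sigma> x else \<tau> x)))"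
    using assms by (subst integral_measure_pmf[of "set_pmf (coins B)"]) (auto simp: finite_set_coins)
  finally show ?thesis .
qed

lemma Ecoins_insert:
  assumes "finite B" "x \<notin> B"
  shows "Ecoins (insert x B) f = (Ecoins B (\<lambda>\<sigma>. f (\<sigma>(x := 1))) + Ecoins B (\<lambda>\<sigma>. f (\<sigma>(x := -1)))) / 2"
proof -
  have "coins (insert x B) = bind_pmf coin (\<lambda>y. map_pmf (\<lambda>\<sigma>. \<sigma>(x := y)) (coins B))"
    unfolding coins_def Pi_pmf_insert'[OF assms] by (simp add: map_pmf_def)
  hence "Ecoins (insert x B) f =
      (\<Sum>y\<in>{1, -1}. pmf coin y *\<^sub>R measure_pmf.expectation (map_pmf (\<lambda>\<sigma>. \<sigma>(x := y)) (coins B)) f)"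
    by (simp only:) (rule pmf_expectation_bind, use assms in \<open>simp_all add: finite_set_coins set_coin\<close>)
  thus ?thesis by (simp add: pmf_coin)
qed

lemma Ecoins_insert_sum:
  assumes "finite B" "x \<notin> B"
  shows "Ecoins (insert x B) (\<lambda>\<sigma>. g (\<Sum>v\<in>insert x B. real_of_int (\<sigma> v))) =
     (Ecoins B (\<lambda>\<sigma>. g ((\<Sum>v\<in>B. real_of_int (\<sigma> v)) + 1)) + Ecoins B (\<lambda>\<sigma>. g ((\<Sum>v\<in>B. real_of_int (\<sigma> v)) - 1))) / 2"
proof -
  have "(\<Sum>v\<in>insert x B. real_of_int ((\<sigma>(x := a)) v)) = (\<Sum>v\<in>B. real_of_int (\<sigma> v)) + a" for \<sigma> a
  proof -
    have "(\<Sum>v\<in>B. real_of_int ((\<sigma>(x := a)) v)) = (\<Sum>v\<in>B. real_of_int (\<sigma> v))"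
      using assms by (intro sum.cong) auto
    thus ?thesis using assms by simp
  qed
  thus ?thesis using assms by (simp add: Ecoins_insert del: fun_upd_apply sum.insert)
qed

text \<open>A new coin replaces Y by Y + 1 or Y - 1 with equal weight, and averaging the powers
  gives Y^2 + 1 and Y^4 + 6 Y^2 + 1. With n coins the fourth moment bound closes as 3 n^2 + 6 n + 1
  \<le> 3 (n + 1)^2.\<close>

lemma coin_moments:
  assumes "finite B"
  defines "Y \<equiv> \<lambda>\<sigma>. \<Sum>v\<in>B. real_of_int (\<sigma> v)"
  shows "Ecoins B Y = 0" "Ecoins B (\<lambda>\<sigma>. Y \<sigma> ^ 2) = card B" "Ecoins B (\<lambda>\<sigma>. Y \<sigma> ^ 4) \<le> 3 * real (card B) ^ 2"
proof -
  let ?Y = "\<lambda>B \<sigma>. \<Sum>v\<in>B. real_of_int (\<sigma> v)"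
  have "Ecoins B (?Y B) = 0 \<and> Ecoins B (\<lambda>\<sigma>. ?Y B \<sigma> ^ 2) = card B \<and>
      Ecoins B (\<lambda>\<sigma>. ?Y B \<sigma> ^ 4) \<le> 3 * real (card B) ^ 2"
    using assms(1)
  proof (induction B rule: finite_induct)
    case (insert x B)
    note i = integrable_coins[OF insert.hyps(1)]
    note e = Ecoins_insert_sum[OF insert.hyps]
    have 1: "Ecoins (insert x B) (?Y (insert x B)) = Ecoins B (?Y B)"
      using e[of "\<lambda>y. y"] by (simp add: i del: sum.insert)
    have "Ecoins (insert x B) (\<lambda>\<sigma>. ?Y (insert x B) \<sigma> ^ 2) =
        Ecoins B (\<lambda>\<sigma>. ((?Y B \<sigma> + 1) ^ 2 + (?Y B \<sigma> - 1) ^ 2) / 2)"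
      unfolding e[of "\<lambda>y. y ^ 2"] by (simp add: i del: sum.insert)
    also have "\<dots> = Ecoins B (\<lambda>\<sigma>. ?Y B \<sigma> ^ 2 + 1)"
      by (intro Bochner_Integration.integral_cong refl) (simp add: power2_eq_square field_simps)
    finally have 2: "Ecoins (insert x B) (\<lambda>\<sigma>. ?Y (insert x B) \<sigma> ^ 2) = Ecoins B (\<lambda>\<sigma>. ?Y B \<sigma> ^ 2) + 1"
      by (simp add: i del: sum.insert)
    have "Ecoins (insert x B) (\<lambda>\<sigma>. ?Y (insert x B) \<sigma> ^ 4) =
        Ecoins B (\<lambda>\<sigma>. ((?Y B \<sigma> + 1) ^ 4 + (?Y B \<sigma> - 1) ^ 4) / 2)"
      unfolding e[of "\<lambda>y. y ^ 4"] by (simp add: i del: sum.insert)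
    also have "\<dots> = Ecoins B (\<lambda>\<sigma>. ?Y B \<sigma> ^ 4 + 6 * ?Y B \<sigma> ^ 2 + 1)"
      by (intro Bochner_Integration.integral_cong refl) (simp add: power4_eq_xxxx power2_eq_square field_simps)
    finally have 4: "Ecoins (insert x B) (\<lambda>\<sigma>. ?Y (insert x B) \<sigma> ^ 4) =
        Ecoins B (\<lambda>\<sigma>. ?Y B \<sigma> ^ 4) + 6 * Ecoins B (\<lambda>\<sigma>. ?Y B \<sigma> ^ 2) + 1"
      by (simp add: i del: sum.insert)
    show ?case unfolding 1 2 4 using insert by (simp add: power2_eq_square algebra_simps)
  qed (simp add: coins_def)
  thus "Ecoins B Y = 0" "Ecoins B (\<lambda>\<sigma>. Y \<sigma> ^ 2) = card B" "Ecoins B (\<lambda>\<sigma>. Y \<sigma> ^ 4) \<le> 3 * real (card B) ^ 2"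
    by (simp_all add: Y_def)
qed

text \<open>Second and fourth moments bound E |Y| from below through u^2 - u^4 \<le> |u| with u = Y
  / s. As the mean is 0, E Y^+ is half of E |Y|.\<close>

lemma coin_sum_pos_part:
  assumes "finite B"
  shows "sqrt (card B) / 16 \<le> Ecoins B (\<lambda>\<sigma>. max 0 (\<Sum>v\<in>B. real_of_int (\<sigma> v)))"
proof (cases "B = {}")
  case False
  define n where "n = real (card B)"
  \<comment> \<open>With this scale, n / s - 3 n^2 / s^3 equals sqrt n / 2 - 3 sqrt n / 8 = sqrt n /
    8.\<close>
  define s where "s = 2 * sqrt n"
  define Y where "Y \<sigma> = (\<Sum>v\<in>B. real_of_int (\<sigma> v))" for \<sigma>
  have n: "n > 0" using assms False by (simp add: n_def card_gt_0_iff)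
  hence s: "s > 0" and s2: "s ^ 2 = 4 * n" by (simp_all add: s_def power_mult_distrib)
  note i = integrable_coins[OF assms]
  note m = coin_moments[OF assms, folded Y_def]
  have *: "u\<^sup>2 - u ^ 4 \<le> \<bar>u\<bar>" for u :: real
  proof -
    have "\<bar>u\<bar> * (1 - \<bar>u\<bar> + \<bar>u\<bar> ^ 3) \<ge> 0"
    proof (intro mult_nonneg_nonneg)
      show "1 - \<bar>u\<bar> + \<bar>u\<bar> ^ 3 \<ge> 0"
      proof (cases "\<bar>u\<bar> \<le> 1")
        case False
        hence "\<bar>u\<bar> ^ 1 \<le> \<bar>u\<bar> ^ 3" by (intro power_increasing) auto
        thus ?thesis by simp
      qed simp
    qed simp
    moreover have "\<bar>u\<bar> * (1 - \<bar>u\<bar> + \<bar>u\<bar> ^ 3) = \<bar>u\<bar> - \<bar>u\<bar> ^ 2 + \<bar>u\<bar> ^ 4"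
      by (simp add: algebra_simps power2_eq_square power3_eq_cube power4_eq_xxxx)
    ultimately show ?thesis by simp
  qed
  have "Y \<sigma> ^ 2 / s - Y \<sigma> ^ 4 / s ^ 3 \<le> \<bar>Y \<sigma>\<bar>" for \<sigma>
  proof -
    have "s * ((Y \<sigma> / s) ^ 2 - (Y \<sigma> / s) ^ 4) \<le> s * \<bar>Y \<sigma> / s\<bar>"
      using s by (intro mult_left_mono *) auto
    thus ?thesis using s
      by (simp add: power_divide right_diff_distrib abs_divide eval_nat_numeral mult_ac)
  qed
  hence "Ecoins B (\<lambda>\<sigma>. Y \<sigma> ^ 2 / s - Y \<sigma> ^ 4 / s ^ 3) \<le> Ecoins B (\<lambda>\<sigma>. \<bar>Y \<sigma>\<bar>)"
    by (intro Ecoins_mono assms)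
  moreover have "Ecoins B (\<lambda>\<sigma>. Y \<sigma> ^ 2 / s - Y \<sigma> ^ 4 / s ^ 3) = n / s - Ecoins B (\<lambda>\<sigma>. Y \<sigma> ^ 4) / s ^ 3"
    by (simp add: i m n_def)
  moreover have "Ecoins B (\<lambda>\<sigma>. Y \<sigma> ^ 4) / s ^ 3 \<le> 3 * n ^ 2 / s ^ 3"
    using m(3) s by (intro divide_right_mono) (auto simp: n_def)
  moreover have "n / s - 3 * n ^ 2 / s ^ 3 = sqrt n / 8"
  proof -
    have "n / s = sqrt n / 2" using n by (simp add: s_def real_div_sqrt)
    hence "2 * n / s = sqrt n" by (simp add: mult.commute)
    moreover have "3 * n ^ 2 / s ^ 3 = 3 / 4 * (n * n / (n * s))"
      using n by (simp add: power3_eq_cube s2[unfolded power2_eq_square] power2_eq_square)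
    hence "3 * n ^ 2 / s ^ 3 = 3 / 4 * (n / s)" using n by simp
    ultimately show ?thesis by simp
  qed
  moreover have "Ecoins B (\<lambda>\<sigma>. \<bar>Y \<sigma>\<bar>) = 2 * Ecoins B (\<lambda>\<sigma>. max 0 (Y \<sigma>))"
  proof -
    have "Ecoins B (\<lambda>\<sigma>. \<bar>Y \<sigma>\<bar>) = Ecoins B (\<lambda>\<sigma>. 2 * max 0 (Y \<sigma>) - Y \<sigma>)"
      by (intro Bochner_Integration.integral_cong refl) auto
    also have "\<dots> = 2 * Ecoins B (\<lambda>\<sigma>. max 0 (Y \<sigma>)) - Ecoins B Y"
      by (simp add: i)
    finally show ?thesis by (simp add: m)
  qed
  ultimately have "sqrt n / 16 \<le> Ecoins B (\<lambda>\<sigma>. max 0 (Y \<sigma>))" by linarith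
  thus ?thesis by (simp add: n_def Y_def)
qed (simp add: coins_def)

section \<open>Finite systems with random initial state\<close>

context annihilation_graph
begin

text \<open>The sites of H are filled one at a time. As each holds 0, 1 or -1, a step is no change,
  one \<open>incr\<close>, or one \<open>incr\<close> read backwards.\<close>

lemma lip_restrict:
  assumes "finite H" "finite F" "F \<inter> H = {}" "unit_config \<zeta>" "real (card (F \<union> H)) \<le> N"
    and g: "lip N \<phi> g" "\<And>x. 0 \<le> \<phi> x"
  shows "\<bar>g (restrict_config (F \<union> H) \<zeta>) - g (restrict_config F \<zeta>)\<bar> \<le> (\<Sum>y\<in>H. \<phi> y)"
  using assms(1,3,5)
proof (induction H rule: finite_induct)
  case (insert y H)
  let ?r = "\<lambda>F. restrict_config F \<zeta>"
  have card: "real (card (F \<union> insert y H)) = real (card (F \<union> H)) + 1"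
    using insert assms by simp
  have C: "?r (F \<union> H) \<in> configs N" "?r (F \<union> insert y H) \<in> configs N"
    using insert assms card by (auto intro!: restrict_unit_in_configs)
  have "\<bar>\<zeta> y\<bar> \<le> 1" using assms(4) by (simp add: unit_config_def)
  then consider "\<zeta> y = 0" | "\<zeta> y = 1" | "\<zeta> y = -1" by linarith
  hence "\<bar>g (?r (F \<union> insert y H)) - g (?r (F \<union> H))\<bar> \<le> \<phi> y"
  proof cases
    case 1
    hence "?r (F \<union> insert y H) = ?r (F \<union> H)"
      by (auto simp: restrict_config_def)
    thus ?thesis using g by simp
  next
    case 2
    hence "?r (F \<union> insert y H) = incr y (?r (F \<union> H))"
      using insert by (auto simp: restrict_config_def incr_def fun_eq_iff)
    thus ?thesis using g(1) C by (simp add: lip_def)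
  next
    case 3
    hence "?r (F \<union> H) = incr y (?r (F \<union> insert y H))"
      using insert by (auto simp: restrict_config_def incr_def fun_eq_iff)
    thus ?thesis using g(1) C by (simp add: lip_def abs_minus_commute)
  qed
  moreover have "\<bar>g (?r (F \<union> H)) - g (?r F)\<bar> \<le> (\<Sum>y\<in>H. \<phi> y)"
    using insert card by simp
  ultimately show ?case using insert by simp
qed simp

lemma lip_restrict_sym_diff:
  assumes "finite F" "finite F'" "unit_config \<zeta>" "real (card (F \<union> F')) \<le> N"
    and g: "lip N \<phi> g" "\<And>x. 0 \<le> \<phi> x"
  shows "\<bar>g (restrict_config F \<zeta>) - g (restrict_config F' \<zeta>)\<bar> \<le> (\<Sum>y\<in>(F - F') \<union> (F' - F). \<phi> y)"
proof -
  have c: "card F \<le> card (F \<union> F')" "card F' \<le> card (F \<union> F')"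
    using assms by (auto intro: card_mono)
  have "\<bar>g (restrict_config ((F \<inter> F') \<union> (F - F')) \<zeta>) - g (restrict_config (F \<inter> F') \<zeta>)\<bar> \<le> (\<Sum>y\<in>F - F'. \<phi> y)"
    using assms c by (intro lip_restrict) (auto simp: Int_Diff_Un)
  moreover have "\<bar>g (restrict_config ((F \<inter> F') \<union> (F' - F)) \<zeta>) - g (restrict_config (F \<inter> F') \<zeta>)\<bar> \<le> (\<Sum>y\<in>F' - F. \<phi> y)"
    using assms c by (intro lip_restrict) (auto simp: Int_Diff_Un Int_commute[of F F'])
  moreover have "(F \<inter> F') \<union> (F - F') = F" "(F \<inter> F') \<union> (F' - F) = F'" by auto
  moreover have "(\<Sum>y\<in>(F - F') \<union> (F' - F). \<phi> y) = (\<Sum>y\<in>F - F'. \<phi> y) + (\<Sum>y\<in>F' - F. \<phi> y)"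
    using assms by (intro sum.union_disjoint) auto
  ultimately show ?thesis by simp
qed

text \<open>Both expectations are realised by restricting one sample on
  \<open>F \<union> F'\<close>, so the initial states differ only on the symmetric
  difference.\<close>

lemma Ecoins_sym_diff:
  assumes "finite F" "finite F'" "real (card (F \<union> F')) \<le> N"
    and g: "lip N \<phi> g" "\<And>x. 0 \<le> \<phi> x"
  shows "\<bar>Ecoins F g - Ecoins F' g\<bar> \<le> (\<Sum>y\<in>(F - F') \<union> (F' - F). \<phi> y)"
proof -
  have fin: "finite (F \<union> F')" using assms by simp
  have "Ecoins F g = Ecoins (F \<union> F') (\<lambda>\<sigma>. g (restrict_config F \<sigma>))"
    "Ecoins F' g = Ecoins (F \<union> F') (\<lambda>\<sigma>. g (restrict_config F' \<sigma>))"
    using fin by (intro Ecoins_restrict; auto)+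
  thus ?thesis
    using assms coins_unit[OF fin]
    by (auto intro!: Ecoins_diff_le lip_restrict_sym_diff)
qed

lemma lip_coord:
  assumes "\<And>z. \<bar>u (z + 1) - u z\<bar> \<le> 1"
  shows "lip N (\<lambda>y. if y = x then 1 else 0) (\<lambda>\<zeta>. u (\<zeta> x))"
  using assms by (auto simp: lip_def incr_def)

lemma bounded_below_mass:
  assumes "\<And>\<zeta>. finite (supp \<zeta>) \<Longrightarrow> \<bar>f \<zeta>\<bar> \<le> mass \<zeta>"
  shows "bounded_below N f"
  unfolding bounded_below_def
proof (intro exI[of _ N] ballI)
  fix \<zeta> :: "'v config" assume "\<zeta> \<in> configs N"
  thus "\<bar>f \<zeta>\<bar> \<le> N" using assms[of \<zeta>] by (simp add: configs_def)
qed

lemma bounded_below_coord: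
  assumes "\<And>z. \<bar>u z\<bar> \<le> \<bar>real_of_int z\<bar>"
  shows "bounded_below N (\<lambda>\<zeta>. u (\<zeta> x))"
  by (rule bounded_below_mass, rule order.trans[OF assms abs_coord_le_mass])

lemma bounded_below_charge: "bounded_below N charge"
  by (rule bounded_below_mass) (rule abs_charge_le_mass)

lemma gen_charge: "finite (supp \<zeta>) \<Longrightarrow> gen charge \<zeta> = 0"
proof -
  assume fin: "finite (supp \<zeta>)"
  have "avg v (\<lambda>w. charge (jump_A v w \<zeta>) - charge \<zeta>) = avg v (\<lambda>_. 0)"
    "avg v (\<lambda>w. charge (jump_B v w \<zeta>) - charge \<zeta>) = avg v (\<lambda>_. 0)" for v
  proof -
    have "v \<noteq> w" if "w \<in> nbrs v" for w using that nbrs_irrefl by auto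
    thus "avg v (\<lambda>w. charge (jump_A v w \<zeta>) - charge \<zeta>) = avg v (\<lambda>_. 0)"
      "avg v (\<lambda>w. charge (jump_B v w \<zeta>) - charge \<zeta>) = avg v (\<lambda>_. 0)"
      by (intro avg_cong; simp add: charge_jump fin)+
  qed
  thus ?thesis by (simp add: gen_eq[OF fin order.refl])
qed

text \<open>No jump changes the charge, so all terms of the series but the zeroth vanish.\<close>

lemma semi_charge:
  assumes "finite (supp \<zeta>)"
  shows "semi t charge \<zeta> = charge \<zeta>"
proof -
  have "(gen ^^ n) charge \<zeta> = (if n = 0 then charge \<zeta> else 0)" for n
  proof (cases n)
    case (Suc m)
    have "(gen ^^ Suc m) charge \<zeta> = (gen ^^ m) (gen charge) \<zeta>" by (simp add: funpow_swap1)
    also have "\<dots> = (gen ^^ m) (\<lambda>_. 0) \<zeta>"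
      by (rule gen_power_local[of "mass \<zeta>"]) (use assms in \<open>auto simp: configs_def gen_charge\<close>)
    also have "\<dots> = 0" using gen_power_cmult[of m 0 "\<lambda>_. 0"] by simp
    finally show ?thesis using Suc by simp
  qed simp
  hence "semi t charge \<zeta> = (\<Sum>n. if n = 0 then charge \<zeta> else 0)"
    unfolding finite_semigroup_def by (intro suminf_cong) auto
  also have "\<dots> = (\<Sum>n\<in>{0::nat}. if n = 0 then charge \<zeta> else 0)"
    by (rule suminf_finite) auto
  finally show ?thesis by simp
qed

text \<open>A graph automorphism carries jumps to jumps with the same rates. On the lattice it will
  be a translation.\<close>

lemma gen_automorphism:
  assumes "bij \<pi>" and nb: "\<And>v. nbrs (\<pi> v) = \<pi> ` nbrs v"
  shows "gen (\<lambda>\<zeta>. f (\<zeta> \<circ> \<pi>)) \<zeta> = gen f (\<zeta> \<circ> \<pi>)"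
proof -
  have inj: "inj \<pi>" using assms by (simp add: bij_def)
  have jA: "jump_A (\<pi> v) (\<pi> w) \<zeta> \<circ> \<pi> = jump_A v w (\<zeta> \<circ> \<pi>)" for v w
    using inj by (auto simp: jump_A_def fun_eq_iff inj_eq)
  have jB: "jump_B (\<pi> v) (\<pi> w) \<zeta> \<circ> \<pi> = jump_B v w (\<zeta> \<circ> \<pi>)" for v w
    using inj by (auto simp: jump_B_def fun_eq_iff inj_eq)
  have "S = \<pi> ` {v. \<pi> v \<in> S}" for S
    using surj_image_vimage_eq[OF bij_is_surj[OF assms(1)], of S] by (simp add: vimage_def)
  from this[of "{v. \<zeta> v > 0}"] this[of "{v. \<zeta> v < 0}"]
  have P: "{v. \<zeta> v > 0} = \<pi> ` {v. \<zeta> (\<pi> v) > 0}" "{v. \<zeta> v < 0} = \<pi> ` {v. \<zeta> (\<pi> v) < 0}"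
    by simp_all
  have injs: "inj_on \<pi> S" for S using inj by (rule inj_on_subset) simp
  show ?thesis
    unfolding generator_def
    by (subst (1) P, subst (1) P(2)) (simp add: sum.reindex injs nb jA jB card_image)
qed

lemma semi_automorphism:
  assumes "bij \<pi>" and nb: "\<And>v. nbrs (\<pi> v) = \<pi> ` nbrs v"
  shows "semi t (\<lambda>\<zeta>. f (\<zeta> \<circ> \<pi>)) \<zeta> = semi t f (\<zeta> \<circ> \<pi>)"
proof -
  have "(gen ^^ n) (\<lambda>\<zeta>. f (\<zeta> \<circ> \<pi>)) = (\<lambda>\<zeta>. (gen ^^ n) f (\<zeta> \<circ> \<pi>))" for n
  proof (induction n)
    case (Suc n)
    have *: "(gen ^^ Suc n) g = gen ((gen ^^ n) g)" for g by simp
    show ?case unfolding * Suc.IH by (rule ext) (rule gen_automorphism[OF assms])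
  qed simp
  thus ?thesis by (simp add: finite_semigroup_def)
qed

lemma Ecoins_automorphism:
  assumes "bij \<pi>" "finite F"
  shows "Ecoins (\<pi> ` F) (\<lambda>\<zeta>. f (\<zeta> \<circ> \<pi>)) = Ecoins F f"
proof -
  have inj: "inj \<pi>" using assms by (simp add: bij_def)
  have "coins F = map_pmf (\<lambda>g. g \<circ> \<pi>) (coins (\<pi> ` F))"
    unfolding coins_def using assms inj
    by (intro Pi_pmf_bij_betw) (auto simp: bij_betw_def inj_eq intro: inj_on_subset)
  thus ?thesis by simp
qed

text \<open>The observable is the charge outside D, which feels a unit added at y only if y is
  outside D. With \<open>lip_semi\<close> any weight that is at least 1 off D then controls the
  charge escaping from D.\<close>

lemma charge_defect_lip:
  assumes "finite D" "\<And>y. 0 \<le> \<Phi> y" "\<And>y. y \<notin> D \<Longrightarrow> 1 \<le> \<Phi> y"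
  shows "lip N \<Phi> (\<lambda>\<zeta>. charge \<zeta> - (\<Sum>x\<in>D. real_of_int (\<zeta> x)))"
  unfolding lip_def
proof (intro allI impI)
  fix \<zeta> :: "'v config" and y assume "\<zeta> \<in> configs N"
  hence "charge (incr y \<zeta>) = charge \<zeta> + 1" by (simp add: charge_incr configs_def)
  moreover have "(\<Sum>x\<in>D. real_of_int (incr y \<zeta> x)) = (\<Sum>x\<in>D. real_of_int (\<zeta> x)) + (if y \<in> D then 1 else 0)"
  proof -
    have "(\<Sum>x\<in>D. real_of_int (incr y \<zeta> x)) = (\<Sum>x\<in>D. real_of_int (\<zeta> x) + (if x = y then 1 else 0))"
      by (intro sum.cong) (auto simp: incr_def)
    thus ?thesis using assms(1) by (simp add: sum.distrib)
  qed
  ultimately show "\<bar>charge (incr y \<zeta>) - (\<Sum>x\<in>D. real_of_int (incr y \<zeta> x)) -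
      (charge \<zeta> - (\<Sum>x\<in>D. real_of_int (\<zeta> x)))\<bar> \<le> \<Phi> y"
    using assms(2,3)[of y] by (cases "y \<in> D") auto
qed

text \<open>Particles from \<open>B\<close> rarely leave \<open>D\<close>. So, up to the error \<open>\<epsilon>\<close>, resampling the initial
  configuration in \<open>B\<close> changes the charge of \<open>D\<close> at time \<open>t\<close> exactly by the initial charge of \<open>B\<close>.\<close>

lemma charge_fluctuation_bound:
  assumes fin: "finite D" "finite G" "B \<subseteq> G"
    and \<Phi>: "superharmonic c \<Phi>" "0 \<le> c" and out: "\<And>y. y \<notin> D \<Longrightarrow> 1 \<le> \<Phi> y" and t: "0 \<le> t"
  defines "\<epsilon> \<equiv> \<Sum>y\<in>B. exp (c * t) * \<Phi> y"
  shows "Ecoins B (\<lambda>\<sigma>. max 0 (\<Sum>v\<in>B. real_of_int (\<sigma> v)))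
      - \<bar>\<Sum>x\<in>D. Ecoins G (semi t (\<lambda>\<zeta>. real_of_int (\<zeta> x)))\<bar> - 2 * \<epsilon>
    \<le> (\<Sum>x\<in>D. Ecoins G (semi t (\<lambda>\<zeta>. pos (\<zeta> x))))"
proof -
  define N where "N = real (card G)"
  define h where "h = semi t (\<lambda>\<zeta>. \<Sum>x\<in>D. real_of_int (\<zeta> x))"
  define rest where "rest \<zeta> = charge \<zeta> - (\<Sum>x\<in>D. real_of_int (\<zeta> x))" for \<zeta>
  define Y where "Y \<sigma> = (\<Sum>v\<in>B. real_of_int (\<sigma> v))" for \<sigma>
  define ind where "ind y = (if y > 0 then 1 else 0 :: real)" for y :: real
  define mrg where "mrg \<sigma> \<tau> = (\<lambda>x. if x \<in> B then \<sigma> x else \<tau> x)" for \<sigma> \<tau> :: "'v config"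
  have finB: "finite B" "finite (G - B)" using fin finite_subset by auto
  have G: "G = B \<union> (G - B)" using fin by auto
  have \<Phi>0: "0 \<le> \<Phi> y" for y using \<Phi> by (simp add: superharmonic_def)
  have be: "bounded_below N (\<lambda>\<zeta>. real_of_int (\<zeta> x))" for x
    by (rule bounded_below_coord) simp
  have bp: "bounded_below N (\<lambda>\<zeta>. pos (\<zeta> x))" for x
    by (rule bounded_below_coord) (simp add: pos_def)
  have bD: "bounded_below N (\<lambda>\<zeta>. \<Sum>x\<in>D. real_of_int (\<zeta> x))" by (intro bounded_below_sum be)
  have brest: "bounded_below N rest"
    unfolding rest_def by (intro bounded_below_diff bounded_below_charge bD)
  have lrest: "lip N (\<lambda>y. exp (c * t) * \<Phi> y) (semi t rest)"
    using lip_semi[OF brest _ \<Phi> _ t] charge_defect_lip[OF fin(1) \<Phi>0 out]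
    by (simp add: rest_def[abs_def] N_def)
  have h_sum: "h \<zeta> = (\<Sum>x\<in>D. semi t (\<lambda>\<zeta>. real_of_int (\<zeta> x)) \<zeta>)" if "\<zeta> \<in> configs N" for \<zeta>
    unfolding h_def by (rule semi_sum[OF be that])
  have h: "h \<zeta> = charge \<zeta> - semi t rest \<zeta>" if "\<zeta> \<in> configs N" for \<zeta>
  proof -
    have "semi t rest \<zeta> = semi t charge \<zeta> - h \<zeta>"
      unfolding rest_def[abs_def] h_def using that bD by (intro semi_diff bounded_below_charge)
    thus ?thesis using that by (simp add: semi_charge configs_def)
  qed
  \<comment> \<open>The comparison is with the state in which B starts empty. The total charge
    differs by exactly \<open>Y \<sigma>\<close>, the expected charge outside D at time t by at most
    \<epsilon>.\<close>
  have key: "\<bar>h (mrg \<sigma> \<tau>) - (h \<tau> + Y \<sigma>)\<bar> \<le> \<epsilon>"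
    if \<sigma>: "\<sigma> \<in> set_pmf (coins B)" and \<tau>: "\<tau> \<in> set_pmf (coins (G - B))" for \<sigma> \<tau>
  proof -
    have unit: "unit_config (mrg \<sigma> \<tau>)"
      using coins_unit[OF finB(1) \<sigma>] coins_unit[OF finB(2) \<tau>] by (simp add: unit_config_def mrg_def)
    have r: "restrict_config ((G - B) \<union> B) (mrg \<sigma> \<tau>) = mrg \<sigma> \<tau>" "restrict_config (G - B) (mrg \<sigma> \<tau>) = \<tau>"
      using coins_apply(2)[OF finB(1) \<sigma>] coins_apply(2)[OF finB(2) \<tau>] fin
      by (auto simp: restrict_config_def mrg_def fun_eq_iff)
    have "\<bar>semi t rest (restrict_config ((G - B) \<union> B) (mrg \<sigma> \<tau>)) - semi t rest (restrict_config (G - B) (mrg \<sigma> \<tau>))\<bar> \<le> \<epsilon>"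
      unfolding \<epsilon>_def
      by (rule lip_restrict[OF finB _ unit _ lrest]) (use G \<Phi>0 in \<open>auto simp: N_def Un_commute\<close>)
    hence 1: "\<bar>semi t rest (mrg \<sigma> \<tau>) - semi t rest \<tau>\<bar> \<le> \<epsilon>" unfolding r .
    have c: "card (G - B) \<le> card G" using fin by (intro card_mono) auto
    have C: "mrg \<sigma> \<tau> \<in> configs N" "\<tau> \<in> configs N"
      using restrict_unit_in_configs[OF unit, of "(G - B) \<union> B" N] r finB G
        coins_in_configs[OF finB(2) \<tau>, of N] c by (auto simp: N_def Un_commute)
    have sup: "supp (mrg \<sigma> \<tau>) \<subseteq> B \<union> (G - B)" "supp \<tau> \<subseteq> G - B"
      using coins_apply(2)[OF finB(2) \<tau>] by (auto simp: supp_def mrg_def split: if_splits)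
    have "charge (mrg \<sigma> \<tau>) = (\<Sum>v\<in>B \<union> (G - B). real_of_int (mrg \<sigma> \<tau> v))"
      using finB sup by (intro charge_eq) auto
    also have "\<dots> = (\<Sum>v\<in>B. real_of_int (mrg \<sigma> \<tau> v)) + (\<Sum>v\<in>G - B. real_of_int (mrg \<sigma> \<tau> v))"
      using finB by (intro sum.union_disjoint) auto
    also have "(\<Sum>v\<in>B. real_of_int (mrg \<sigma> \<tau> v)) = Y \<sigma>"
      unfolding Y_def by (intro sum.cong) (auto simp: mrg_def)
    also have "(\<Sum>v\<in>G - B. real_of_int (mrg \<sigma> \<tau> v)) = (\<Sum>v\<in>G - B. real_of_int (\<tau> v))"
      by (intro sum.cong) (auto simp: mrg_def)
    also have "\<dots> = charge \<tau>"
      using finB sup by (intro charge_eq[symmetric]) auto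
    finally show ?thesis using 1 h[OF C(1)] h[OF C(2)] by linarith
  qed
  \<comment> \<open>The mean charge of D when B starts empty. Averaging over \<sigma>, where Y has
    mean 0, shows that it is within \<epsilon> of \<open>Ecoins G h\<close>; this is the second of
    the two \<epsilon> in the conclusion.\<close>
  define a where "a = Ecoins (G - B) h"
  have Ya: "Ecoins (G - B) (\<lambda>\<tau>. h \<tau> + Y \<sigma>) = a + Y \<sigma>" for \<sigma>
    by (simp add: a_def integrable_coins finB)
  have E: "Ecoins G f = Ecoins B (\<lambda>\<sigma>. Ecoins (G - B) (\<lambda>\<tau>. f (mrg \<sigma> \<tau>)))" for f
    using Ecoins_Un[OF finB, of f] G by (simp add: mrg_def)
  have inner: "\<bar>Ecoins (G - B) (\<lambda>\<tau>. h (mrg \<sigma> \<tau>)) - (a + Y \<sigma>)\<bar> \<le> \<epsilon>" if "\<sigma> \<in> set_pmf (coins B)" for \<sigma>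
    unfolding Ya[symmetric] using finB key[OF that] by (intro Ecoins_diff_le)
  have "\<bar>Ecoins G h - Ecoins B (\<lambda>\<sigma>. a + Y \<sigma>)\<bar> \<le> \<epsilon>"
    unfolding E[of h] using finB inner by (intro Ecoins_diff_le)
  moreover have "Ecoins B (\<lambda>\<sigma>. a + Y \<sigma>) = a"
    using coin_moments(1)[OF finB(1)] by (simp add: integrable_coins finB Y_def)
  ultimately have a: "\<bar>a\<bar> \<le> \<bar>Ecoins G h\<bar> + \<epsilon>" by linarith
  have Ymrg: "Y (mrg \<sigma> \<tau>) = Y \<sigma>" for \<sigma> \<tau>
    unfolding Y_def by (intro sum.cong) (auto simp: mrg_def)
  have "Ecoins B (\<lambda>\<sigma>. max 0 (Y \<sigma>)) - \<bar>a\<bar> - \<epsilon> = Ecoins B (\<lambda>\<sigma>. max 0 (Y \<sigma>) - \<bar>a\<bar> - \<epsilon>)"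
    by (simp add: integrable_coins finB)
  \<comment> \<open>On the event Y > 0, which involves only the coins of B, the average of h over
    the other coins is a + Y up to \<epsilon>.\<close>
  also have "\<dots> \<le> Ecoins B (\<lambda>\<sigma>. Ecoins (G - B) (\<lambda>\<tau>. h (mrg \<sigma> \<tau>)) * ind (Y \<sigma>))"
  proof (rule Ecoins_mono[OF finB(1)])
    fix \<sigma> assume \<sigma>: "\<sigma> \<in> set_pmf (coins B)"
    have "0 \<le> \<epsilon>" unfolding \<epsilon>_def by (intro sum_nonneg) (simp add: \<Phi>0)
    with inner[OF \<sigma>] show "max 0 (Y \<sigma>) - \<bar>a\<bar> - \<epsilon> \<le> Ecoins (G - B) (\<lambda>\<tau>. h (mrg \<sigma> \<tau>)) * ind (Y \<sigma>)"
      by (auto simp: ind_def max_def)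
  qed
  also have "\<dots> = Ecoins G (\<lambda>\<zeta>. h \<zeta> * ind (Y \<zeta>))"
    unfolding E Ymrg by simp
  also have "\<dots> = Ecoins G (\<lambda>\<zeta>. \<Sum>x\<in>D. semi t (\<lambda>\<zeta>. real_of_int (\<zeta> x)) \<zeta> * ind (Y \<zeta>))"
    using coins_in_configs[OF fin(2), of _ N]
    by (intro Ecoins_cong) (simp add: h_sum N_def sum_distrib_right)
  \<comment> \<open>Where Y > 0, the charge is bounded by the number of A-particles; elsewhere the
    indicator gives 0, and that number is nonnegative.\<close>
  also have "\<dots> \<le> Ecoins G (\<lambda>\<zeta>. \<Sum>x\<in>D. semi t (\<lambda>\<zeta>. pos (\<zeta> x)) \<zeta>)"
  proof (intro Ecoins_mono fin(2) sum_mono)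
    fix \<zeta> x assume "\<zeta> \<in> set_pmf (coins G)"
    hence C: "\<zeta> \<in> configs N" using coins_in_configs[OF fin(2)] by (simp add: N_def)
    have "semi t (\<lambda>\<zeta>. real_of_int (\<zeta> x)) \<zeta> \<le> semi t (\<lambda>\<zeta>. pos (\<zeta> x)) \<zeta>"
      using C t by (intro semi_mono[OF be bp]) (auto simp: pos_def)
    moreover have "0 \<le> semi t (\<lambda>\<zeta>. pos (\<zeta> x)) \<zeta>"
      using C t by (intro semi_nonneg[OF bp]) auto
    ultimately show "semi t (\<lambda>\<zeta>. real_of_int (\<zeta> x)) \<zeta> * ind (Y \<zeta>) \<le> semi t (\<lambda>\<zeta>. pos (\<zeta> x)) \<zeta>"
      by (simp add: ind_def)
  qed
  also have "\<dots> = (\<Sum>x\<in>D. Ecoins G (semi t (\<lambda>\<zeta>. pos (\<zeta> x))))"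
    by (intro Bochner_Integration.integral_sum integrable_coins fin(2))
  finally have "Ecoins B (\<lambda>\<sigma>. max 0 (Y \<sigma>)) - \<bar>a\<bar> - \<epsilon> \<le> (\<Sum>x\<in>D. Ecoins G (semi t (\<lambda>\<zeta>. pos (\<zeta> x))))" .
  moreover have "Ecoins G h = (\<Sum>x\<in>D. Ecoins G (semi t (\<lambda>\<zeta>. real_of_int (\<zeta> x))))"
  proof -
    have "Ecoins G h = Ecoins G (\<lambda>\<zeta>. \<Sum>x\<in>D. semi t (\<lambda>\<zeta>. real_of_int (\<zeta> x)) \<zeta>)"
      using coins_in_configs[OF fin(2), of _ N] by (intro Ecoins_cong) (simp add: h_sum N_def)
    also have "\<dots> = (\<Sum>x\<in>D. Ecoins G (semi t (\<lambda>\<zeta>. real_of_int (\<zeta> x))))"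
      by (intro Bochner_Integration.integral_sum integrable_coins fin(2))
    finally show ?thesis .
  qed
  ultimately show ?thesis using a unfolding Y_def by linarith
qed

end

section \<open>The integer lattice\<close>

text \<open>Nonnegative integers with sum 1: one coordinate differs by 1 and the others
  agree.\<close>

lemma lattice_nbrs_eq:
  "lattice_nbrs v = range (\<lambda>i. v + axis i 1) \<union> range (\<lambda>i. v - axis i 1)" for v :: "int ^ 'd"
proof (intro equalityI subsetI)
  fix w assume "w \<in> lattice_nbrs v"
  hence s: "(\<Sum>i\<in>UNIV. \<bar>w $ i - v $ i\<bar>) = 1" by (simp add: lattice_nbrs_def)
  have "\<exists>i. \<bar>w $ i - v $ i\<bar> \<noteq> 0"
  proof (rule ccontr)
    assume "\<not> ?thesis"
    hence "(\<Sum>i\<in>UNIV. \<bar>w $ i - v $ i\<bar>) = 0" by simp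
    with s show False by simp
  qed
  then obtain i where i: "\<bar>w $ i - v $ i\<bar> \<noteq> 0" by blast
  have "\<bar>w $ i - v $ i\<bar> + (\<Sum>j\<in>UNIV - {i}. \<bar>w $ j - v $ j\<bar>) = 1"
    using s by (subst sum.remove[symmetric]) auto
  moreover have nn: "0 \<le> (\<Sum>j\<in>UNIV - {i}. \<bar>w $ j - v $ j\<bar>)" by (intro sum_nonneg) auto
  ultimately have 1: "\<bar>w $ i - v $ i\<bar> = 1" and "(\<Sum>j\<in>UNIV - {i}. \<bar>w $ j - v $ j\<bar>) = 0"
    using i by linarith+
  hence z: "w $ j = v $ j" if "j \<noteq> i" for j
    using that by (subst (asm) sum_nonneg_eq_0_iff) auto
  from 1 consider "w $ i = v $ i + 1" | "w $ i = v $ i - 1" by linarith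
  thus "w \<in> range (\<lambda>i. v + axis i 1) \<union> range (\<lambda>i. v - axis i 1)"
  proof cases
    case 1
    hence "w = v + axis i 1" using z by (auto simp: vec_eq_iff axis_def)
    thus ?thesis by blast
  next
    case 2
    hence "w = v - axis i 1" using z by (auto simp: vec_eq_iff axis_def)
    thus ?thesis by blast
  qed
next
  fix w assume "w \<in> range (\<lambda>i. v + axis i 1) \<union> range (\<lambda>i. v - axis i 1)"
  then obtain i where "w = v + axis i 1 \<or> w = v - axis i 1" by blast
  hence "\<bar>w $ j - v $ j\<bar> = (if j = i then 1 else 0)" for j by (auto simp: axis_def)
  thus "w \<in> lattice_nbrs v" by (simp add: lattice_nbrs_def)
qed

lemma axis_neq_neg: "axis i (1::int) \<noteq> - axis j 1"
proof
  assume "axis i (1::int) = - axis j 1"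
  hence "axis i (1::int) $ i = (- axis j 1) $ i" by simp
  thus False by (simp add: axis_def split: if_splits)
qed

lemma sum_lattice_nbrs:
  fixes v :: "int ^ 'd"
  shows "(\<Sum>w\<in>lattice_nbrs v. g w) = (\<Sum>i\<in>UNIV. g (v + axis i 1) + g (v - axis i 1) :: real)"
proof -
  have inj: "inj (\<lambda>i. v + axis i 1)" "inj (\<lambda>i. v - axis i 1)"
    by (auto simp: inj_def axis_eq_axis)
  have "v + axis i 1 \<noteq> v - axis j 1" for i j
    using axis_neq_neg[of i j] by (metis add_left_cancel diff_conv_add_uminus)
  hence "range (\<lambda>i. v + axis i 1) \<inter> range (\<lambda>i. v - axis i 1) = {}" by auto
  thus ?thesis
    by (simp add: lattice_nbrs_eq sum.union_disjoint sum.reindex inj sum.distrib)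
qed

lemma card_lattice_nbrs: "card (lattice_nbrs (v :: int ^ 'd)) = 2 * CARD('d)"
proof -
  have "real (card (lattice_nbrs v)) = (\<Sum>w\<in>lattice_nbrs v. 1)" by simp
  also have "\<dots> = 2 * CARD('d)" unfolding sum_lattice_nbrs by simp
  finally show ?thesis by linarith
qed

lemma lattice_nbrs_sym: "w \<in> lattice_nbrs v \<longleftrightarrow> v \<in> lattice_nbrs w"
  by (simp add: lattice_nbrs_def abs_minus_commute)

lemma lattice_nbrs_translate: "lattice_nbrs (v + x) = (\<lambda>w. w + x) ` lattice_nbrs v"
proof (intro equalityI subsetI)
  fix w assume "w \<in> lattice_nbrs (v + x)"
  hence "w - x \<in> lattice_nbrs v" by (simp add: lattice_nbrs_def algebra_simps)
  thus "w \<in> (\<lambda>w. w + x) ` lattice_nbrs v" by (rule rev_image_eqI) simp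
qed (auto simp: lattice_nbrs_def)

locale lattice_graph =
  fixes rB :: real and dim :: "'d::finite itself"
  assumes rB: "0 \<le> rB" "rB \<le> 1"
begin

sublocale annihilation_graph "lattice_nbrs :: int ^ 'd \<Rightarrow> _" 1 rB
  by unfold_locales (auto simp: lattice_nbrs_eq rB axis_eq_0_iff)

end

definition cube :: "nat \<Rightarrow> (int ^ 'd) set" where
  "cube n = {x. \<forall>i. \<bar>x $ i\<bar> \<le> int n}"

lemma abs_le_int_iff: "\<bar>z\<bar> \<le> int n \<longleftrightarrow> z \<in> {- int n..int n}"
  by auto

text \<open>Passing to a function space makes cardinalities and sums of products over cubes factor
  over the coordinates.\<close>

lemma cube_eq: "(cube n :: (int ^ 'd) set) = vec_lambda ` (UNIV \<rightarrow>\<^sub>E {- int n..int n})"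
proof (intro equalityI subsetI)
  fix x :: "int ^ 'd" assume "x \<in> cube n"
  hence "vec_nth x \<in> UNIV \<rightarrow>\<^sub>E {- int n..int n}" by (simp add: cube_def abs_le_int_iff PiE_def)
  thus "x \<in> vec_lambda ` (UNIV \<rightarrow>\<^sub>E {- int n..int n})" by (rule rev_image_eqI) simp
qed (auto simp: cube_def abs_le_int_iff PiE_def Pi_def)

lemma inj_vec_lambda: "inj_on vec_lambda S"
  by (auto simp: inj_on_def vec_lambda_inject)

lemma finite_cube: "finite (cube n :: (int ^ 'd) set)"
  unfolding cube_eq by (intro finite_imageI finite_PiE) auto

lemma card_cube: "card (cube n :: (int ^ 'd) set) = (2 * n + 1) ^ CARD('d)"
  unfolding cube_eq by (simp add: card_image inj_vec_lambda card_PiE nat_add_distrib nat_mult_distrib)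

lemma cube_mono: "m \<le> n \<Longrightarrow> cube m \<subseteq> cube n"
  by (auto simp: cube_def intro: order.trans)

lemma finite_subset_cube:
  assumes "finite F"
  obtains n where "F \<subseteq> (cube n :: (int ^ 'd) set)"
proof
  define n where "n = (\<Sum>x\<in>F. \<Sum>i\<in>UNIV. nat \<bar>x $ i\<bar>)"
  show "F \<subseteq> cube n"
  proof
    fix x assume x: "x \<in> F"
    have "nat \<bar>x $ i\<bar> \<le> n" for i
    proof -
      have "nat \<bar>x $ i\<bar> \<le> (\<Sum>i\<in>UNIV. nat \<bar>x $ i\<bar>)" by (intro member_le_sum) auto
      also have "\<dots> \<le> n" unfolding n_def using x assms by (intro member_le_sum[of x F]) auto
      finally show ?thesis .
    qed
    thus "x \<in> cube n" by (simp add: cube_def nat_le_iff)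
  qed
qed

lemma countable_lattice: "countable (UNIV :: (int ^ 'd) set)"
proof -
  have "x \<in> (\<Union>n. cube n)" for x :: "int ^ 'd"
    using finite_subset_cube[of "{x}"] by auto
  hence "(UNIV :: (int ^ 'd) set) = (\<Union>n. cube n)" by blast
  thus ?thesis using finite_cube by (metis countable_UN countable_finite countableI_type)
qed

text \<open>The weight for passing from finite to infinite systems: summable and superharmonic, so
  initial sites outside a large F hardly influence the origin at a fixed time. Its growth rate is
  too large for the scale R, where \<open>barrier\<close> takes over.\<close>

definition decay :: "int ^ 'd \<Rightarrow> real" where
  "decay x = exp (- (\<Sum>i\<in>UNIV. \<bar>real_of_int (x $ i)\<bar>))"

lemma decay_pos: "0 < decay x" and decay_0: "decay 0 = 1"
  by (simp_all add: decay_def)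

lemma decay_nonneg [simp]: "0 \<le> decay x"
  by (rule less_imp_le[OF decay_pos])

text \<open>The weight is a product over the coordinates, so its sum over a cube is a power of a
  one-dimensional sum, which is at most twice a geometric series.\<close>

lemma decay_bounded: "\<exists>S. \<forall>n. (\<Sum>x\<in>(cube n :: (int ^ 'd) set). decay x) \<le> S"
proof (intro exI allI)
  fix n :: nat
  define e where "e k = exp (- \<bar>real_of_int k\<bar>)" for k
  define s where "s = (\<Sum>k. exp (- 1 :: real) ^ k)"
  have half: "(\<Sum>k\<le>n. exp (- 1 :: real) ^ k) \<le> s"
    unfolding s_def by (intro sum_le_suminf summable_geometric) auto
  have "(\<Sum>k\<in>{- int n..int n}. e k) \<le> (\<Sum>k\<in>int ` {..n} \<union> (\<lambda>k. - int k) ` {..n}. e k)"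
  proof (rule sum_mono2)
    show "{- int n..int n} \<subseteq> int ` {..n} \<union> (\<lambda>k. - int k) ` {..n}"
    proof
      fix k assume k: "k \<in> {- int n..int n}"
      show "k \<in> int ` {..n} \<union> (\<lambda>k. - int k) ` {..n}"
      proof (cases "k \<ge> 0")
        case True
        with k have "k \<in> int ` {..n}" by (intro image_eqI[of _ _ "nat k"]) auto
        thus ?thesis by blast
      next
        case False
        with k have "k \<in> (\<lambda>k. - int k) ` {..n}" by (intro image_eqI[of _ _ "nat (- k)"]) auto
        thus ?thesis by blast
      qed
    qed
  qed (auto simp: e_def)
  also have "\<dots> \<le> (\<Sum>k\<in>int ` {..n}. e k) + (\<Sum>k\<in>(\<lambda>k. - int k) ` {..n}. e k)"
    by (subst sum.union_inter[symmetric]) (auto simp: e_def intro: sum_nonneg)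
  also have "\<dots> = (\<Sum>k\<le>n. e (int k)) + (\<Sum>k\<le>n. e (- int k))"
    by (subst (1 2) sum.reindex) (auto simp: inj_on_def)
  also have "\<dots> = 2 * (\<Sum>k\<le>n. exp (- 1 :: real) ^ k)"
    by (simp add: e_def exp_of_nat_mult[symmetric])
  finally have 1: "(\<Sum>k\<in>{- int n..int n}. e k) \<le> 2 * s" using half by linarith
  have "(\<Sum>x\<in>(cube n :: (int ^ 'd) set). decay x) =
      (\<Sum>f\<in>(UNIV :: 'd set) \<rightarrow>\<^sub>E {- int n..int n}. \<Prod>i\<in>UNIV. e (f i))"
    unfolding cube_eq
    by (subst sum.reindex) (auto simp: inj_vec_lambda decay_def e_def exp_sum sum_negf[symmetric])
  also have "\<dots> = (\<Prod>i\<in>(UNIV :: 'd set). \<Sum>k\<in>{- int n..int n}. e k)"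
    by (rule prod_sum_PiE[symmetric]) auto
  also have "\<dots> \<le> (2 * s) ^ CARD('d)"
    unfolding prod_constant by (rule power_mono[OF 1]) (simp add: sum_nonneg e_def)
  finally show "(\<Sum>x\<in>(cube n :: (int ^ 'd) set). decay x) \<le> (2 * s) ^ CARD('d)" .
qed

lemma decay_summable: "(decay :: int ^ 'd \<Rightarrow> real) summable_on UNIV"
proof -
  obtain S where S: "\<And>n. (\<Sum>x\<in>(cube n :: (int ^ 'd) set). decay x) \<le> S"
    using decay_bounded by blast
  show ?thesis
  proof (rule nonneg_bounded_partial_sums_imp_summable_on)
    show "\<forall>\<^sub>F F in finite_subsets_at_top UNIV. (\<Sum>x\<in>F. decay (x :: int ^ 'd)) \<le> S"
    proof (rule eventually_finite_subsets_at_top_weakI)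
      fix F :: "(int ^ 'd) set" assume "finite F"
      then obtain n where n: "F \<subseteq> cube n" by (rule finite_subset_cube)
      have "(\<Sum>x\<in>F. decay x) \<le> (\<Sum>x\<in>(cube n :: (int ^ 'd) set). decay x)"
        by (intro sum_mono2 finite_cube n) auto
      thus "(\<Sum>x\<in>F. decay x) \<le> S" using S[of n] by linarith
    qed
  qed auto
qed

text \<open>Total minus partial sum, so that convergence to 0 is immediate from summability.\<close>

definition tail :: "(int ^ 'd) set \<Rightarrow> real" where
  "tail F = infsum (decay :: int ^ 'd \<Rightarrow> real) UNIV - (\<Sum>x\<in>F. decay x)"

lemma sum_decay_le_tail: "finite F \<Longrightarrow> finite H \<Longrightarrow> F \<inter> H = {} \<Longrightarrow> (\<Sum>x\<in>H. decay x) \<le> tail F"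
  using finite_sum_le_infsum[OF decay_summable, of "F \<union> H"] by (simp add: tail_def sum.union_disjoint)

lemma tail_antimono: "finite F' \<Longrightarrow> F \<subseteq> F' \<Longrightarrow> tail F' \<le> tail F"
  unfolding tail_def by (intro diff_left_mono sum_mono2) auto

lemma tail_nonneg: "finite F \<Longrightarrow> 0 \<le> tail F"
  using sum_decay_le_tail[of F "{}"] by simp

lemma tail_tendsto: "(tail \<longlongrightarrow> 0) (finite_subsets_at_top (UNIV :: (int ^ 'd) set))"
proof -
  let ?S = "infsum (decay :: int ^ 'd \<Rightarrow> real) UNIV"
  have "((\<lambda>F. ?S - (\<Sum>x\<in>F. decay (x :: int ^ 'd))) \<longlongrightarrow> ?S - ?S) (finite_subsets_at_top UNIV)"
    by (rule tendsto_diff[OF tendsto_const infsum_tendsto[OF decay_summable]])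
  thus ?thesis by (simp add: tail_def[abs_def])
qed

lemma tail_cube_small:
  assumes "0 < \<eta>"
  obtains n where "tail (cube n :: (int ^ 'd) set) < \<eta>"
proof -
  have "\<forall>\<^sub>F F in finite_subsets_at_top (UNIV :: (int ^ 'd) set). tail F < \<eta>"
    using order_tendstoD(2)[OF tail_tendsto assms] .
  then obtain F :: "(int ^ 'd) set" where F: "finite F" "\<And>F'. finite F' \<Longrightarrow> F \<subseteq> F' \<Longrightarrow> tail F' < \<eta>"
    by (auto simp: eventually_finite_subsets_at_top)
  from F(1) obtain n where "F \<subseteq> cube n" by (rule finite_subset_cube)
  with F finite_cube that show ?thesis by blast
qed

section \<open>The exponential barrier\<close>

lemma cosh_le_1_plus_sq:
  fixes x :: real
  assumes "0 \<le> x" "x \<le> 1"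
  shows "cosh x \<le> 1 + x ^ 2"
proof -
  have "exp x \<le> 1 + x + x ^ 2" by (rule exp_bound[OF assms])
  moreover have "exp (- x) \<le> 1 - x + x ^ 2"
  proof -
    have "1 \<le> (1 - x + x ^ 2) * (1 + x)"
      using assms by (simp add: algebra_simps power2_eq_square)
    also have "\<dots> \<le> (1 - x + x ^ 2) * exp x"
      using assms by (intro mult_left_mono exp_ge_add_one_self) simp
    finally show ?thesis by (simp add: exp_minus field_simps)
  qed
  ultimately show ?thesis by (simp add: cosh_field_def)
qed

text \<open>2 cosh z is at least exp |z|, so a single coordinate beyond R brings the sum to 1.
  Unlike exp |z|, cosh is an exact eigenfunction of averaging over the two neighbours on a
  line.\<close>

definition barrier :: "real \<Rightarrow> nat \<Rightarrow> int ^ 'd \<Rightarrow> real" where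
  "barrier \<theta> R y = (\<Sum>i\<in>UNIV. 2 * exp (- (\<theta> * real R)) * cosh (\<theta> * real_of_int (y $ i)))"

lemma barrier_outside:
  fixes y :: "int ^ 'd"
  assumes "y \<notin> cube R" "0 \<le> \<theta>"
  shows "1 \<le> barrier \<theta> R y"
proof -
  obtain i where i: "\<bar>y $ i\<bar> > int R" using assms by (auto simp: cube_def not_le)
  define z where "z = \<theta> * \<bar>real_of_int (y $ i)\<bar>"
  have "real R \<le> \<bar>real_of_int (y $ i)\<bar>" using i by linarith
  hence "\<theta> * real R \<le> z" unfolding z_def using assms by (intro mult_left_mono)
  hence "1 \<le> exp (- (\<theta> * real R)) * exp z" by (simp add: exp_add[symmetric])
  also have "\<dots> \<le> exp (- (\<theta> * real R)) * (2 * cosh z)"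
    by (intro mult_left_mono) (auto simp: cosh_field_def)
  also have "cosh z = cosh (\<theta> * real_of_int (y $ i))"
    by (cases "y $ i \<ge> 0") (auto simp: z_def)
  also have "exp (- (\<theta> * real R)) * (2 * cosh (\<theta> * real_of_int (y $ i))) =
      2 * exp (- (\<theta> * real R)) * cosh (\<theta> * real_of_int (y $ i))" by simp
  also have "\<dots> \<le> barrier \<theta> R y"
    unfolding barrier_def by (rule member_le_sum) auto
  finally show ?thesis .
qed

lemma barrier_inside:
  fixes y :: "int ^ 'd"
  assumes "y \<in> cube r" "0 \<le> \<theta>"
  shows "barrier \<theta> R y \<le> 2 * CARD('d) * exp (\<theta> * (real r - real R))"
proof -
  have "cosh (\<theta> * real_of_int (y $ i)) \<le> exp (\<theta> * real r)" for i
  proof -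
    have "\<bar>y $ i\<bar> \<le> int r" using assms by (simp add: cube_def)
    hence "\<bar>real_of_int (y $ i)\<bar> \<le> real r" by linarith
    hence "\<theta> * \<bar>real_of_int (y $ i)\<bar> \<le> \<theta> * real r" using assms by (intro mult_left_mono)
    hence "\<bar>\<theta> * real_of_int (y $ i)\<bar> \<le> \<theta> * real r" using assms by (simp add: abs_mult)
    hence "exp (\<theta> * real_of_int (y $ i)) \<le> exp (\<theta> * real r)" "exp (- (\<theta> * real_of_int (y $ i))) \<le> exp (\<theta> * real r)"
      by (simp_all add: abs_le_iff)
    moreover have "(p + q) / 2 \<le> c" if "p \<le> c" "q \<le> c" for p q c :: real
      using that by simp
    ultimately show ?thesis unfolding cosh_field_def by blast
  qed
  hence "barrier \<theta> R y \<le> (\<Sum>i\<in>(UNIV :: 'd set). 2 * exp (- (\<theta> * real R)) * exp (\<theta> * real r))"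
    unfolding barrier_def by (intro sum_mono mult_left_mono) auto
  also have "\<dots> = 2 * CARD('d) * exp (\<theta> * (real r - real R))"
    by (simp add: exp_add[symmetric] algebra_simps)
  finally show ?thesis .
qed

context lattice_graph
begin

lemma avg_lattice: "avg v g = (\<Sum>i\<in>UNIV. g (v + axis i 1) + g (v - axis i 1)) / (2 * real CARD('d))"
  by (simp add: avg_def sum_lattice_nbrs card_lattice_nbrs)

text \<open>A step changes the l1 norm by at most 1, hence the weight by at most a factor e.\<close>

lemma superharmonic_decay: "superharmonic (exp 1 - 1) decay"
  unfolding superharmonic_def
proof safe
  fix x :: "int ^ 'd"
  have "avg x decay \<le> avg x (\<lambda>_. exp 1 * decay x)"
  proof (rule avg_mono)
    fix w assume "w \<in> lattice_nbrs x"
    hence "(\<Sum>i\<in>UNIV. \<bar>w $ i - x $ i\<bar>) = 1" by (simp add: lattice_nbrs_def)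
    hence "real_of_int (\<Sum>i\<in>UNIV. \<bar>w $ i - x $ i\<bar>) = 1" by simp
    hence 1: "(\<Sum>i\<in>UNIV. \<bar>real_of_int (w $ i) - real_of_int (x $ i)\<bar>) = 1" by simp
    have "(\<Sum>i\<in>UNIV. \<bar>real_of_int (x $ i)\<bar>) \<le>
      (\<Sum>i\<in>UNIV. \<bar>real_of_int (w $ i)\<bar> + \<bar>real_of_int (w $ i) - real_of_int (x $ i)\<bar>)"
      by (intro sum_mono) linarith
    with 1 show "decay w \<le> exp 1 * decay x"
      by (simp add: decay_def exp_add[symmetric] sum.distrib)
  qed
  thus "avg x decay \<le> (1 + (exp 1 - 1)) * decay x" by simp
qed simp

text \<open>By the addition formula, averaging over the two neighbours along an axis multiplies the
  term of that coordinate by cosh \<theta>, which is at most 1 + \<theta>^2 for \<theta> in the unit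
  interval.\<close>

lemma superharmonic_barrier:
  assumes "0 \<le> \<theta>" "\<theta> \<le> 1"
  shows "superharmonic (\<theta>\<^sup>2) (barrier \<theta> R)"
  unfolding superharmonic_def
proof safe
  fix x :: "int ^ 'd"
  show "0 \<le> barrier \<theta> R x" unfolding barrier_def by (intro sum_nonneg) auto
  define C where "C k = 2 * exp (- (\<theta> * real R)) * cosh (\<theta> * real_of_int k)" for k
  have C0: "0 \<le> C k" for k by (simp add: C_def)
  have C1: "C (k + 1) + C (k - 1) \<le> 2 * (1 + \<theta>\<^sup>2) * C k" for k
  proof -
    have "cosh (\<theta> * (real_of_int k + 1)) + cosh (\<theta> * (real_of_int k - 1)) = 2 * cosh \<theta> * cosh (\<theta> * real_of_int k)"
      by (simp add: ring_distribs cosh_add cosh_diff)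
    hence "C (k + 1) + C (k - 1) = 2 * cosh \<theta> * C k"
      by (simp add: C_def distrib_left[symmetric])
    also have "\<dots> \<le> 2 * (1 + \<theta>\<^sup>2) * C k"
      using cosh_le_1_plus_sq[OF assms] by (intro mult_right_mono C0) simp
    finally show ?thesis .
  qed
  \<comment> \<open>For the coordinates that a step along axis j leaves unchanged.\<close>
  have C2: "2 * C k \<le> 2 * (1 + \<theta>\<^sup>2) * C k" for k
    using C0[of k] by (simp add: algebra_simps)
  have "barrier \<theta> R (x + axis j 1) + barrier \<theta> R (x - axis j 1) \<le> 2 * (1 + \<theta>\<^sup>2) * barrier \<theta> R x" for j
  proof -
    have "barrier \<theta> R (x + axis j 1) + barrier \<theta> R (x - axis j 1) =
        (\<Sum>i\<in>UNIV. C ((x + axis j 1) $ i) + C ((x - axis j 1) $ i))"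
      by (simp add: barrier_def C_def sum.distrib)
    also have "\<dots> \<le> (\<Sum>i\<in>UNIV. 2 * (1 + \<theta>\<^sup>2) * C (x $ i))"
      using C1 C2 by (intro sum_mono) (auto simp: axis_def)
    also have "\<dots> = 2 * (1 + \<theta>\<^sup>2) * barrier \<theta> R x"
      unfolding sum_distrib_left[symmetric] by (simp add: barrier_def C_def)
    finally show ?thesis .
  qed
  hence "(\<Sum>j\<in>(UNIV :: 'd set). barrier \<theta> R (x + axis j 1) + barrier \<theta> R (x - axis j 1)) \<le>
      (\<Sum>j\<in>(UNIV :: 'd set). 2 * (1 + \<theta>\<^sup>2) * barrier \<theta> R x)"
    by (rule sum_mono)
  thus "avg x (barrier \<theta> R) \<le> (1 + \<theta>\<^sup>2) * barrier \<theta> R x"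
    unfolding avg_lattice by (simp add: divide_le_eq mult_ac)
qed

end

lemma Ecoins_coord:
  assumes "finite F"
  shows "Ecoins F (\<lambda>\<sigma>. real_of_int (\<sigma> x)) = 0"
proof (cases "x \<in> F")
  case True
  hence "F = insert x (F - {x})" by auto
  moreover have "Ecoins (insert x (F - {x})) (\<lambda>\<sigma>. real_of_int (\<sigma> x)) = 0"
    using assms by (subst Ecoins_insert) auto
  ultimately show ?thesis by simp
next
  case False
  have "Ecoins F (\<lambda>\<sigma>. real_of_int (\<sigma> x)) = Ecoins F (\<lambda>_. 0)"
    using False assms by (intro Ecoins_cong) (simp add: coins_apply(2))
  thus ?thesis by simp
qed

context annihilation_graph
begin

lemma lip_mono: "lip N \<phi> f \<Longrightarrow> (\<And>x. \<phi> x \<le> \<psi> x) \<Longrightarrow> lip N \<psi> f"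
  unfolding lip_def by (meson order.trans)

lemma semi_0: "semi 0 f = f"
proof
  fix \<zeta>
  have "semi 0 f \<zeta> = (\<Sum>n\<in>{0::nat}. 0 ^ n / fact n * (gen ^^ n) f \<zeta>)"
    unfolding finite_semigroup_def by (rule suminf_finite) auto
  thus "semi 0 f \<zeta> = f \<zeta>" by simp
qed

lemma has_derivative_Ecoins_semi:
  assumes "finite F" "bounded_below (card F) f"
  shows "((\<lambda>t. Ecoins F (semi t f)) has_real_derivative Ecoins F (semi t (gen f))) (at t)"
proof -
  have E: "Ecoins F g = (\<Sum>\<sigma>\<in>set_pmf (coins F). g \<sigma> * pmf (coins F) \<sigma>)" for g
    using assms by (subst integral_measure_pmf[of "set_pmf (coins F)"]) (auto simp: finite_set_coins mult.commute)
  show ?thesis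
    unfolding E
    by (intro DERIV_sum DERIV_cmult_right has_derivative_semi[OF assms(2)] coins_in_configs[OF assms(1)]) auto
qed

end

section \<open>Translation invariance and the mean charge of a site\<close>

context lattice_graph
begin

text \<open>The factor that \<open>lip_semi\<close> produces for the weight
  \<open>decay\<close>.\<close>

definition growth :: "real \<Rightarrow> real" where
  "growth t = exp ((exp 1 - 1) * t)"

lemma growth_pos: "0 < growth t" and growth_mono: "s \<le> t \<Longrightarrow> growth s \<le> growth t"
  by (auto simp: growth_def intro!: mult_left_mono)

text \<open>A common interface for the one-site observables: the charge, \<open>flow\<close> and the
  truncated number of A-particles. The bound on increments gives a \<open>lip\<close> weight
  concentrated at the site, the bound on values gives \<open>bounded_below\<close>.\<close>

definition contractive :: "(int \<Rightarrow> real) \<Rightarrow> bool" where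
  "contractive u \<longleftrightarrow> u 0 = 0 \<and> (\<forall>z. \<bar>u (z + 1) - u z\<bar> \<le> 1) \<and> (\<forall>z. \<bar>u z\<bar> \<le> \<bar>real_of_int z\<bar>)"

lemma contractive_bounded: "contractive u \<Longrightarrow> bounded_below N (\<lambda>\<zeta>. u (\<zeta> x))"
  by (rule bounded_below_coord) (simp add: contractive_def)

lemma lip_semi_origin:
  assumes u: "contractive u" and "0 \<le> N" "0 \<le> t"
  shows "lip N (\<lambda>y. growth t * decay y) (semi t (\<lambda>\<zeta>. u (\<zeta> 0)))"
  unfolding growth_def
proof (rule lip_semi[OF contractive_bounded[OF u] _ superharmonic_decay])
  show "lip N decay (\<lambda>\<zeta>. u (\<zeta> 0))"
  proof (rule lip_mono)
    show "lip N (\<lambda>y. if y = 0 then 1 else 0) (\<lambda>\<zeta>. u (\<zeta> 0))"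
      using u by (intro lip_coord) (simp add: contractive_def)
  qed (simp add: decay_0)
qed (use assms in simp_all)

text \<open>A site in only one of the two sets lies outside the other, so the weights that occur are
  bounded by two tails.\<close>

lemma Ecoins_origin_diff:
  assumes u: "contractive u" and "0 \<le> t" "finite F" "finite F'"
  shows "\<bar>Ecoins F (semi t (\<lambda>\<zeta>. u (\<zeta> 0))) - Ecoins F' (semi t (\<lambda>\<zeta>. u (\<zeta> 0)))\<bar> \<le> growth t * (tail F + tail F')"
proof -
  have "\<bar>Ecoins F (semi t (\<lambda>\<zeta>. u (\<zeta> 0))) - Ecoins F' (semi t (\<lambda>\<zeta>. u (\<zeta> 0)))\<bar> \<le>
      (\<Sum>y\<in>(F - F') \<union> (F' - F). growth t * decay y)"
    using assms growth_pos[of t]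
    by (intro Ecoins_sym_diff[OF _ _ order.refl] lip_semi_origin) auto
  also have "\<dots> = growth t * ((\<Sum>y\<in>F - F'. decay y) + (\<Sum>y\<in>F' - F. decay y))"
    unfolding sum_distrib_left[symmetric] using assms by (subst sum.union_disjoint) auto
  also have "\<dots> \<le> growth t * (tail F' + tail F)"
    using assms growth_pos[of t] by (intro mult_left_mono add_mono sum_decay_le_tail) auto
  finally show ?thesis by (simp add: add.commute)
qed

text \<open>The dynamics and the law of the coins are translation invariant; only the finite set
  moves.\<close>

lemma Ecoins_translate:
  assumes "finite G"
  shows "Ecoins G (semi t (\<lambda>\<zeta>. u (\<zeta> x))) = Ecoins ((\<lambda>v. v - x) ` G) (semi t (\<lambda>\<zeta>. u (\<zeta> 0)))"
proof -
  define \<pi> where "\<pi> = (\<lambda>v :: int ^ 'd. v + x)"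
  have bij: "bij \<pi>" unfolding \<pi>_def by (rule bij_betw_byWitness[of _ "\<lambda>v. v - x"]) auto
  have nb: "lattice_nbrs (\<pi> v) = \<pi> ` lattice_nbrs v" for v
    unfolding \<pi>_def by (rule lattice_nbrs_translate)
  have "semi t (\<lambda>\<zeta>. u (\<zeta> x)) = (\<lambda>\<zeta>. semi t (\<lambda>\<zeta>. u (\<zeta> 0)) (\<zeta> \<circ> \<pi>))"
    using semi_automorphism[OF bij nb, of t "\<lambda>\<zeta>. u (\<zeta> 0)"] by (auto simp: \<pi>_def)
  moreover have "G = \<pi> ` (\<lambda>v. v - x) ` G" by (auto simp: \<pi>_def image_image)
  ultimately show ?thesis
    using Ecoins_automorphism[OF bij, of "(\<lambda>v. v - x) ` G" "semi t (\<lambda>\<zeta>. u (\<zeta> 0))"] assms by simp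
qed

text \<open>The net rate at which charge leaves a site with charge z: A-particles carry off +1 at
  rate 1, B-particles -1 at rate \<open>rB\<close>.\<close>

definition flow :: "int \<Rightarrow> real" where
  "flow z = pos z - rB * pos (- z)"

lemma contractive_flow: "contractive flow"
proof -
  have flow_nonpos: "flow z = rB * real_of_int z" if "z \<le> 0" for z
    using that by (simp add: flow_def pos_def max_absorb1 max_absorb2)
  have "\<bar>flow (z + 1) - flow z\<bar> \<le> 1" "\<bar>flow z\<bar> \<le> \<bar>real_of_int z\<bar>" for z
  proof -
    consider "z \<ge> 0" | "z < 0" by linarith
    hence "\<bar>flow (z + 1) - flow z\<bar> \<le> 1 \<and> \<bar>flow z\<bar> \<le> \<bar>real_of_int z\<bar>"
    proof cases
      case 1
      thus ?thesis by (auto simp: flow_def pos_def)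
    next
      case 2
      hence "flow z = rB * real_of_int z" "flow (z + 1) = rB * real_of_int (z + 1)"
        using flow_nonpos[of z] flow_nonpos[of "z + 1"] by simp_all
      moreover have "rB * \<bar>real_of_int z\<bar> \<le> 1 * \<bar>real_of_int z\<bar>"
        using rB by (intro mult_right_mono) auto
      ultimately show ?thesis using rB by (simp add: abs_mult algebra_simps)
    qed
    thus "\<bar>flow (z + 1) - flow z\<bar> \<le> 1" "\<bar>flow z\<bar> \<le> \<bar>real_of_int z\<bar>" by auto
  qed
  thus ?thesis by (simp add: contractive_def flow_def pos_def)
qed

lemma contractive_id: "contractive real_of_int"
  by (auto simp: contractive_def pos_def)

text \<open>Each neighbour sends the fraction 1 / (2 d) of its flow to the origin, and the origin
  loses its own flow. So the charge drifts by a normalised discrete Laplacian of the flow.\<close>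

lemma gen_origin:
  assumes "finite (supp \<zeta>)"
  shows "gen (\<lambda>\<zeta>. real_of_int (\<zeta> 0)) \<zeta> =
    1 / (2 * real CARD('d)) * (\<Sum>w\<in>lattice_nbrs 0. flow (\<zeta> w) - flow (\<zeta> 0))"
proof -
  let ?n = "2 * real CARD('d)"
  define V where "V = insert 0 (lattice_nbrs 0 \<union> supp \<zeta>)"
  have V: "finite V" "supp \<zeta> \<subseteq> V" using assms finite_nbrs by (auto simp: V_def)
  define g where "g v = (if v \<in> lattice_nbrs 0 then 1 / ?n else 0) - (if v = 0 then 1 else 0 :: real)" for v :: "int ^ 'd"
  have avg0: "avg v (\<lambda>w. if w = 0 then 1 else 0) = (if v \<in> lattice_nbrs 0 then 1 / ?n else 0)" for v
    using lattice_nbrs_sym[of 0 v] finite_nbrs[of v] by (simp add: avg_def card_lattice_nbrs)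
  have A: "avg v (\<lambda>w. real_of_int (jump_A v w \<zeta> 0) - real_of_int (\<zeta> 0)) = g v" for v
  proof -
    have "avg v (\<lambda>w. real_of_int (jump_A v w \<zeta> 0) - real_of_int (\<zeta> 0)) =
        avg v (\<lambda>w. (if w = 0 then 1 else 0) - (if v = 0 then 1 else 0))"
      by (rule avg_cong) (use nbrs_irrefl in \<open>auto simp: jump_A_def\<close>)
    thus ?thesis by (simp only: avg_diff avg0 avg_const g_def)
  qed
  have B: "avg v (\<lambda>w. real_of_int (jump_B v w \<zeta> 0) - real_of_int (\<zeta> 0)) = - g v" for v
  proof -
    have "avg v (\<lambda>w. real_of_int (jump_B v w \<zeta> 0) - real_of_int (\<zeta> 0)) =
        avg v (\<lambda>w. (if v = 0 then 1 else 0) - (if w = 0 then 1 else 0))"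
      by (rule avg_cong) (use nbrs_irrefl in \<open>auto simp: jump_B_def\<close>)
    thus ?thesis by (simp only: avg_diff avg0 avg_const g_def)
  qed
  have "gen (\<lambda>\<zeta>. real_of_int (\<zeta> 0)) \<zeta> = (\<Sum>v\<in>V. flow (\<zeta> v) * g v)"
    unfolding gen_eq[OF V] A B by (intro sum.cong) (auto simp: flow_def algebra_simps)
  also have "\<dots> = (\<Sum>v\<in>V. if v \<in> lattice_nbrs 0 then flow (\<zeta> v) / ?n else 0) - (\<Sum>v\<in>V. if v = 0 then flow (\<zeta> v) else 0)"
    unfolding sum_subtractf[symmetric] by (intro sum.cong) (auto simp: g_def algebra_simps)
  also have "(\<Sum>v\<in>V. if v \<in> lattice_nbrs 0 then flow (\<zeta> v) / ?n else 0) = (\<Sum>v\<in>lattice_nbrs 0. flow (\<zeta> v) / ?n)"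
    using V by (intro sum.mono_neutral_cong_right) (auto simp: V_def)
  also have "(\<Sum>v\<in>V. if v = 0 then flow (\<zeta> v) else 0) = flow (\<zeta> 0)"
    using V by (simp add: V_def)
  finally show ?thesis
    by (simp add: sum_subtractf card_lattice_nbrs sum_divide_distrib[symmetric] field_simps)
qed

text \<open>The expected charge of a site does not change, since the expected flows along an edge
  cancel up to the effect of the boundary of \<open>F\<close>.\<close>

lemma Ecoins_origin_small:
  assumes F: "finite F" and t: "0 \<le> t"
    and \<eta>: "tail F \<le> \<eta>" "\<And>w. w \<in> lattice_nbrs 0 \<Longrightarrow> tail ((\<lambda>v. v - w) ` F) \<le> \<eta>"
  shows "\<bar>Ecoins F (semi t (\<lambda>\<zeta>. real_of_int (\<zeta> 0)))\<bar> \<le> 2 * \<eta> * growth t * t"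
proof (cases "t = 0")
  case True
  thus ?thesis using F by (simp add: semi_0 Ecoins_coord)
next
  case False
  define N where "N = real (card F)"
  define f where "f = (\<lambda>\<zeta> :: (int ^ 'd) config. real_of_int (\<zeta> 0))"
  define A where "A s = Ecoins F (semi s f)" for s
  define n where "n = 2 * real CARD('d)"
  have n: "n > 0" by (simp add: n_def)
  define \<Psi> where "\<Psi> w s = Ecoins F (semi s (\<lambda>\<zeta>. flow (\<zeta> w)))" for w s
  have b: "bounded_below N (\<lambda>\<zeta>. flow (\<zeta> w))" for w by (rule contractive_bounded[OF contractive_flow])
  have bf: "bounded_below N f" unfolding f_def by (rule contractive_bounded[OF contractive_id])
  have dA: "(A has_real_derivative 1 / n * (\<Sum>w\<in>lattice_nbrs 0. \<Psi> w s - \<Psi> 0 s)) (at s)" for s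
  proof -
    have "Ecoins F (semi s (gen f)) =
        Ecoins F (\<lambda>\<sigma>. 1 / n * (\<Sum>w\<in>lattice_nbrs 0. semi s (\<lambda>\<zeta>. flow (\<zeta> w)) \<sigma> - semi s (\<lambda>\<zeta>. flow (\<zeta> 0)) \<sigma>))"
    proof (rule Ecoins_cong)
      fix \<sigma> assume "\<sigma> \<in> set_pmf (coins F)"
      hence C: "\<sigma> \<in> configs N" using coins_in_configs[OF F] by (simp add: N_def)
      have "semi s (gen f) \<sigma> = semi s (\<lambda>\<zeta>. 1 / n * (\<Sum>w\<in>lattice_nbrs 0. flow (\<zeta> w) - flow (\<zeta> 0))) \<sigma>"
        by (rule semi_local[OF _ C]) (simp add: f_def n_def gen_origin configs_def)
      also have "\<dots> = 1 / n * semi s (\<lambda>\<zeta>. \<Sum>w\<in>lattice_nbrs 0. flow (\<zeta> w) - flow (\<zeta> 0)) \<sigma>"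
        by (intro semi_cmult[OF _ C] bounded_below_sum bounded_below_diff b)
      also have "semi s (\<lambda>\<zeta>. \<Sum>w\<in>lattice_nbrs 0. flow (\<zeta> w) - flow (\<zeta> 0)) \<sigma> =
          (\<Sum>w\<in>lattice_nbrs 0. semi s (\<lambda>\<zeta>. flow (\<zeta> w) - flow (\<zeta> 0)) \<sigma>)"
        by (intro semi_sum[OF _ C] bounded_below_diff b)
      also have "\<dots> = (\<Sum>w\<in>lattice_nbrs 0. semi s (\<lambda>\<zeta>. flow (\<zeta> w)) \<sigma> - semi s (\<lambda>\<zeta>. flow (\<zeta> 0)) \<sigma>)"
        by (intro sum.cong refl semi_diff[OF b b C])
      finally show "semi s (gen f) \<sigma> =
          1 / n * (\<Sum>w\<in>lattice_nbrs 0. semi s (\<lambda>\<zeta>. flow (\<zeta> w)) \<sigma> - semi s (\<lambda>\<zeta>. flow (\<zeta> 0)) \<sigma>)" .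
    qed
    also have "\<dots> = 1 / n * (\<Sum>w\<in>lattice_nbrs 0. \<Psi> w s - \<Psi> 0 s)"
      by (simp only: integral_mult_right_zero Bochner_Integration.integral_sum[OF integrable_coins[OF F]]
        Bochner_Integration.integral_diff[OF integrable_coins[OF F] integrable_coins[OF F]] \<Psi>_def)
    finally show ?thesis
      using has_derivative_Ecoins_semi[OF F bf[unfolded N_def], of s] by (simp add: A_def[abs_def])
  qed
  \<comment> \<open>The mean value theorem stands in for integrating the derivative. As A 0 = 0, a
    bound on the Laplacian of the mean flow, uniform up to time t, is enough.\<close>
  have "\<exists>z>0. z < t \<and> A t - A 0 = (t - 0) * (1 / n * (\<Sum>w\<in>lattice_nbrs 0. \<Psi> w z - \<Psi> 0 z))"
    using False t by (intro MVT2 dA) simp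
  then obtain z where z: "0 < z" "z < t" "A t - A 0 = t * (1 / n * (\<Sum>w\<in>lattice_nbrs 0. \<Psi> w z - \<Psi> 0 z))"
    by auto
  have "\<bar>\<Psi> w z - \<Psi> 0 z\<bar> \<le> growth t * (2 * \<eta>)" if w: "w \<in> lattice_nbrs 0" for w
  proof -
    \<comment> \<open>After translating w to the origin, the two mean flows concern the same
      observable and differ only in their finite sets, both of which cover the vicinity of the
      origin.\<close>
    have "\<Psi> w z = Ecoins ((\<lambda>v. v - w) ` F) (semi z (\<lambda>\<zeta>. flow (\<zeta> 0)))"
      unfolding \<Psi>_def by (rule Ecoins_translate[OF F])
    hence "\<bar>\<Psi> w z - \<Psi> 0 z\<bar> \<le> growth z * (tail ((\<lambda>v. v - w) ` F) + tail F)"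
      unfolding \<Psi>_def using z F by (simp only:) (intro Ecoins_origin_diff contractive_flow; simp)
    also have "\<dots> \<le> growth t * (\<eta> + \<eta>)"
      using \<eta>(1) \<eta>(2)[OF w] z growth_mono[of z t] growth_pos[of t] tail_nonneg F
      by (intro mult_mono add_mono add_nonneg_nonneg) auto
    finally show ?thesis by simp
  qed
  hence "\<bar>\<Sum>w\<in>lattice_nbrs 0. \<Psi> w z - \<Psi> 0 z\<bar> \<le> (\<Sum>w\<in>lattice_nbrs (0 :: int ^ 'd). growth t * (2 * \<eta>))"
    by (intro order.trans[OF sum_abs] sum_mono)
  also have "\<dots> = n * (growth t * (2 * \<eta>))" by (simp add: card_lattice_nbrs n_def)
  finally have "1 / n * \<bar>\<Sum>w\<in>lattice_nbrs 0. \<Psi> w z - \<Psi> 0 z\<bar> \<le> growth t * (2 * \<eta>)"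
    using n by (simp add: divide_le_eq mult.commute)
  hence "t * (1 / n * \<bar>\<Sum>w\<in>lattice_nbrs 0. \<Psi> w z - \<Psi> 0 z\<bar>) \<le> t * (growth t * (2 * \<eta>))"
    using t by (rule mult_left_mono)
  moreover have "A 0 = 0" by (simp add: A_def semi_0 f_def Ecoins_coord[OF F])
  ultimately have "\<bar>A t\<bar> \<le> t * (growth t * (2 * \<eta>))"
    using z(3) n t by (simp add: abs_mult)
  thus ?thesis by (simp add: A_def f_def mult_ac)
qed

end

section \<open>The infinite system\<close>

text \<open>The witness g is a finite combination of indicators of cylinder events, so its integral
  is explicit. It agrees with the composition only almost surely, since it is the law that confines
  the initial values to 1 and -1; countability handles all sites at once.\<close>

lemma
  fixes nbrs :: "'v \<Rightarrow> 'v set"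
  assumes "DLAS M nbrs rA rB (1 / 2) \<zeta>" and cnt: "countable (UNIV :: 'v set)"
  shows DLAS_initial_unit: "AE \<omega> in M. unit_config (\<zeta> 0 \<omega>)"
    and DLAS_initial_coins: "finite F \<Longrightarrow> \<exists>g. integrable M g \<and>
      (AE \<omega> in M. g \<omega> = \<Phi> (restrict_config F (\<zeta> 0 \<omega>))) \<and> integral\<^sup>L M g = Ecoins F \<Phi>"
proof -
  interpret DLAS M nbrs rA rB "1 / 2" \<zeta> by fact
  define P where "P = PiM UNIV (\<lambda>_ :: 'v. measure_pmf coin)"
  interpret P: product_prob_space "\<lambda>_ :: 'v. measure_pmf coin" UNIV
    by unfold_locales
  have law: "distr M config_space (\<zeta> 0) = P"
    unfolding P_def coin_def by (rule initial_law)
  have m0: "\<zeta> 0 \<in> measurable M config_space" by (rule measurable) simp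
  have spP: "space P = UNIV" by (simp add: P_def space_PiM PiE_def)
  have sP: "sets P = sets config_space"
    unfolding P_def config_space_def by (intro sets_PiM_cong) simp_all
  have "AE x in P. \<forall>v\<in>UNIV. x v \<in> {1, -1}"
  proof (rule AE_ball_countable'[OF _ cnt])
    fix v :: 'v
    show "AE x in P. x v \<in> {1, -1}"
      unfolding P_def using P.AE_component[of v "\<lambda>y. y \<in> {1, -1}"] set_coin
      by (simp add: AE_measure_pmf_iff)
  qed
  hence "AE \<omega> in M. \<forall>v\<in>UNIV. \<zeta> 0 \<omega> v \<in> {1, -1}"
    unfolding law[symmetric] by (rule AE_distrD[OF m0])
  hence AE: "AE \<omega> in M. \<forall>v. \<zeta> 0 \<omega> v = 1 \<or> \<zeta> 0 \<omega> v = -1" by simp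
  show "AE \<omega> in M. unit_config (\<zeta> 0 \<omega>)"
    using AE
  proof eventually_elim
    case (elim \<omega>)
    show ?case unfolding unit_config_def
    proof
      fix v show "\<bar>\<zeta> 0 \<omega> v\<bar> \<le> 1" using elim[rule_format, of v] by auto
    qed
  qed
  assume F: "finite F"
  define S where "S \<sigma> = {x \<in> space P. \<forall>v\<in>F. x v \<in> {\<sigma> v}}" for \<sigma> :: "'v config"
  have mS: "S \<sigma> \<in> sets config_space" for \<sigma>
    unfolding sP[symmetric] S_def P_def
    by (intro sets.sets_Collect_finite_All sets_Collect_single' F) auto
  define T where "T \<sigma> = \<zeta> 0 -` S \<sigma> \<inter> space M" for \<sigma>
  have mT: "T \<sigma> \<in> sets M" for \<sigma>
    unfolding T_def by (rule measurable_sets[OF m0 mS])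
  have PT: "prob (T \<sigma>) = pmf (coins F) \<sigma>" if "\<sigma> \<in> set_pmf (coins F)" for \<sigma>
  proof -
    have "emeasure M (T \<sigma>) = emeasure P (S \<sigma>)"
      unfolding law[symmetric] T_def by (rule emeasure_distr[OF m0 mS, symmetric])
    also have "\<dots> = (\<Prod>v\<in>F. emeasure (measure_pmf coin) {\<sigma> v})"
      unfolding S_def P_def using F by (intro P.emeasure_PiM_Collect) auto
    also have "\<dots> = ennreal (\<Prod>v\<in>F. pmf coin (\<sigma> v))"
      by (simp add: emeasure_pmf_single prod_ennreal)
    also have "(\<Prod>v\<in>F. pmf coin (\<sigma> v)) = pmf (coins F) \<sigma>"
      unfolding coins_def by (rule pmf_Pi'[symmetric, OF F]) (rule coins_apply(2)[OF F that])
    finally show ?thesis by (simp add: emeasure_eq_measure)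
  qed
  define g where "g \<omega> = (\<Sum>\<sigma>\<in>set_pmf (coins F). \<Phi> \<sigma> * indicator (T \<sigma>) \<omega>)" for \<omega>
  have int: "integrable M (\<lambda>\<omega>. \<Phi> \<sigma> * indicator (T \<sigma>) \<omega>)" for \<sigma>
    using mT by (intro integrable_mult_right integrable_real_indicator) (auto simp: emeasure_eq_measure)
  have "integrable M g" unfolding g_def by (intro Bochner_Integration.integrable_sum int)
  moreover have "integral\<^sup>L M g = Ecoins F \<Phi>"
  proof -
    have "integral\<^sup>L M g = (\<Sum>\<sigma>\<in>set_pmf (coins F). \<integral>\<omega>. \<Phi> \<sigma> * indicator (T \<sigma>) \<omega> \<partial>M)"
      unfolding g_def by (rule Bochner_Integration.integral_sum) (rule int)
    also have "\<dots> = (\<Sum>\<sigma>\<in>set_pmf (coins F). pmf (coins F) \<sigma> * \<Phi> \<sigma>)"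
      using mT PT by (intro sum.cong) (auto simp: mult.commute Int_absorb2 sets.sets_into_space)
    also have "\<dots> = Ecoins F \<Phi>"
      using F by (subst integral_measure_pmf[of "set_pmf (coins F)"]) (auto simp: finite_set_coins)
    finally show ?thesis .
  qed
  moreover have "AE \<omega> in M. g \<omega> = \<Phi> (restrict_config F (\<zeta> 0 \<omega>))"
    using AE AE_space
  proof eventually_elim
    case (elim \<omega>)
    define \<sigma>0 where "\<sigma>0 = restrict_config F (\<zeta> 0 \<omega>)"
    have mem: "\<sigma>0 \<in> set_pmf (coins F)"
      using elim F by (auto simp: set_coins PiE_dflt_def \<sigma>0_def restrict_config_def)
    have "indicator (T \<sigma>) \<omega> = (if \<sigma> = \<sigma>0 then 1 else 0 :: real)" if "\<sigma> \<in> set_pmf (coins F)" for \<sigma>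
    proof -
      have "\<omega> \<in> T \<sigma> \<longleftrightarrow> (\<forall>v\<in>F. \<zeta> 0 \<omega> v = \<sigma> v)" using elim by (auto simp: T_def S_def spP)
      also have "\<dots> \<longleftrightarrow> \<sigma> = \<sigma>0"
        using coins_apply(2)[OF F that] by (auto simp: \<sigma>0_def restrict_config_def fun_eq_iff)
      finally show ?thesis by (simp add: indicator_def)
    qed
    hence "g \<omega> = (\<Sum>\<sigma>\<in>set_pmf (coins F). if \<sigma> = \<sigma>0 then \<Phi> \<sigma> else 0)"
      unfolding g_def by (intro sum.cong) auto
    also have "\<dots> = \<Phi> \<sigma>0" using mem finite_set_coins[OF F] by simp
    finally show ?case by (simp add: \<sigma>0_def)
  qed
  ultimately show "\<exists>g. integrable M g \<and>
      (AE \<omega> in M. g \<omega> = \<Phi> (restrict_config F (\<zeta> 0 \<omega>))) \<and> integral\<^sup>L M g = Ecoins F \<Phi>"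
    by blast
qed

lemma (in DLAS) subalgebra_history:
  assumes "0 \<le> s"
  shows "subalgebra M (history M \<zeta> s)"
proof -
  have "{\<zeta> u -` E \<inter> space M | u E. 0 \<le> u \<and> u \<le> s \<and> E \<in> sets config_space} \<subseteq> sets M"
    using measurable by (auto intro: measurable_sets)
  thus ?thesis
    unfolding subalgebra_def history_def
    by (simp add: sets.sigma_sets_subset space_measure_of_conv sets_measure_of_conv)
qed

context lattice_graph
begin

text \<open>Enlarging F changes the finite system by at most \<open>growth t * tail F\<close>. So
  the limit along finite sets exists, and the \<open>Lim\<close> in the definition is a genuine
  value.\<close>

lemma semigroup_DLAS_approx:
  assumes u: "contractive u" and t: "0 \<le> t" and \<zeta>: "unit_config \<zeta>" and F: "finite F"
  shows "\<bar>semigroup_DLAS lattice_nbrs 1 rB t (\<lambda>\<zeta>. u (\<zeta> 0)) \<zeta> -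
      semi t (\<lambda>\<zeta>. u (\<zeta> 0)) (restrict_config F \<zeta>)\<bar> \<le> growth t * tail F"
proof -
  define a where "a F = semi t (\<lambda>\<zeta>. u (\<zeta> 0)) (restrict_config F \<zeta>)" for F
  have step: "\<bar>a F' - a F\<bar> \<le> growth t * tail F" if "finite F'" "F \<subseteq> F'" for F F'
  proof -
    have F: "finite F" using that finite_subset by blast
    have "\<bar>a (F \<union> (F' - F)) - a F\<bar> \<le> (\<Sum>y\<in>F' - F. growth t * decay y)"
      unfolding a_def
      by (rule lip_restrict[OF _ F _ \<zeta> order.refl lip_semi_origin[OF u _ t]])
        (use that growth_pos[of t] in \<open>auto simp: less_imp_le\<close>)
    also have "\<dots> \<le> growth t * tail F"
      unfolding sum_distrib_left[symmetric]
      using that F growth_pos[of t] by (intro mult_left_mono sum_decay_le_tail) auto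
    also have "F \<union> (F' - F) = F'" using that by auto
    finally show ?thesis .
  qed
  \<comment> \<open>The limit is first taken along cubes, where completeness for sequences applies;
    \<open>close\<close> then extends it to all finite sets.\<close>
  have "Cauchy (\<lambda>n. a (cube n))"
  proof (rule metric_CauchyI)
    fix e :: real assume "0 < e"
    hence "0 < e / 2 / growth t" using growth_pos[of t] by simp
    then obtain n where "tail (cube n :: (int ^ 'd) set) < e / 2 / growth t" by (rule tail_cube_small)
    hence n: "growth t * tail (cube n :: (int ^ 'd) set) < e / 2"
      using growth_pos[of t] by (simp add: field_simps)
    have "dist (a (cube m)) (a (cube m')) < e" if "n \<le> m" "n \<le> m'" for m m'
      using step[OF finite_cube cube_mono[OF that(1)]] step[OF finite_cube cube_mono[OF that(2)]] n
      unfolding dist_real_def by linarith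
    thus "\<exists>n. \<forall>m\<ge>n. \<forall>m'\<ge>n. dist (a (cube m)) (a (cube m')) < e" by blast
  qed
  then obtain l where l: "(\<lambda>n. a (cube n)) \<longlonglongrightarrow> l"
    using Cauchy_convergent_iff convergent_def by blast
  have close: "\<bar>l - a F\<bar> \<le> growth t * tail F" if F: "finite F" for F
  proof -
    obtain m where m: "F \<subseteq> cube m" using F by (rule finite_subset_cube)
    have "(\<lambda>n. \<bar>a (cube n) - a F\<bar>) \<longlonglongrightarrow> \<bar>l - a F\<bar>" by (intro tendsto_intros l)
    moreover have "\<forall>n\<ge>m. \<bar>a (cube n) - a F\<bar> \<le> growth t * tail F"
      using m cube_mono by (intro allI impI step finite_cube) blast
    ultimately show ?thesis by (rule Lim_bounded)
  qed
  have "(a \<longlongrightarrow> l) (finite_subsets_at_top UNIV)"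
  proof (rule LIM_zero_cancel, rule Lim_null_comparison)
    show "\<forall>\<^sub>F F in finite_subsets_at_top UNIV. norm (a F - l) \<le> growth t * tail F"
      by (rule eventually_finite_subsets_at_top_weakI) (use close in \<open>simp add: abs_minus_commute\<close>)
    show "((\<lambda>F. growth t * tail F) \<longlongrightarrow> 0) (finite_subsets_at_top (UNIV :: (int ^ 'd) set))"
      using tendsto_mult_left[OF tail_tendsto, of "growth t"] by simp
  qed
  hence "semigroup_DLAS lattice_nbrs 1 rB t (\<lambda>\<zeta>. u (\<zeta> 0)) \<zeta> = l"
    unfolding semigroup_DLAS_def a_def by (intro tendsto_Lim finite_subsets_at_top_neq_bot)
  with close[OF F] show ?thesis by (simp add: a_def)
qed

text \<open>The Markov property at time 0 expresses the conditional expectation by the limit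
  semigroup at the initial state. There the finite system on F approximates it, and the initial law
  turns this into coins.\<close>

lemma DLAS_expectation_approx:
  fixes M :: "'a measure" and \<zeta> :: "real \<Rightarrow> 'a \<Rightarrow> (int ^ 'd) config"
  assumes D: "DLAS M lattice_nbrs 1 rB (1 / 2) \<zeta>"
    and u: "contractive u" and b: "\<And>z. \<bar>u z\<bar> \<le> b" and t: "0 \<le> t" and F: "finite F"
  shows "integrable M (\<lambda>\<omega>. u (\<zeta> t \<omega> 0))"
    and "\<bar>(\<integral>\<omega>. u (\<zeta> t \<omega> 0) \<partial>M) - Ecoins F (semi t (\<lambda>\<zeta>. u (\<zeta> 0)))\<bar> \<le> growth t * tail F"
proof -
  interpret DLAS M lattice_nbrs 1 rB "1 / 2" \<zeta> by fact
  let ?f = "\<lambda>\<zeta> :: (int ^ 'd) config. u (\<zeta> 0)"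
  let ?H = "history M \<zeta> 0"
  interpret H: finite_measure_subalgebra M ?H
    by unfold_locales (rule subalgebra_history, simp)
  have "(\<lambda>\<omega>. \<zeta> t \<omega> 0) \<in> measurable M (count_space UNIV)"
    using measurable_compose[OF measurable[OF t, unfolded config_space_def]
        measurable_component_singleton[of 0 UNIV "\<lambda>_. count_space UNIV"]] by simp
  hence "(\<lambda>\<omega>. u (\<zeta> t \<omega> 0)) \<in> borel_measurable M"
    by (rule measurable_compose) simp
  thus int: "integrable M (\<lambda>\<omega>. u (\<zeta> t \<omega> 0))"
    by (rule integrable_const_bound[of _ b, rotated]) (simp add: b)
  have cyl: "bounded_cylinder ?f"
    unfolding bounded_cylinder_def using b by (intro conjI exI[of _ "{0}"] exI[of _ b]) auto
  define c where "c = real_cond_exp M ?H (\<lambda>\<omega>. ?f (\<zeta> t \<omega>))"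
  have c: "integrable M c" "integral\<^sup>L M c = (\<integral>\<omega>. u (\<zeta> t \<omega> 0) \<partial>M)"
    unfolding c_def using H.real_cond_exp_int[OF int] by simp_all
  obtain g where g: "integrable M g" "integral\<^sup>L M g = Ecoins F (semi t ?f)"
    "AE \<omega> in M. g \<omega> = semi t ?f (restrict_config F (\<zeta> 0 \<omega>))"
    using DLAS_initial_coins[OF D countable_lattice F, of "semi t ?f"] by blast
  have "AE \<omega> in M. c \<omega> = semigroup_DLAS lattice_nbrs 1 rB t ?f (\<zeta> 0 \<omega>)"
    using markov[OF order.refl t cyl] by (simp add: c_def)
  hence AE: "AE \<omega> in M. \<bar>c \<omega> - g \<omega>\<bar> \<le> growth t * tail F"
    using g(3) DLAS_initial_unit[OF D countable_lattice]
    by eventually_elim (simp add: semigroup_DLAS_approx[OF u t _ F])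
  have "\<bar>\<integral>\<omega>. c \<omega> - g \<omega> \<partial>M\<bar> \<le> (\<integral>\<omega>. \<bar>c \<omega> - g \<omega>\<bar> \<partial>M)"
    by (rule integral_abs_bound)
  also have "\<dots> \<le> (\<integral>\<omega>. growth t * tail F \<partial>M)"
    using AE c g by (intro integral_mono_AE) auto
  finally show "\<bar>(\<integral>\<omega>. u (\<zeta> t \<omega> 0) \<partial>M) - Ecoins F (semi t ?f)\<bar> \<le> growth t * tail F"
    using c g by (simp add: prob_space)
qed

lemma contractive_truncated: "contractive (\<lambda>z. min (pos z) (real K))"
  by (auto simp: contractive_def pos_def)

text \<open>The Markov property is available for bounded observables only, so the number of
  A-particles is truncated at K and monotonicity in K does the rest.\<close>

lemma density_A_lower:
  fixes M :: "'a measure" and \<zeta> :: "real \<Rightarrow> 'a \<Rightarrow> (int ^ 'd) config"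
  assumes D: "DLAS M lattice_nbrs 1 rB (1 / 2) \<zeta>" and t: "0 \<le> t" and F: "finite F"
  shows "Ecoins F (semi t (\<lambda>\<zeta>. pos (\<zeta> 0))) \<le> density_A M \<zeta> 0 t + growth t * tail F"
proof -
  interpret DLAS M lattice_nbrs 1 rB "1 / 2" \<zeta> by fact
  define u where "u K z = min (pos z) (real K)" for K z
  have u: "contractive (u K)" for K
    using contractive_truncated[of K] by (simp add: u_def[abs_def])
  have ub: "\<bar>u K z\<bar> \<le> real K" for K z by (simp add: u_def)
  note approx = DLAS_expectation_approx[OF D u ub t]
  define N where "N = (\<lambda>\<omega>. real (num_A \<zeta> 0 t \<omega>))"
  have N: "N \<omega> = pos (\<zeta> t \<omega> 0)" for \<omega> by (simp add: N_def num_A_def pos_def)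
  have lim: "(\<lambda>K. u K z) \<longlonglongrightarrow> pos z" for z
  proof (rule tendsto_eventually)
    obtain k :: nat where "pos z \<le> real k" using real_arch_simple by blast
    hence "u K z = pos z" if "k \<le> K" for K using that by (simp add: u_def)
    thus "\<forall>\<^sub>F K in sequentially. u K z = pos z" by (auto simp: eventually_sequentially)
  qed
  \<comment> \<open>A Bochner integral is 0 when the function is not integrable, so comparing the
    truncations with \<open>density_A\<close> requires integrability. It comes from monotone
    convergence.\<close>
  have "integrable M N"
  proof -
    define I where "I K = (\<integral>\<omega>. u K (\<zeta> t \<omega> 0) \<partial>M)" for K
    have "incseq I"
      unfolding incseq_def I_def using approx(1)
      by (intro allI impI integral_mono) (auto simp: u_def)
    \<comment> \<open>Comparison with the empty system, whose expectation is 0, gives a bound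
      independent of K.\<close>
    moreover have "I K \<le> growth t * tail ({} :: (int ^ 'd) set)" for K
    proof -
      have "semi t (\<lambda>\<zeta>. u K (\<zeta> 0)) (\<lambda>_. 0) = semi t (\<lambda>_. 0) (\<lambda>_. 0)"
      proof (rule semi_local[of 0])
        fix \<sigma> :: "(int ^ 'd) config" assume "\<sigma> \<in> configs 0"
        hence "\<bar>real_of_int (\<sigma> 0)\<bar> \<le> 0"
          using abs_coord_le_mass[of \<sigma> 0] unfolding configs_def by (auto intro: order.trans)
        thus "u K (\<sigma> 0) = 0" by (simp add: u_def pos_def)
      qed (simp add: configs_def supp_def mass_def)
      hence "Ecoins {} (semi t (\<lambda>\<zeta>. u K (\<zeta> 0))) = 0"
        by (simp add: coins_def semi_zero)
      thus ?thesis using approx(2)[of "{}" K] by (simp add: I_def abs_le_iff)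
    qed
    ultimately obtain L where "I \<longlonglongrightarrow> L" by (meson incseq_convergent)
    thus ?thesis
      unfolding I_def
    proof (rule integral_monotone_convergence_nonneg(1)[rotated 4])
      show "\<And>K. integrable M (\<lambda>\<omega>. u K (\<zeta> t \<omega> 0))" by (rule approx(1)[OF finite.emptyI])
      show "AE \<omega> in M. (\<lambda>K. u K (\<zeta> t \<omega> 0)) \<longlonglongrightarrow> N \<omega>" using lim by (simp add: N)
      show "N \<in> borel_measurable M"
      proof (rule borel_measurable_LIMSEQ_real)
        show "(\<lambda>K. u K (\<zeta> t \<omega> 0)) \<longlonglongrightarrow> N \<omega>" for \<omega> using lim by (simp add: N)
        show "(\<lambda>\<omega>. u K (\<zeta> t \<omega> 0)) \<in> borel_measurable M" for K
          using approx(1)[of "{}" K] by (intro borel_measurable_integrable) simp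
      qed
    qed (auto simp: u_def mono_def)
  qed
  \<comment> \<open>A system started with at most card F particles never has more of them at a site,
    so truncation at this K does not affect it.\<close>
  define K where "K = card F"
  have "Ecoins F (semi t (\<lambda>\<zeta>. pos (\<zeta> 0))) = Ecoins F (semi t (\<lambda>\<zeta>. u K (\<zeta> 0)))"
  proof (intro Ecoins_cong semi_local[of "real K"])
    fix \<sigma> :: "(int ^ 'd) config" assume "\<sigma> \<in> configs (real K)"
    hence "\<bar>real_of_int (\<sigma> 0)\<bar> \<le> real K"
      using abs_coord_le_mass[of \<sigma> 0] by (simp add: configs_def)
    thus "pos (\<sigma> 0) = u K (\<sigma> 0)" by (auto simp: u_def pos_def)
  qed (use coins_in_configs[OF F] in \<open>simp add: K_def\<close>)
  also have "\<dots> \<le> (\<integral>\<omega>. u K (\<zeta> t \<omega> 0) \<partial>M) + growth t * tail F"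
    using approx(2)[OF F, of K] by linarith
  also have "(\<integral>\<omega>. u K (\<zeta> t \<omega> 0) \<partial>M) \<le> integral\<^sup>L M N"
    using approx(1)[OF F, of K] \<open>integrable M N\<close> by (intro integral_mono) (auto simp: N u_def)
  finally show ?thesis by (simp add: density_A_def N_def)
qed

section \<open>From the charge of cubes to the density at the origin\<close>

lemma cube_translate:
  fixes x :: "int ^ 'd"
  assumes "x \<in> cube m"
  shows "cube n \<subseteq> (\<lambda>v. v - x) ` cube (n + m)"
proof
  fix y :: "int ^ 'd" assume y: "y \<in> cube n"
  have "y + x \<in> cube (n + m)"
    unfolding cube_def
  proof (intro CollectI allI)
    fix i
    have "\<bar>y $ i\<bar> \<le> int n" "\<bar>x $ i\<bar> \<le> int m" using y assms by (auto simp: cube_def)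
    thus "\<bar>(y + x) $ i\<bar> \<le> int (n + m)" by simp
  qed
  thus "y \<in> (\<lambda>v. v - x) ` cube (n + m)" by (rule rev_image_eqI) simp
qed

lemma lattice_nbrs_0_cube: "w \<in> lattice_nbrs 0 \<Longrightarrow> w \<in> cube 1"
  by (auto simp: lattice_nbrs_eq cube_def axis_def)

text \<open>At fixed t and R the finite system G is made so large that all errors of
  \<open>decay\<close> type sum to at most an arbitrary e. Only the escape error of the barrier
  remains.\<close>

lemma density_A_bound:
  fixes M :: "'a measure" and \<zeta> :: "real \<Rightarrow> 'a \<Rightarrow> (int ^ 'd) config" and R :: nat
  assumes D: "DLAS M lattice_nbrs 1 rB (1 / 2) \<zeta>" and t: "0 \<le> t" and \<theta>: "0 \<le> \<theta>" "\<theta> \<le> 1"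
  defines "b \<equiv> (2 * real R + 1) ^ CARD('d)"
  shows "sqrt b / 16 - 4 * real CARD('d) * b * exp (\<theta>\<^sup>2 * t - \<theta> * real R)
    \<le> (4 * real R + 1) ^ CARD('d) * density_A M \<zeta> 0 t"
proof (rule field_le_epsilon)
  fix e :: real assume e: "0 < e"
  define \<rho> where "\<rho> = density_A M \<zeta> 0 t"
  define B where "B = (cube R :: (int ^ 'd) set)"
  define Q where "Q = (cube (2 * R) :: (int ^ 'd) set)"
  \<comment> \<open>The total coefficient of \<eta>: every site of Q costs one error for its mean
    charge and one for replacing its mean number of A-particles by the density.\<close>
  define C where "C = real (card Q) * (2 * growth t * t + growth t)"
  have finQ: "finite Q" by (simp add: Q_def finite_cube)
  have cardQ: "real (card Q) = (4 * real R + 1) ^ CARD('d)" by (simp add: Q_def card_cube add.commute)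
  have cardB: "real (card B) = b" by (simp add: B_def b_def card_cube add.commute)
  have C: "0 < C"
    unfolding C_def using growth_pos[of t] t by (intro mult_pos_pos add_nonneg_pos) (auto simp: cardQ)
  define \<eta> where "\<eta> = e / C"
  have "0 < \<eta>" using e C by (simp add: \<eta>_def)
  then obtain n where n: "tail (cube n :: (int ^ 'd) set) < \<eta>" by (rule tail_cube_small)
  \<comment> \<open>The margin 2 R allows recentring at any site of Q, and the margin 1 a further
    shift by a neighbour of the origin; the result still contains \<open>cube n\<close>.\<close>
  define G where "G = (cube (n + 1 + 2 * R) :: (int ^ 'd) set)"
  have G: "finite G" "B \<subseteq> G" by (simp_all add: G_def B_def finite_cube cube_mono)
  define T where "T x = (\<lambda>v. v - x) ` G" for x
  have T: "cube (n + 1) \<subseteq> T x" "finite (T x)" if "x \<in> Q" for x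
    using that G cube_translate[of x "2 * R" "n + 1"] by (auto simp: T_def G_def Q_def)
  have tail_T: "tail F \<le> \<eta>" if "cube n \<subseteq> F" "finite F" for F :: "(int ^ 'd) set"
    using tail_antimono[OF that(2,1)] n by linarith
  have TQ: "tail (T x) \<le> \<eta>" if x: "x \<in> Q" for x
    using T[OF x] cube_mono[of n "n + 1"] by (intro tail_T) auto
  have upper: "Ecoins G (semi t (\<lambda>\<zeta>. pos (\<zeta> x))) \<le> \<rho> + growth t * \<eta>" if x: "x \<in> Q" for x
  proof -
    have "Ecoins G (semi t (\<lambda>\<zeta>. pos (\<zeta> x))) = Ecoins (T x) (semi t (\<lambda>\<zeta>. pos (\<zeta> 0)))"
      unfolding T_def by (rule Ecoins_translate[OF G(1)])
    also have "\<dots> \<le> \<rho> + growth t * tail (T x)"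
      unfolding \<rho>_def by (rule density_A_lower[OF D t T(2)[OF x]])
    also have "\<dots> \<le> \<rho> + growth t * \<eta>"
      using TQ[OF x] growth_pos[of t] by simp
    finally show ?thesis .
  qed
  have mean: "\<bar>Ecoins G (semi t (\<lambda>\<zeta>. real_of_int (\<zeta> x)))\<bar> \<le> 2 * \<eta> * growth t * t" if x: "x \<in> Q" for x
  proof -
    have "tail ((\<lambda>v. v - w) ` T x) \<le> \<eta>" if "w \<in> lattice_nbrs 0" for w
    proof (rule tail_T)
      have "cube n \<subseteq> (\<lambda>v. v - w) ` cube (n + 1)"
        by (rule cube_translate[OF lattice_nbrs_0_cube[OF that]])
      also have "\<dots> \<subseteq> (\<lambda>v. v - w) ` T x" using T(1)[OF x] by (rule image_mono)
      finally show "cube n \<subseteq> (\<lambda>v. v - w) ` T x" .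
    qed (use T[OF x] in simp)
    thus ?thesis
      using Ecoins_origin_small[OF T(2)[OF x] t TQ[OF x]]
      unfolding Ecoins_translate[OF G(1)] T_def by simp
  qed
  \<comment> \<open>The barrier stands at radius 2 R and B has radius R, so a discrepancy from B has
    to cover the distance R.\<close>
  have "(\<Sum>y\<in>B. exp (\<theta>\<^sup>2 * t) * barrier \<theta> (2 * R) y) \<le>
      (\<Sum>y\<in>B. exp (\<theta>\<^sup>2 * t) * (2 * CARD('d) * exp (\<theta> * (real R - real (2 * R)))))"
    using \<theta> by (intro sum_mono mult_left_mono barrier_inside) (auto simp: B_def)
  also have "\<dots> = 2 * real CARD('d) * b * exp (\<theta>\<^sup>2 * t - \<theta> * real R)"
    by (simp add: cardB exp_diff exp_minus field_simps)
  finally have \<epsilon>: "(\<Sum>y\<in>B. exp (\<theta>\<^sup>2 * t) * barrier \<theta> (2 * R) y) \<le>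
      2 * real CARD('d) * b * exp (\<theta>\<^sup>2 * t - \<theta> * real R)" .
  have "sqrt b / 16 \<le> Ecoins B (\<lambda>\<sigma>. max 0 (\<Sum>v\<in>B. real_of_int (\<sigma> v)))"
    using coin_sum_pos_part[of B] by (simp add: cardB[symmetric] B_def finite_cube)
  also have "\<dots> \<le> (\<Sum>x\<in>Q. Ecoins G (semi t (\<lambda>\<zeta>. pos (\<zeta> x))))
      + \<bar>\<Sum>x\<in>Q. Ecoins G (semi t (\<lambda>\<zeta>. real_of_int (\<zeta> x)))\<bar>
      + 2 * (\<Sum>y\<in>B. exp (\<theta>\<^sup>2 * t) * barrier \<theta> (2 * R) y)"
  proof -
    have "1 \<le> barrier \<theta> (2 * R) y" if "y \<notin> Q" for y
      using that \<theta> unfolding Q_def by (intro barrier_outside)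
    from charge_fluctuation_bound[OF finQ G superharmonic_barrier[OF \<theta>] zero_le_power2 this t]
    show ?thesis by linarith
  qed
  also have "(\<Sum>x\<in>Q. Ecoins G (semi t (\<lambda>\<zeta>. pos (\<zeta> x)))) \<le> (\<Sum>x\<in>Q. \<rho> + growth t * \<eta>)"
    by (intro sum_mono upper)
  also have "\<bar>\<Sum>x\<in>Q. Ecoins G (semi t (\<lambda>\<zeta>. real_of_int (\<zeta> x)))\<bar> \<le> (\<Sum>x\<in>Q. 2 * \<eta> * growth t * t)"
    by (intro order.trans[OF sum_abs] sum_mono mean)
  also note \<epsilon>
  finally have "sqrt b / 16 \<le> real (card Q) * \<rho> + C * \<eta> + 2 * (2 * real CARD('d) * b * exp (\<theta>\<^sup>2 * t - \<theta> * real R))"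
    by (simp add: C_def algebra_simps)
  moreover have "C * \<eta> = e" using C by (simp add: \<eta>_def)
  ultimately show "sqrt b / 16 - 4 * real CARD('d) * b * exp (\<theta>\<^sup>2 * t - \<theta> * real R)
    \<le> (4 * real R + 1) ^ CARD('d) * density_A M \<zeta> 0 t + e"
    by (simp add: cardQ \<rho>_def)
qed

end

text \<open>Optimises \<open>density_A_bound\<close> in \<theta> and R up to constants. Fluctuations
  of order sqrt b are spread over a volume of order b, so the density is at least of order 1 / sqrt
  b.\<close>

lemma density_A_lower_bound:
  fixes M :: "'a measure" and \<zeta> :: "real \<Rightarrow> 'a \<Rightarrow> (int ^ 'd) config"
  assumes d: "CARD('d) \<le> 3" and rB: "0 \<le> rB" "rB \<le> 1"
    and D: "DLAS M lattice_nbrs 1 rB (1 / 2) \<zeta>" and t: "1000 \<le> t"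
  shows "1 / (32 * 2 ^ CARD('d) * 11 powr (real CARD('d) / 2)) * (t * ln t) powr (- (real CARD('d) / 4))
    \<le> density_A M \<zeta> 0 t"
proof -
  interpret lattice_graph rB "TYPE('d)" by unfold_locales (use rB in auto)
  let ?d = "CARD('d)"
  define s where "s = sqrt (t * ln t)"
  \<comment> \<open>Then \<theta>^2 t and \<theta> s both equal log t, and R \<ge> 4 s makes the
    exponent at most log t - 4 log t = - 3 log t.\<close>
  define \<theta> where "\<theta> = sqrt (ln t / t)"
  define R where "R = nat \<lceil>4 * s\<rceil>"
  define b where "b = (2 * real R + 1) ^ ?d"
  define \<rho> where "\<rho> = density_A M \<zeta> 0 t"
  have "exp 1 \<le> t" using exp_le t by linarith
  hence ln1: "1 \<le> ln t" using t by (simp add: ln_ge_iff)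
  have lnt: "ln t \<le> t" using ln_le_minus_one[of t] t by linarith
  have s2: "s\<^sup>2 = t * ln t" using ln1 t by (simp add: s_def)
  have s1: "1 \<le> s" unfolding s_def using mult_mono[of 1 t 1 "ln t"] ln1 t by simp
  have "s\<^sup>2 \<le> t\<^sup>2" unfolding s2 power2_eq_square[of t] using lnt t by (intro mult_left_mono) auto
  hence st: "s \<le> t" by (rule power2_le_imp_le) (use t in simp)
  have \<theta>: "0 \<le> \<theta>" "\<theta> \<le> 1" using ln1 lnt t by (auto simp: \<theta>_def)
  have \<theta>t: "\<theta>\<^sup>2 * t = ln t" using ln1 t by (simp add: \<theta>_def)
  have "\<theta> * s = sqrt (ln t / t * (t * ln t))" by (simp only: \<theta>_def s_def real_sqrt_mult)
  also have "\<dots> = sqrt ((ln t)\<^sup>2)" using t by (simp add: power2_eq_square)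
  finally have \<theta>s: "\<theta> * s = ln t" using ln1 by simp
  have R: "4 * s \<le> real R" "real R \<le> 4 * s + 1"
    unfolding R_def using s1 by linarith+
  have "\<theta> * (4 * s) \<le> \<theta> * real R" using R(1) \<theta>(1) by (rule mult_left_mono)
  hence "exp (\<theta>\<^sup>2 * t - \<theta> * real R) \<le> exp (- (3 * ln t))" using \<theta>t \<theta>s by simp
  also have "\<dots> = 1 / t ^ 3"
    using t exp_of_nat_mult[of 3 "ln t"] by (simp add: exp_minus divide_inverse)
  finally have ex: "exp (\<theta>\<^sup>2 * t - \<theta> * real R) \<le> 1 / t ^ 3" .
  have b1: "1 \<le> b" unfolding b_def by (rule one_le_power) simp
  \<comment> \<open>2 R + 1 \<le> 8 s + 3 \<le> 11 s, since s \<ge> 1.\<close>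
  have b_le: "b \<le> (11 * s) ^ ?d" unfolding b_def using R s1 by (intro power_mono) auto
  \<comment> \<open>The dimension bound gives b = O(t^3). Then sqrt b is small against t^3, so the
    error of order b / t^3 is small against sqrt b.\<close>
  also have "\<dots> \<le> (11 * s) ^ 3" using s1 d by (intro power_increasing) auto
  also have "\<dots> \<le> (11 * t) ^ 3" using st s1 by (intro power_mono) auto
  finally have bt: "b \<le> 1331 * t ^ 3" by (simp add: power_mult_distrib)
  have err: "4 * real ?d * b * (1 / t ^ 3) \<le> sqrt b / 32"
  proof -
    have t3: "0 < t ^ 3" using t by simp
    have "1000 ^ 3 \<le> t ^ 3" using t by (intro power_mono) auto
    hence K: "1000000000 * t ^ 3 \<le> t ^ 3 * t ^ 3" using t3 by (intro mult_right_mono) auto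
    \<comment> \<open>384 = 4 * 3 * 32: the prefactor 4 d with d \<le> 3 times the target fraction
      32. Since 147456 * 1331 is below 10^9, the threshold t \<ge> 1000 suffices.\<close>
    have "(384 * sqrt b)\<^sup>2 = 147456 * b" using b1 by (simp add: power_mult_distrib)
    also have "\<dots> \<le> t ^ 3 * t ^ 3" using bt t3 K by linarith
    also have "\<dots> = (t ^ 3)\<^sup>2" by (rule power2_eq_square[symmetric])
    finally have "384 * sqrt b \<le> t ^ 3" by (rule power2_le_imp_le) (use t3 in linarith)
    hence "384 * sqrt b * sqrt b \<le> t ^ 3 * sqrt b" by (intro mult_right_mono) (use b1 in auto)
    moreover have "384 * sqrt b * sqrt b = 384 * b"
      unfolding mult.assoc using b1 by simp
    ultimately have "384 * b \<le> t ^ 3 * sqrt b" by simp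
    moreover have "real ?d * b \<le> 3 * b" using d b1 by (intro mult_right_mono) auto
    ultimately have "128 * (real ?d * b) \<le> t ^ 3 * sqrt b" by linarith
    hence "4 * real ?d * b \<le> sqrt b / 32 * t ^ 3" by (simp add: mult_ac)
    hence "4 * real ?d * b / t ^ 3 \<le> sqrt b / 32" unfolding pos_divide_le_eq[OF t3] .
    thus ?thesis by simp
  qed
  have "sqrt b / 16 - 4 * real ?d * b * exp (\<theta>\<^sup>2 * t - \<theta> * real R) \<le> (4 * real R + 1) ^ ?d * \<rho>"
    unfolding b_def \<rho>_def by (rule density_A_bound[OF D _ \<theta>]) (use t in simp)
  moreover have "4 * real ?d * b * exp (\<theta>\<^sup>2 * t - \<theta> * real R) \<le> 4 * real ?d * b * (1 / t ^ 3)"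
    using ex b1 by (intro mult_left_mono) auto
  ultimately have "sqrt b / 32 \<le> (4 * real R + 1) ^ ?d * \<rho>" using err by linarith
  \<comment> \<open>4 R + 1 \<le> 2 (2 R + 1): doubling the radius costs at most 2^d in
    volume.\<close>
  also have "\<dots> \<le> (2 ^ ?d * b) * \<rho>"
  proof (rule mult_right_mono)
    show "(4 * real R + 1) ^ ?d \<le> 2 ^ ?d * b"
      unfolding b_def power_mult_distrib[symmetric] by (intro power_mono) auto
    show "0 \<le> \<rho>" unfolding \<rho>_def density_A_def by (intro integral_nonneg_AE) simp
  qed
  also have "\<dots> = sqrt b * (2 ^ ?d * sqrt b * \<rho>)"
    using b1 real_sqrt_mult_self[of b] by (simp add: mult_ac)
  finally have "sqrt b * (1 / 32) \<le> sqrt b * (2 ^ ?d * sqrt b * \<rho>)" by simp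
  moreover have sb: "0 < sqrt b" using b1 by simp
  ultimately have "1 / 32 \<le> 2 ^ ?d * sqrt b * \<rho>" by (simp only: mult_le_cancel_left_pos)
  moreover have "0 < 32 * 2 ^ ?d * sqrt b" using sb by simp
  ultimately have \<rho>: "1 / (32 * 2 ^ ?d * sqrt b) \<le> \<rho>"
    unfolding pos_divide_le_eq[OF \<open>0 < 32 * 2 ^ ?d * sqrt b\<close>] by (simp add: mult_ac)
  have "sqrt b \<le> sqrt ((11 * s) ^ ?d)" using b_le by simp
  also have "(11 * s) ^ ?d = (11 * s) powr real ?d"
    using s1 by (intro powr_realpow[symmetric]) simp
  also have "sqrt \<dots> = ((11 * s) powr real ?d) powr (1 / 2)"
    by (rule powr_half_sqrt[symmetric]) simp
  also have "\<dots> = (11 * s) powr (real ?d / 2)"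
    by (simp add: powr_powr)
  also have "\<dots> = 11 powr (real ?d / 2) * s powr (real ?d / 2)"
    using s1 by (simp add: powr_mult)
  also have "s powr (real ?d / 2) = (t * ln t) powr (real ?d / 4)"
  proof -
    have "s = (t * ln t) powr (1 / 2)"
      unfolding s_def using ln1 t by (intro powr_half_sqrt[symmetric]) simp
    thus ?thesis by (simp add: powr_powr)
  qed
  finally have le: "sqrt b \<le> 11 powr (real ?d / 2) * (t * ln t) powr (real ?d / 4)" (is "_ \<le> ?P") .
  have P: "0 < ?P" using sb le by linarith
  have "32 * 2 ^ ?d * sqrt b \<le> 32 * 2 ^ ?d * ?P" using le by (intro mult_left_mono) simp_all
  hence "1 / (32 * 2 ^ ?d * ?P) \<le> 1 / (32 * 2 ^ ?d * sqrt b)"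
    by (rule divide_left_mono[OF _ zero_le_one]) (intro mult_pos_pos sb P zero_less_power, simp_all)
  hence "1 / (32 * 2 ^ ?d * ?P) \<le> density_A M \<zeta> 0 t" using \<rho> unfolding \<rho>_def by (rule order.trans)
  moreover have "1 / (32 * 2 ^ ?d * ?P) =
      1 / (32 * 2 ^ ?d * 11 powr (real ?d / 2)) * (1 / (t * ln t) powr (real ?d / 4))"
    unfolding times_divide_times_eq mult.assoc by simp
  ultimately show ?thesis unfolding powr_minus_divide by simp
qed

theorem theorem1p1:
  assumes "CARD('d::finite) \<in> {1, 2, 3}"
  shows "\<exists>C>0. \<forall>rB. 0 \<le> rB \<and> rB \<le> 1 \<longrightarrow>
           (\<forall>(M :: 'a measure) (\<zeta> :: real \<Rightarrow> 'a \<Rightarrow> (int ^ 'd) config).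
              DLAS M lattice_nbrs 1 rB (1 / 2) \<zeta> \<longrightarrow>
              (\<forall>\<^sub>F t in at_top.
                 density_A M \<zeta> 0 t \<ge> C * (t * ln t) powr (- (real CARD('d) / 4))))"
proof (intro exI conjI allI impI)
  \<comment> \<open>The constant depends on the dimension alone, and so does not involve
    \<open>rB\<close>.\<close>
  show "0 < 1 / (32 * 2 ^ CARD('d) * 11 powr (real CARD('d) / 2))" by simp
  fix rB and M :: "'a measure" and \<zeta> :: "real \<Rightarrow> 'a \<Rightarrow> (int ^ 'd) config"
  assume rB: "0 \<le> rB \<and> rB \<le> 1" and D: "DLAS M lattice_nbrs 1 rB (1 / 2) \<zeta>"
  show "\<forall>\<^sub>F t in at_top. 1 / (32 * 2 ^ CARD('d) * 11 powr (real CARD('d) / 2)) *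
      (t * ln t) powr (- (real CARD('d) / 4)) \<le> density_A M \<zeta> 0 t"
    using eventually_ge_at_top[of 1000]
    by eventually_elim (rule density_A_lower_bound[OF _ _ _ D], use assms rB in auto)
qed

end
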